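(* Let $n\in\mathbf N$, $A\in\mathbb G^\infty_{n\times n}$, $t_0\in I$, $x_0\in\mathbf C^n$, and let $f\in\mathcal R^{n\prime}$ satisfy $f=0$ for $t<t_0$. For $\alpha\in\mathbf C$ let $y\in\mathcal R^{n\prime}$ be the unique solution of $$y'-A(t)y=f+x_0\delta_{t_0}^\alpha,\qquad y=0\ \text{ if } t<t_0 ;$$ this $y$ is called the solution of the Cauchy problem $x'-A(t)x=f$, $x=x_0$ if $t<t_0$. Then: 1) The solution of the Cauchy problem $x'-A(t)x=f$, $x=x_0$ if $t<t_0$, does not depend on the choice of $\alpha\in\mathbf C$. 2) If $f$ is a regular distribution, then the solution of the Cauchy problem $x'-A(t)x=f$, $x=x_0$ if $t<t_0$, coincides for $t>t_0$ with the solution of the corresponding ordinary Cauchy problem $$x'-A(t)x=f(t),\quad t>t_0,\qquad x(t_0+)=x_0 .$$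
   Context: $I=(a,b)\subset\mathbf R$ is an open interval (e.g. $I=\mathbf R$), $\mathbf N_0=\mathbf N\cup\{0\}$; functions are identified when equal almost everywhere. $\mathbb G$ is the algebra of essentially bounded $g:I\to\mathbf C$ possessing both limits $g(t\pm)=\operatorname{ess\,lim}_{s\to t\pm}g(s)$ at every $t\in I$; $\sigma_t(g):=g(t+)-g(t-)$. $\mathbb G^\infty$ is the algebra of $g\in\mathbb G$ such that for every $k\in\mathbf N$ there is $g^{(k)}\in\mathbb G$ with $g^{(k)}(t\pm)=\operatorname{ess\,lim}_{s\to t\pm}\frac{g^{(k-1)}(s)-g^{(k-1)}(t\pm)}{s-t}$ for all $t\in I$ ($g^{(0)}=g$), with the norms $\|g\|_k=\max_{0\le i\le k}\|g^{(i)}\|_{L_\infty}$, $k\in\mathbf N_0$. For $g\in\mathbb G$, $\operatorname{supp}(g)$ is the closure in $I$ of $\{t: g(t-)\ne0\text{ or }g(t+)\ne0\}$. $\mathcal R$ is the space of $\varphi\in\mathbb G^\infty$ with compact support in $I$, with the locally convex inductive limit topology of the countably normed spaces $\{\varphi\in\mathbb G^\infty:\varphi=0\text{ outside }J\}$ (norms $\|\cdot\|_k$), $J$ running over bounded subintervals with $\bar J\subset I$. $\mathcal R'$ is the space of continuous linear functionals $f:\mathcal R\to\mathbf C$, $\varphi\mapsto(f,\varphi)$, with the weak* topology. A locally summable function $f$ on $I$ is identified with the (regular) distribution $(f,\varphi)=\int_I f\varphi\,dt$. For $g\in\mathbb G^\infty$, $f\in\mathcal R'$: $(gf,\varphi):=(f,g\varphi)$.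 For $\alpha\in\mathbf C$, $(\delta_{t_0}^\alpha,\varphi):=\alpha\varphi(t_0+)+(1-\alpha)\varphi(t_0-)$. Derivative: let $\mathbb C$ be the bounded continuous functions on $I$; $\mathbb F_k\subset\mathbb G^\infty$ is the set of $g$ with $g^{(i)}\in\mathbb C$ for all $i\ne k$ and $g^{(k)}$ piecewise continuous (locally finitely many discontinuities); $\mathbb F$ is the linear span of all $\mathbb F_k$, $k\in\mathbf N_0$; $\mathcal R_F=\mathcal R\cap\mathbb F$. $\Delta\subset\mathcal R'$ is the set of $g\in\mathcal R'$ for which there is $c:I\to\mathbf C$ with $(g,\varphi)=\sum_{t\in I}c(t)\sigma_t(\varphi)$ for all $\varphi\in\mathcal R_F$ (a finite sum). For $f\in\mathcal R'$ let $(\frac{df}{dt},\varphi):=-(f,\varphi')$; a derivative of $f$ is any element $f'$ of $D(f):=\frac{df}{dt}+\Delta$ (differentiation is multivalued). $\mathcal R^{n\prime}$ is the space of $\mathbf C^n$-valued distributions ($n$-tuples of elements of $\mathcal R'$, operations componentwise), and $\mathbb G^\infty_{n\times n}$ the $n\times n$ matrices with entries in $\mathbb G^\infty$. "$f=0$ for $t<t_0$" means $(f,\varphi)=0$ for all $\varphi\in\mathcal R$ with $\operatorname{supp}(\varphi)\subset(a,t_0)$. A solution of $y'-A(t)y=h$ is $y\in\mathcal R^{n\prime}$ having some derivative $y'\in D(y)$ (componentwise) with $(y'-Ay,\varphi)=(h,\varphi)$ for all $\varphi\in\mathcal R$; for $h$ vanishing for $t<t_0$ the solution vanishing for $t<t_0$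 exists and is unique. The ordinary Cauchy problem is understood in the sense of locally absolutely continuous functions on $(t_0,b)$ satisfying the equation a.e. *)

theory Defs
  imports "HOL-Analysis.Analysis" "HOL-Probability.Essential_Supremum"
begin

text \<open>
  Functions on the open interval \<open>I\<close> that are identified when equal almost everywhere are
  represented by arbitrary representatives \<open>real \<Rightarrow> complex\<close>; values outside \<open>I\<close> are irrelevant.
  All notions below depend only on the class of the representative.
\<close>

type_synonym cfun = "real \<Rightarrow> complex"
type_synonym distr = "cfun \<Rightarrow> complex"


subsection \<open>Regulated functions and their one-sided derivatives\<close>

text \<open>\<open>(g \<longlongrightarrow> l) (ess_at_right t)\<close> says that for every \<open>e > 0\<close> there is \<open>d > 0\<close> such that
  \<open>|g s - l| < e\<close> for almost every \<open>s\<close> in \<open>]t, t + d[\<close>, i.e. it is the essential right limit.\<close>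

definition ess_at_right :: "real \<Rightarrow> real filter" where
  "ess_at_right t = inf (at_right t) (ae_filter lebesgue)"

definition ess_at_left :: "real \<Rightarrow> real filter" where
  "ess_at_left t = inf (at_left t) (ae_filter lebesgue)"

definition rlim :: "cfun \<Rightarrow> real \<Rightarrow> complex" where
  "rlim g t = Lim (ess_at_right t) g"

definition llim :: "cfun \<Rightarrow> real \<Rightarrow> complex" where
  "llim g t = Lim (ess_at_left t) g"

definition jump :: "real \<Rightarrow> cfun \<Rightarrow> complex" where
  "jump t g = rlim g t - llim g t"

definition ae_eq :: "real set \<Rightarrow> cfun \<Rightarrow> cfun \<Rightarrow> bool" where
  "ae_eq I g h \<longleftrightarrow> (AE t in lebesgue_on I. g t = h t)"

definition GG :: "real set \<Rightarrow> cfun set" where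
  "GG I = {g. g \<in> borel_measurable (lebesgue_on I) \<and>
              (\<exists>C. AE t in lebesgue_on I. norm (g t) \<le> C) \<and>
              (\<forall>t\<in>I. (\<exists>l. (g \<longlongrightarrow> l) (ess_at_left t)) \<and> (\<exists>l. (g \<longlongrightarrow> l) (ess_at_right t)))}"

definition is_gderiv :: "real set \<Rightarrow> cfun \<Rightarrow> cfun \<Rightarrow> bool" where
  "is_gderiv I g h \<longleftrightarrow> h \<in> GG I \<and>
     (\<forall>t\<in>I. ((\<lambda>s. (g s - rlim g t) / complex_of_real (s - t)) \<longlongrightarrow> rlim h t) (ess_at_right t) \<and>
            ((\<lambda>s. (g s - llim g t) / complex_of_real (s - t)) \<longlongrightarrow> llim h t) (ess_at_left t))"

definition Ginf :: "real set \<Rightarrow> cfun set" where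
  "Ginf I = {g \<in> GG I. \<exists>d :: nat \<Rightarrow> cfun. d 0 = g \<and> (\<forall>k. is_gderiv I (d k) (d (Suc k)))}"

text \<open>The derivative is determined up to equality almost everywhere (an element of \<open>GG I\<close> is
  determined by its one-sided limits); \<open>gderiv\<close> picks a representative, which depends only on
  the class of \<open>g\<close>.\<close>

definition gderiv :: "real set \<Rightarrow> cfun \<Rightarrow> cfun" where
  "gderiv I g = (SOME h. is_gderiv I g h)"

definition Linf_norm :: "real set \<Rightarrow> cfun \<Rightarrow> real" where
  "Linf_norm I g = real_of_ereal (esssup (lebesgue_on I) (\<lambda>t. ereal (norm (g t))))"

definition gnorm :: "real set \<Rightarrow> nat \<Rightarrow> cfun \<Rightarrow> real" where
  "gnorm I k g = Max ((\<lambda>i. Linf_norm I ((gderiv I ^^ i) g)) ` {..k})"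

definition gsupp :: "real set \<Rightarrow> cfun \<Rightarrow> real set" where
  "gsupp I g = I \<inter> closure {t \<in> I. llim g t \<noteq> 0 \<or> rlim g t \<noteq> 0}"


subsection \<open>The test space and its locally convex inductive limit topology\<close>

definition RR :: "real set \<Rightarrow> cfun set" where
  "RR I = {\<phi> \<in> Ginf I. compact (gsupp I \<phi>)}"

definition RR_on :: "real set \<Rightarrow> real set \<Rightarrow> cfun set" where
  "RR_on I J = {\<phi> \<in> Ginf I. AE t in lebesgue_on I. t \<notin> J \<longrightarrow> \<phi> t = 0}"

text \<open>The inductive limit topology is the finest locally convex topology on \<open>RR I\<close> making all
  inclusions of the spaces \<open>RR_on I J\<close>, normed by \<open>gnorm I k\<close> for all \<open>k\<close>, continuous.  A base of
  its neighbourhoods of \<open>0\<close> consists of the absolutely convex sets whose trace on every step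
  space is a neighbourhood of \<open>0\<close> there.\<close>

definition base_nhd :: "real set \<Rightarrow> cfun set \<Rightarrow> bool" where
  "base_nhd I V \<longleftrightarrow> V \<subseteq> RR I \<and>
     (\<forall>\<phi>\<in>V. \<forall>\<psi>\<in>V. \<forall>c d. norm c + norm d \<le> 1 \<longrightarrow> (\<lambda>t. c * \<phi> t + d * \<psi> t) \<in> V) \<and>
     (\<forall>J. is_interval J \<and> bounded J \<and> closure J \<subseteq> I \<longrightarrow>
        (\<exists>k. \<exists>e>0. {\<psi> \<in> RR_on I J. gnorm I k \<psi> < e} \<subseteq> V))"

definition RR_open :: "real set \<Rightarrow> cfun set \<Rightarrow> bool" where
  "RR_open I U \<longleftrightarrow> U \<subseteq> RR I \<and>
     (\<forall>\<phi>\<in>U. \<exists>V. base_nhd I V \<and> (\<forall>\<psi>\<in>V. (\<lambda>t. \<phi> t + \<psi> t) \<in> U))"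

definition RR_topology :: "real set \<Rightarrow> cfun topology" where
  "RR_topology I = topology (RR_open I)"

lemma gnorm_mono: "j \<le> k \<Longrightarrow> gnorm I j g \<le> gnorm I k g"
  unfolding gnorm_def by (rule Max_mono) auto

lemma base_nhd_Int:
  assumes "base_nhd I V" "base_nhd I W"
  shows "base_nhd I (V \<inter> W)"
proof -
  have "\<exists>k. \<exists>e>0. {\<psi> \<in> RR_on I J. gnorm I k \<psi> < e} \<subseteq> V \<inter> W"
    if J: "is_interval J \<and> bounded J \<and> closure J \<subseteq> I" for J
  proof -
    obtain k e where 1: "e > 0" "{\<psi> \<in> RR_on I J. gnorm I k \<psi> < e} \<subseteq> V"
      using assms(1) J unfolding base_nhd_def by meson
    obtain k' e' where 2: "e' > 0" "{\<psi> \<in> RR_on I J. gnorm I k' \<psi> < e'} \<subseteq> W"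
      using assms(2) J unfolding base_nhd_def by meson
    have "gnorm I k \<psi> < e \<and> gnorm I k' \<psi> < e'" if "gnorm I (max k k') \<psi> < min e e'" for \<psi>
      using that gnorm_mono[of k "max k k'" I \<psi>] gnorm_mono[of k' "max k k'" I \<psi>] by simp
    then have "{\<psi> \<in> RR_on I J. gnorm I (max k k') \<psi> < min e e'} \<subseteq> V \<inter> W"
      using 1(2) 2(2) by blast
    moreover have "min e e' > 0"
      using 1(1) 2(1) by simp
    ultimately show ?thesis
      by blast
  qed
  moreover have "V \<inter> W \<subseteq> RR I"
    using assms(1) unfolding base_nhd_def by blast
  moreover have "(\<lambda>t. c * \<phi> t + d * \<psi> t) \<in> V \<inter> W"
    if "\<phi> \<in> V \<inter> W" "\<psi> \<in> V \<inter> W" "norm c + norm d \<le> 1" for \<phi> \<psi> c d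
    using assms that unfolding base_nhd_def by simp
  ultimately show ?thesis
    unfolding base_nhd_def by simp
qed

lemma openin_RR_topology: "openin (RR_topology I) = RR_open I"
proof -
  have "istopology (RR_open I)"
    unfolding istopology_def
  proof (intro conjI allI impI)
    fix S T assume "RR_open I S" "RR_open I T"
    then show "RR_open I (S \<inter> T)"
      unfolding RR_open_def by (metis Int_iff base_nhd_Int le_infI1)
  next
    fix K assume "\<forall>S\<in>K. RR_open I S"
    then show "RR_open I (\<Union>K)"
      unfolding RR_open_def by (meson Union_iff Union_least)
  qed
  then show ?thesis
    by (simp add: RR_topology_def)
qed


subsection \<open>Distributions\<close>

text \<open>On representatives \<open>RR_topology\<close> is not Hausdorff: a function vanishing almost everywhere
  lies in every neighbourhood of \<open>0\<close>.  Hence a continuous linear functional automatically takes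
  equal values at test functions that agree almost everywhere.  A distribution is only specified
  on \<open>RR I\<close>; equality of distributions means equality on \<open>RR I\<close>.\<close>

definition RR_dual :: "real set \<Rightarrow> distr set" where
  "RR_dual I = {f. (\<forall>\<phi>\<in>RR I. \<forall>\<psi>\<in>RR I. f (\<lambda>t. \<phi> t + \<psi> t) = f \<phi> + f \<psi>) \<and>
                   (\<forall>c. \<forall>\<phi>\<in>RR I. f (\<lambda>t. c * \<phi> t) = c * f \<phi>) \<and>
                   continuous_map (RR_topology I) euclidean f}"

definition eq_distr :: "real set \<Rightarrow> distr \<Rightarrow> distr \<Rightarrow> bool" where
  "eq_distr I f g \<longleftrightarrow> (\<forall>\<phi>\<in>RR I. f \<phi> = g \<phi>)"

definition locally_summable :: "real set \<Rightarrow> cfun \<Rightarrow> bool" where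
  "locally_summable I F \<longleftrightarrow> (\<forall>K. compact K \<and> K \<subseteq> I \<longrightarrow> set_integrable lebesgue K F)"

definition regular :: "real set \<Rightarrow> cfun \<Rightarrow> distr" where
  "regular I F = (\<lambda>\<phi>. set_lebesgue_integral lebesgue I (\<lambda>t. F t * \<phi> t))"

definition mult_distr :: "cfun \<Rightarrow> distr \<Rightarrow> distr" where
  "mult_distr g f = (\<lambda>\<phi>. f (\<lambda>t. g t * \<phi> t))"

definition delta :: "real \<Rightarrow> complex \<Rightarrow> distr" where
  "delta t0 \<alpha> = (\<lambda>\<phi>. \<alpha> * rlim \<phi> t0 + (1 - \<alpha>) * llim \<phi> t0)"

text \<open>\<open>f = 0\<close> for \<open>t < t0\<close>.\<close>

definition zero_before :: "real set \<Rightarrow> real \<Rightarrow> distr \<Rightarrow> bool" where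
  "zero_before I t0 f \<longleftrightarrow> (\<forall>\<phi>\<in>RR I. gsupp I \<phi> \<subseteq> I \<inter> {..<t0} \<longrightarrow> f \<phi> = 0)"


subsection \<open>Multivalued differentiation\<close>

definition bdd_cont :: "real set \<Rightarrow> cfun \<Rightarrow> bool" where
  "bdd_cont I g \<longleftrightarrow> (\<exists>h. ae_eq I g h \<and> continuous_on I h \<and> bounded (h ` I))"

definition pw_cont :: "real set \<Rightarrow> cfun \<Rightarrow> bool" where
  "pw_cont I g \<longleftrightarrow> (\<exists>h. ae_eq I g h \<and>
     (\<forall>K. compact K \<and> K \<subseteq> I \<longrightarrow> finite {t \<in> K. \<not> isCont h t}))"

definition FF_k :: "real set \<Rightarrow> nat \<Rightarrow> cfun set" where
  "FF_k I k = {g \<in> Ginf I. (\<forall>i. i \<noteq> k \<longrightarrow> bdd_cont I ((gderiv I ^^ i) g)) \<and>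
                           pw_cont I ((gderiv I ^^ k) g)}"

definition FF :: "real set \<Rightarrow> cfun set" where
  "FF I = {g. \<exists>S c. finite S \<and> S \<subseteq> (\<Union>k. FF_k I k) \<and> g = (\<lambda>t. \<Sum>h\<in>S. c h * h t)}"

definition RR_F :: "real set \<Rightarrow> cfun set" where
  "RR_F I = RR I \<inter> FF I"

text \<open>The index set of the sum is finite, since a compactly supported element of \<open>FF I\<close> has only
  finitely many jumps.\<close>

definition Delta :: "real set \<Rightarrow> distr set" where
  "Delta I = {g \<in> RR_dual I. \<exists>c :: real \<Rightarrow> complex. \<forall>\<phi>\<in>RR_F I.
                g \<phi> = (\<Sum>t | t \<in> I \<and> jump t \<phi> \<noteq> 0. c t * jump t \<phi>)}"

definition ddt :: "real set \<Rightarrow> distr \<Rightarrow> distr" where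
  "ddt I f = (\<lambda>\<phi>. - f (gderiv I \<phi>))"

definition derivatives :: "real set \<Rightarrow> distr \<Rightarrow> distr set" where
  "derivatives I f = {f' \<in> RR_dual I. \<exists>g\<in>Delta I. eq_distr I f' (\<lambda>\<phi>. ddt I f \<phi> + g \<phi>)}"


subsection \<open>Linear systems\<close>

definition solution ::
    "real set \<Rightarrow> (real \<Rightarrow> complex^'n^'n) \<Rightarrow> ('n::finite \<Rightarrow> distr) \<Rightarrow> ('n \<Rightarrow> distr) \<Rightarrow> bool" where
  "solution I A h y \<longleftrightarrow> (\<forall>i. y i \<in> RR_dual I) \<and>
     (\<exists>y'. (\<forall>i. y' i \<in> derivatives I (y i)) \<and>
           (\<forall>i. eq_distr I (\<lambda>\<phi>. y' i \<phi> - (\<Sum>j\<in>UNIV. mult_distr (\<lambda>t. A t $ i $ j) (y j) \<phi>)) (h i)))"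

definition cauchy_solution ::
    "real set \<Rightarrow> (real \<Rightarrow> complex^'n^'n) \<Rightarrow> ('n::finite \<Rightarrow> distr) \<Rightarrow> real \<Rightarrow> complex^'n \<Rightarrow> complex
      \<Rightarrow> ('n \<Rightarrow> distr) \<Rightarrow> bool" where
  "cauchy_solution I A f t0 x0 \<alpha> y \<longleftrightarrow>
     solution I A (\<lambda>i \<phi>. f i \<phi> + x0 $ i * delta t0 \<alpha> \<phi>) y \<and> (\<forall>i. zero_before I t0 (y i))"

definition abs_cont_on :: "real \<Rightarrow> real \<Rightarrow> (real \<Rightarrow> 'a::metric_space) \<Rightarrow> bool" where
  "abs_cont_on c d x \<longleftrightarrow>
     (\<forall>e>0. \<exists>r>0. \<forall>P :: (real \<times> real) set. finite P \<and>
        (\<forall>(u, v)\<in>P. c \<le> u \<and> u \<le> v \<and> v \<le> d) \<and>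
        pairwise (\<lambda>(u, v) (u', v'). {u<..<v} \<inter> {u'<..<v'} = {}) P \<and>
        (\<Sum>(u, v)\<in>P. v - u) < r
        \<longrightarrow> (\<Sum>(u, v)\<in>P. dist (x u) (x v)) < e)"

text \<open>Ordinary Cauchy problem \<open>x' - A(t) x = F(t)\<close> for \<open>t > t0\<close>, \<open>x(t0+) = x0\<close>.\<close>

definition ordinary_solution ::
    "real set \<Rightarrow> (real \<Rightarrow> complex^'n^'n) \<Rightarrow> (real \<Rightarrow> complex^'n) \<Rightarrow> real \<Rightarrow> complex^'n
      \<Rightarrow> (real \<Rightarrow> complex^'n::finite) \<Rightarrow> bool" where
  "ordinary_solution I A F t0 x0 x \<longleftrightarrow>
     (\<forall>c d. c \<le> d \<and> {c..d} \<subseteq> I \<inter> {t0<..} \<longrightarrow> abs_cont_on c d x) \<and>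
     (AE t in lebesgue_on (I \<inter> {t0<..}). \<exists>x'. (x has_vector_derivative x') (at t) \<and>
                                             x' - A t *v x t = F t) \<and>
     (x \<longlongrightarrow> x0) (at_right t0)"

end

theory Submission
  imports Defs
begin

text \<open>
  For a test function \<open>\<phi>\<close> and an index \<open>k\<close> one solves the adjoint system
  \<open>- \<eta>\<^sub>j' - \<Sum>\<^sub>i A\<^sub>i\<^sub>j \<eta>\<^sub>i = \<delta>\<^sub>j\<^sub>k \<phi>\<close> backwards from the right end of the support of \<open>\<phi>\<close> to a point
  left of \<open>t0\<close> and joins \<open>\<eta>\<close> linearly to \<open>0\<close>.  The \<open>\<eta>\<^sub>j\<close> are test functions without jumps.  Elements of
  \<open>Delta\<close> vanish on such functions: they vanish on the continuous elements of \<open>RR_F\<close>, and these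
  approximate every continuous test function, since near each point the latter is as close to an
  interpolating polynomial as one wishes, with any given number of derivatives.  Testing the
  equation with \<open>\<eta>\<close> therefore gives
  \<open>y\<^sub>k(\<phi>) = \<Sum>\<^sub>i f\<^sub>i(\<eta>\<^sub>i) + x0\<^sub>i \<eta>\<^sub>i(t0)\<close>, where \<open>\<alpha>\<close> does not occur because \<open>\<eta>\<close> is continuous at \<open>t0\<close>.
  For regular \<open>f\<close>, integrating the derivative of \<open>\<Sum>\<^sub>i x\<^sub>i \<eta>\<^sub>i\<close> over \<open>{s..d}\<close> and letting \<open>s\<close> tend to \<open>t0\<close> shows
  that the ordinary solution \<open>x\<close> satisfies the same formula.
\<close>

subsection \<open>Essential one-sided limits\<close>

text \<open>The coefficients may have jumps accumulating inside I, and the derivatives of \<eta>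
  inherit them, so \<eta> need not lie in \<open>RR_F\<close>, where alone the elements of
  \<open>Delta\<close> are given by a formula. Hence the density argument. The approximants must
  themselves be free of jumps, which forces each polynomial piece to take the right values at both
  ends of its interval; jumps of their derivatives are harmless. Elements of \<open>FF_k\<close>
  have bounded derivatives on all of I, which may be unbounded, and at most one derivative that
  jumps: powers of t - u cut off at u have the right jumps, and a logistic factor restores
  boundedness. That \<eta> is a test function looks circular, since its derivative contains \<eta>
  again. \<open>Ginf\<close> is therefore treated coinductively: if an algebra of regulated
  functions contains a derivative of each of its generators, it is contained in \<open>Ginf\<close>.
  The linear join to 0 violates the adjoint equation, but only left of a point e < t0. The defect is
  a test function supported in {..e}, and the solution vanishes on it.\<close>

lemma eventually_ess_at_right:
  "eventually P (ess_at_right t) \<longleftrightarrow> (\<exists>d>0. AE s in lebesgue. t < s \<and> s < t + d \<longrightarrow> P s)"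
proof
  assume "eventually P (ess_at_right t)"
  then obtain Q R where Q: "eventually Q (at_right t)" and R: "AE s in lebesgue. R s"
    and QR: "\<And>s. Q s \<and> R s \<Longrightarrow> P s"
    unfolding ess_at_right_def eventually_inf by blast
  then obtain b where b: "b > t" "\<And>s. t < s \<Longrightarrow> s < b \<Longrightarrow> Q s"
    unfolding eventually_at_right_field by blast
  have "AE s in lebesgue. t < s \<and> s < t + (b - t) \<longrightarrow> P s"
    using R by eventually_elim (use b QR in auto)
  then show "\<exists>d>0. AE s in lebesgue. t < s \<and> s < t + d \<longrightarrow> P s"
    using b(1) by (intro exI[of _ "b - t"]) auto
next
  assume "\<exists>d>0. AE s in lebesgue. t < s \<and> s < t + d \<longrightarrow> P s"
  then obtain d where d: "d > 0" "AE s in lebesgue. t < s \<and> s < t + d \<longrightarrow> P s" by blast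
  have "eventually (\<lambda>s. t < s \<and> s < t + d) (at_right t)"
    unfolding eventually_at_right_field using d(1) by (intro exI[of _ "t + d"]) auto
  then show "eventually P (ess_at_right t)"
    unfolding ess_at_right_def eventually_inf using d(2) by blast
qed

lemma eventually_ess_at_left:
  "eventually P (ess_at_left t) \<longleftrightarrow> (\<exists>d>0. AE s in lebesgue. t - d < s \<and> s < t \<longrightarrow> P s)"
proof
  assume "eventually P (ess_at_left t)"
  then obtain Q R where Q: "eventually Q (at_left t)" and R: "AE s in lebesgue. R s"
    and QR: "\<And>s. Q s \<and> R s \<Longrightarrow> P s"
    unfolding ess_at_left_def eventually_inf by blast
  then obtain b where b: "b < t" "\<And>s. b < s \<Longrightarrow> s < t \<Longrightarrow> Q s"
    unfolding eventually_at_left_field by blast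
  have "AE s in lebesgue. t - (t - b) < s \<and> s < t \<longrightarrow> P s"
    using R by eventually_elim (use b QR in auto)
  then show "\<exists>d>0. AE s in lebesgue. t - d < s \<and> s < t \<longrightarrow> P s"
    using b(1) by (intro exI[of _ "t - b"]) auto
next
  assume "\<exists>d>0. AE s in lebesgue. t - d < s \<and> s < t \<longrightarrow> P s"
  then obtain d where d: "d > 0" "AE s in lebesgue. t - d < s \<and> s < t \<longrightarrow> P s" by blast
  have "eventually (\<lambda>s. t - d < s \<and> s < t) (at_left t)"
    unfolding eventually_at_left_field using d(1) by (intro exI[of _ "t - d"]) auto
  then show "eventually P (ess_at_left t)"
    unfolding ess_at_left_def eventually_inf using d(2) by blast
qed

text \<open>Nonempty open intervals have positive measure; this makes the essential one-sided
  filters proper and their limits unique.\<close>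

lemma not_AE_notin_Ioo:
  assumes "a < b"
  shows "\<not> (AE s in lebesgue. \<not> (a < s \<and> s < (b::real)))"
proof
  assume "AE s in lebesgue. \<not> (a < s \<and> s < b)"
  then have "{a<..<b} \<in> null_sets lebesgue"
    using AE_iff_null_sets[of "{a<..<b}" lebesgue] by (simp add: greaterThanLessThan_def)
  then show False
    using assms by (simp add: null_sets_def)
qed

lemma ess_at_right_neq_bot [simp]: "ess_at_right t \<noteq> bot"
proof
  assume "ess_at_right t = bot"
  then have "eventually (\<lambda>_. False) (ess_at_right t)" by simp
  then obtain d where "d > 0" "AE s in lebesgue. \<not> (t < s \<and> s < t + d)"
    unfolding eventually_ess_at_right by auto
  then show False using not_AE_notin_Ioo[of t "t + d"] by simp
qed

lemma ess_at_left_neq_bot [simp]: "ess_at_left t \<noteq> bot"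
proof
  assume "ess_at_left t = bot"
  then have "eventually (\<lambda>_. False) (ess_at_left t)" by simp
  then obtain d where "d > 0" "AE s in lebesgue. \<not> (t - d < s \<and> s < t)"
    unfolding eventually_ess_at_left by auto
  then show False using not_AE_notin_Ioo[of "t - d" t] by simp
qed

lemma rlim_eqI: "(g \<longlongrightarrow> l) (ess_at_right t) \<Longrightarrow> rlim g t = l"
  unfolding rlim_def by (rule tendsto_Lim) simp_all

lemma llim_eqI: "(g \<longlongrightarrow> l) (ess_at_left t) \<Longrightarrow> llim g t = l"
  unfolding llim_def by (rule tendsto_Lim) simp_all

lemma tendsto_ess_at_right: "(g \<longlongrightarrow> l) (at_right t) \<Longrightarrow> (g \<longlongrightarrow> l) (ess_at_right t)"
  unfolding ess_at_right_def by (rule tendsto_mono[OF inf_le1])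

lemma tendsto_ess_at_left: "(g \<longlongrightarrow> l) (at_left t) \<Longrightarrow> (g \<longlongrightarrow> l) (ess_at_left t)"
  unfolding ess_at_left_def by (rule tendsto_mono[OF inf_le1])

lemma eventually_ess_at_right_Ioo: "t < b \<Longrightarrow> eventually (\<lambda>s. t < s \<and> s < b) (ess_at_right t)"
  unfolding eventually_ess_at_right by (intro exI[of _ "b - t"]) auto

lemma eventually_ess_at_left_Ioo: "b < t \<Longrightarrow> eventually (\<lambda>s. b < s \<and> s < t) (ess_at_left t)"
  unfolding eventually_ess_at_left by (intro exI[of _ "t - b"]) auto

lemma AE_eventually_ess_at_right:
  assumes "open I" "t \<in> I" "AE s\<in>I in lebesgue. P s"
  shows "eventually P (ess_at_right t)"
proof -
  obtain e where e: "e > 0" "ball t e \<subseteq> I" using assms(1,2) openE by blast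
  have "AE s in lebesgue. t < s \<and> s < t + e \<longrightarrow> P s"
    using assms(3) by eventually_elim (use e in \<open>auto simp: dist_real_def subset_eq\<close>)
  then show ?thesis unfolding eventually_ess_at_right using e(1) by blast
qed

lemma AE_eventually_ess_at_left:
  assumes "open I" "t \<in> I" "AE s\<in>I in lebesgue. P s"
  shows "eventually P (ess_at_left t)"
proof -
  obtain e where e: "e > 0" "ball t e \<subseteq> I" using assms(1,2) openE by blast
  have "AE s in lebesgue. t - e < s \<and> s < t \<longrightarrow> P s"
    using assms(3) by eventually_elim (use e in \<open>auto simp: dist_real_def subset_eq\<close>)
  then show ?thesis unfolding eventually_ess_at_left using e(1) by blast
qed

lemma AE_lebesgue_neq: "AE s in lebesgue. s \<noteq> (t::real)"
proof -
  have "{t} \<in> null_sets lebesgue" by (simp add: null_sets_def)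
  then show ?thesis using AE_iff_null_sets[of "{t}" lebesgue] by simp
qed

text \<open>The exceptional set is null near each of its points, hence null by the Lindelof property
  of the line.\<close>

lemma AE_if_ess_locally:
  assumes "\<And>t. t \<in> I \<Longrightarrow> eventually P (ess_at_left t) \<and> eventually P (ess_at_right t)"
  shows "AE s\<in>I in lebesgue. P s"
proof -
  let ?N = "{s \<in> I. \<not> P s}"
  have "negligible ?N"
  proof (rule locally_negligible_alt[THEN iffD2], rule ballI)
    fix t assume t: "t \<in> ?N"
    then have "eventually P (ess_at_left t)" "eventually P (ess_at_right t)"
      using assms by auto
    then obtain d d' where d: "d > 0" "AE s in lebesgue. t - d < s \<and> s < t \<longrightarrow> P s"
      "d' > 0" "AE s in lebesgue. t < s \<and> s < t + d' \<longrightarrow> P s"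
      unfolding eventually_ess_at_left eventually_ess_at_right by blast
    \<comment> \<open>The two one-sided neighbourhoods miss only the point t itself, which is a null
      set.\<close>
    have "AE s in lebesgue. s \<notin> ?N \<inter> {t - d<..<t + d'}"
      using d(2) d(4) AE_lebesgue_neq[of t] by eventually_elim force
    then have "negligible (?N \<inter> {t - d<..<t + d'})"
      unfolding negligible_iff_null_sets
      by (simp add: completion.null_sets_iff_AE)
    moreover have "openin (top_of_set ?N) (?N \<inter> {t - d<..<t + d'})"
      by (simp add: openin_open_Int)
    moreover have "t \<in> ?N \<inter> {t - d<..<t + d'}"
      using t d by auto
    ultimately show "\<exists>U. openin (top_of_set ?N) U \<and> t \<in> U \<and> negligible U" by blast
  qed
  then have "?N \<in> null_sets lebesgue" by (simp add: negligible_iff_null_sets)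
  then have "AE s in lebesgue. s \<notin> ?N" by (rule AE_not_in)
  then show ?thesis by eventually_elim auto
qed

lemma AE_lebesgue_on_iff:
  "open I \<Longrightarrow> (AE s in lebesgue_on I. P s) \<longleftrightarrow> (AE s\<in>I in lebesgue. P s)"
  by (rule AE_restrict_space_iff) auto

subsection \<open>The algebra of regulated functions\<close>

locale open_domain =
  fixes I :: "real set"
  assumes open_I: "open I"
begin

lemma GG_tendsto_right: "g \<in> GG I \<Longrightarrow> t \<in> I \<Longrightarrow> (g \<longlongrightarrow> rlim g t) (ess_at_right t)"
  unfolding GG_def by (auto dest!: bspec simp: rlim_eqI)

lemma GG_tendsto_left: "g \<in> GG I \<Longrightarrow> t \<in> I \<Longrightarrow> (g \<longlongrightarrow> llim g t) (ess_at_left t)"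
  unfolding GG_def by (auto dest!: bspec simp: llim_eqI)

lemma GG_bounded:
  assumes "g \<in> GG I"
  obtains C where "C \<ge> 0" "AE s\<in>I in lebesgue. norm (g s) \<le> C"
proof -
  obtain C where "AE s\<in>I in lebesgue. norm (g s) \<le> C"
    using assms unfolding GG_def AE_lebesgue_on_iff[OF open_I] by blast
  then have "AE s\<in>I in lebesgue. norm (g s) \<le> max C 0" by eventually_elim auto
  then show ?thesis using that[of "max C 0"] by simp
qed

lemma GG_I:
  assumes "g \<in> borel_measurable (lebesgue_on I)" "AE s\<in>I in lebesgue. norm (g s) \<le> C"
    "\<And>t. t \<in> I \<Longrightarrow> \<exists>l. (g \<longlongrightarrow> l) (ess_at_left t)" "\<And>t. t \<in> I \<Longrightarrow> \<exists>l. (g \<longlongrightarrow> l) (ess_at_right t)"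
  shows "g \<in> GG I"
  unfolding GG_def AE_lebesgue_on_iff[OF open_I] using assms by blast

lemma GG_measurable: "g \<in> GG I \<Longrightarrow> g \<in> borel_measurable (lebesgue_on I)"
  by (simp add: GG_def)

lemma GG_add:
  assumes "g \<in> GG I" "h \<in> GG I"
  shows "(\<lambda>t. g t + h t) \<in> GG I"
proof -
  obtain C where C: "AE s\<in>I in lebesgue. norm (g s) \<le> C"
    by (rule GG_bounded[OF assms(1)])
  obtain D where D: "AE s\<in>I in lebesgue. norm (h s) \<le> D"
    by (rule GG_bounded[OF assms(2)])
  have "AE s\<in>I in lebesgue. norm (g s + h s) \<le> C + D"
    using C D by eventually_elim (meson norm_triangle_mono)
  then show ?thesis
    by (rule GG_I[rotated])
      (use GG_measurable[OF assms(1)] GG_measurable[OF assms(2)]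
        tendsto_add[OF GG_tendsto_left[OF assms(1)] GG_tendsto_left[OF assms(2)]]
        tendsto_add[OF GG_tendsto_right[OF assms(1)] GG_tendsto_right[OF assms(2)]] in \<open>blast+\<close>,
       use GG_measurable[OF assms(1)] GG_measurable[OF assms(2)] in simp)
qed

lemma GG_mult:
  assumes "g \<in> GG I" "h \<in> GG I"
  shows "(\<lambda>t. g t * h t) \<in> GG I"
proof -
  obtain C where C: "C \<ge> 0" "AE s\<in>I in lebesgue. norm (g s) \<le> C"
    by (rule GG_bounded[OF assms(1)])
  obtain D where D: "AE s\<in>I in lebesgue. norm (h s) \<le> D"
    by (rule GG_bounded[OF assms(2)])
  have "AE s\<in>I in lebesgue. norm (g s * h s) \<le> C * D"
    using C(2) D by eventually_elim (auto simp: norm_mult C(1) intro!: mult_mono)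
  then show ?thesis
    by (rule GG_I[rotated])
      (use GG_measurable[OF assms(1)] GG_measurable[OF assms(2)]
        tendsto_mult[OF GG_tendsto_left[OF assms(1)] GG_tendsto_left[OF assms(2)]]
        tendsto_mult[OF GG_tendsto_right[OF assms(1)] GG_tendsto_right[OF assms(2)]] in \<open>blast+\<close>,
       use GG_measurable[OF assms(1)] GG_measurable[OF assms(2)] in simp)
qed

lemma GG_const: "(\<lambda>t. c) \<in> GG I"
  by (rule GG_I[where C = "norm c"]) auto

lemma rlim_add: "g \<in> GG I \<Longrightarrow> h \<in> GG I \<Longrightarrow> t \<in> I \<Longrightarrow> rlim (\<lambda>s. g s + h s) t = rlim g t + rlim h t"
  by (intro rlim_eqI tendsto_add GG_tendsto_right)

lemma llim_add: "g \<in> GG I \<Longrightarrow> h \<in> GG I \<Longrightarrow> t \<in> I \<Longrightarrow> llim (\<lambda>s. g s + h s) t = llim g t + llim h t"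
  by (intro llim_eqI tendsto_add GG_tendsto_left)

lemma rlim_mult: "g \<in> GG I \<Longrightarrow> h \<in> GG I \<Longrightarrow> t \<in> I \<Longrightarrow> rlim (\<lambda>s. g s * h s) t = rlim g t * rlim h t"
  by (intro rlim_eqI tendsto_mult GG_tendsto_right)

lemma llim_mult: "g \<in> GG I \<Longrightarrow> h \<in> GG I \<Longrightarrow> t \<in> I \<Longrightarrow> llim (\<lambda>s. g s * h s) t = llim g t * llim h t"
  by (intro llim_eqI tendsto_mult GG_tendsto_left)

lemma rlim_const: "rlim (\<lambda>s. c) t = c"
  by (intro rlim_eqI tendsto_const)

lemma llim_const: "llim (\<lambda>s. c) t = c"
  by (intro llim_eqI tendsto_const)

text \<open>Where g is almost everywhere within e of some l on an open interval, limits taken inside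
  that interval are within e of l as well, so g and L differ by at most 2 * e there. One-sided
  neighbourhoods of this kind exist at every point; the side from which L t is taken may vary with
  t.\<close>

lemma AE_eq_one_sided_limit:
  assumes "g \<in> GG I"
    and L: "\<And>t. t \<in> I \<Longrightarrow> (g \<longlongrightarrow> L t) (ess_at_right t) \<or> (g \<longlongrightarrow> L t) (ess_at_left t)"
  shows "AE t\<in>I in lebesgue. g t = L t"
proof -
  have near: "AE s in lebesgue. u < s \<and> s < v \<longrightarrow> norm (g s - L s) \<le> 2 * e"
    if l: "AE s in lebesgue. u < s \<and> s < v \<longrightarrow> dist (g s) l < e" and uv: "{u<..<v} \<subseteq> I"
    for u v e l
    using l
  proof eventually_elim
      case (elim s)
      show ?case
      proof
        assume s: "u < s \<and> s < v"
        have "\<forall>\<^sub>F r in ess_at_right s. dist (g r) l \<le> e"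
          by (rule AE_eventually_ess_at_right[of "{u<..<v}"]) (use s l in \<open>auto elim!: eventually_mono\<close>)
        moreover have "\<forall>\<^sub>F r in ess_at_left s. dist (g r) l \<le> e"
          by (rule AE_eventually_ess_at_left[of "{u<..<v}"]) (use s l in \<open>auto elim!: eventually_mono\<close>)
        ultimately have "dist (L s) l \<le> e"
          using L[of s] s uv tendsto_upperbound[OF tendsto_dist[OF _ tendsto_const], of g "L s" _ l e]
            ess_at_right_neq_bot ess_at_left_neq_bot by (metis greaterThanLessThan_iff subsetD)
        then show "norm (g s - L s) \<le> 2 * e"
          using elim s dist_triangle2[of "g s" "L s" l] by (auto simp: dist_norm)
      qed
  qed
  have e: "AE s\<in>I in lebesgue. norm (g s - L s) \<le> 2 * e" if "e > 0" for e
  proof (rule AE_if_ess_locally, intro conjI)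
    fix t assume t: "t \<in> I"
    then obtain r where r: "r > 0" "ball t r \<subseteq> I" using open_I openE by blast
    obtain d where d: "d > 0" "AE s in lebesgue. t < s \<and> s < t + d \<longrightarrow> dist (g s) (rlim g t) < e"
      using tendstoD[OF GG_tendsto_right[OF assms(1) t] \<open>e > 0\<close>] unfolding eventually_ess_at_right
      by blast
    have "AE s in lebesgue. t < s \<and> s < t + min d r \<longrightarrow> norm (g s - L s) \<le> 2 * e"
      using d(2) r(2)
      by (intro near[of t _ "rlim g t"]) (auto simp: dist_real_def subset_eq elim!: eventually_mono)
    then show "\<forall>\<^sub>F s in ess_at_right t. norm (g s - L s) \<le> 2 * e"
      unfolding eventually_ess_at_right using d r by (intro exI[of _ "min d r"]) auto
    obtain d where d: "d > 0" "AE s in lebesgue. t - d < s \<and> s < t \<longrightarrow> dist (g s) (llim g t) < e"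
      using tendstoD[OF GG_tendsto_left[OF assms(1) t] \<open>e > 0\<close>] unfolding eventually_ess_at_left
      by blast
    have "AE s in lebesgue. t - min d r < s \<and> s < t \<longrightarrow> norm (g s - L s) \<le> 2 * e"
      using d(2) r(2)
      by (intro near[of _ t "llim g t"]) (auto simp: dist_real_def subset_eq elim!: eventually_mono)
    then show "\<forall>\<^sub>F s in ess_at_left t. norm (g s - L s) \<le> 2 * e"
      unfolding eventually_ess_at_left using d r by (intro exI[of _ "min d r"]) auto
  qed
  have "AE s in lebesgue. \<forall>n::nat. s \<in> I \<longrightarrow> norm (g s - L s) \<le> 2 * inverse (Suc n)"
    unfolding AE_all_countable using e by simp
  then show ?thesis
  proof eventually_elim
    case (elim s)
    show ?case
    proof
      assume "s \<in> I"
      then have "\<exists>N. \<forall>n\<ge>N. norm (g s - L s) \<le> 2 * inverse (real (Suc n))"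
        using elim by blast
      moreover have "(\<lambda>n. 2 * inverse (real (Suc n))) \<longlonglongrightarrow> 2 * 0"
        by (intro tendsto_mult tendsto_const LIMSEQ_inverse_real_of_nat)
      ultimately have "norm (g s - L s) \<le> 2 * 0"
        by (intro LIMSEQ_le_const)
      then show "g s = L s" by simp
    qed
  qed
qed

lemma AE_eq_rlim: "g \<in> GG I \<Longrightarrow> AE t\<in>I in lebesgue. g t = rlim g t"
  by (rule AE_eq_one_sided_limit) (auto dest: GG_tendsto_right)

lemma AE_eq_llim: "g \<in> GG I \<Longrightarrow> AE t\<in>I in lebesgue. g t = llim g t"
  by (rule AE_eq_one_sided_limit) (auto dest: GG_tendsto_left)

end

subsection \<open>One-sided derivatives\<close>

text \<open>Links ordinary derivatives with the difference quotients that \<open>is_gderiv\<close>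
  is made of.\<close>

lemma has_vector_derivative_iff_quotient:
  fixes f :: cfun
  shows "(f has_vector_derivative D) (at t) \<longleftrightarrow>
    ((\<lambda>s. (f s - f t) / complex_of_real (s - t)) \<longlongrightarrow> D) (at t)"
proof -
  have "norm ((f s - f t - (s - t) *\<^sub>R D) /\<^sub>R norm (s - t))
      = norm ((f s - f t) / complex_of_real (s - t) - D)" if "s \<noteq> t" for s
  proof -
    have eq: "(f s - f t) / complex_of_real (s - t) - D
        = (f s - f t - (s - t) *\<^sub>R D) / complex_of_real (s - t)"
      using that by (simp add: diff_divide_distrib scaleR_conv_of_real del: of_real_diff)
    show ?thesis
      unfolding eq norm_divide norm_scaleR norm_of_real by (simp add: divide_inverse)
  qed
  then have "((\<lambda>s. norm ((f s - f t - (s - t) *\<^sub>R D) /\<^sub>R norm (s - t))) \<longlongrightarrow> 0) (at t) \<longleftrightarrow>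
      ((\<lambda>s. norm ((f s - f t) / complex_of_real (s - t) - D)) \<longlongrightarrow> 0) (at t)"
    by (intro filterlim_cong) (auto simp: eventually_at_filter)
  then show ?thesis
    unfolding tendsto_norm_zero_iff LIM_zero_iff has_vector_derivative_def has_derivative_at_within
    by (simp add: bounded_linear_scaleR_left)
qed

context open_domain
begin

lemma rlim_cong_AE:
  "t \<in> I \<Longrightarrow> AE s\<in>I in lebesgue. g s = h s \<Longrightarrow> rlim g t = rlim h t"
  unfolding rlim_def by (rule Lim_cong) (auto intro: AE_eventually_ess_at_right[OF open_I])

lemma llim_cong_AE:
  "t \<in> I \<Longrightarrow> AE s\<in>I in lebesgue. g s = h s \<Longrightarrow> llim g t = llim h t"
  unfolding llim_def by (rule Lim_cong) (auto intro: AE_eventually_ess_at_left[OF open_I])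

lemma AE_eq_if_rlim_eq:
  assumes "g \<in> GG I" "h \<in> GG I" "\<And>t. t \<in> I \<Longrightarrow> rlim g t = rlim h t"
  shows "AE t\<in>I in lebesgue. g t = h t"
  using AE_eq_rlim[OF assms(1)] AE_eq_rlim[OF assms(2)] by eventually_elim (use assms(3) in auto)

lemma is_gderiv_GG: "is_gderiv I g h \<Longrightarrow> h \<in> GG I"
  by (simp add: is_gderiv_def)

lemma is_gderiv_right:
  "is_gderiv I g h \<Longrightarrow> t \<in> I \<Longrightarrow>
    ((\<lambda>s. (g s - rlim g t) / complex_of_real (s - t)) \<longlongrightarrow> rlim h t) (ess_at_right t)"
  unfolding is_gderiv_def by blast

lemma is_gderiv_left:
  "is_gderiv I g h \<Longrightarrow> t \<in> I \<Longrightarrow>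
    ((\<lambda>s. (g s - llim g t) / complex_of_real (s - t)) \<longlongrightarrow> llim h t) (ess_at_left t)"
  unfolding is_gderiv_def by blast

lemma is_gderiv_const: "is_gderiv I (\<lambda>t. c) (\<lambda>t. 0)"
  unfolding is_gderiv_def by (simp add: GG_const rlim_const llim_const)

lemma is_gderiv_add:
  assumes "g1 \<in> GG I" "g2 \<in> GG I" "is_gderiv I g1 h1" "is_gderiv I g2 h2"
  shows "is_gderiv I (\<lambda>t. g1 t + g2 t) (\<lambda>t. h1 t + h2 t)"
proof -
  have h: "h1 \<in> GG I" "h2 \<in> GG I" using assms(3,4) by (auto dest: is_gderiv_GG)
  have *: "(a + b - (a' + b')) / c = (a - a') / c + (b - b') / c" for a b a' b' c :: complex
    by (simp add: add_divide_distrib diff_divide_distrib)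
  show ?thesis
    unfolding is_gderiv_def
  proof (intro conjI ballI GG_add h)
    fix t assume t: "t \<in> I"
    show "((\<lambda>s. (g1 s + g2 s - rlim (\<lambda>t. g1 t + g2 t) t) / complex_of_real (s - t))
        \<longlongrightarrow> rlim (\<lambda>t. h1 t + h2 t) t) (ess_at_right t)"
      unfolding rlim_add[OF assms(1,2) t] rlim_add[OF h t] *
      by (intro tendsto_add is_gderiv_right assms t)
    show "((\<lambda>s. (g1 s + g2 s - llim (\<lambda>t. g1 t + g2 t) t) / complex_of_real (s - t))
        \<longlongrightarrow> llim (\<lambda>t. h1 t + h2 t) t) (ess_at_left t)"
      unfolding llim_add[OF assms(1,2) t] llim_add[OF h t] *
      by (intro tendsto_add is_gderiv_left assms t)
  qed
qed

lemma is_gderiv_mult: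
  assumes "g1 \<in> GG I" "g2 \<in> GG I" "is_gderiv I g1 h1" "is_gderiv I g2 h2"
  shows "is_gderiv I (\<lambda>t. g1 t * g2 t) (\<lambda>t. h1 t * g2 t + g1 t * h2 t)"
proof -
  have h: "h1 \<in> GG I" "h2 \<in> GG I" using assms(3,4) by (auto dest: is_gderiv_GG)
  have *: "(a * b - a' * b') / c = (a - a') / c * b + a' * ((b - b') / c)" for a b a' b' c :: complex
    by (simp add: add_divide_distrib diff_divide_distrib algebra_simps)
  show ?thesis
    unfolding is_gderiv_def
  proof (intro conjI ballI GG_add GG_mult h assms(1,2))
    fix t assume t: "t \<in> I"
    show "((\<lambda>s. (g1 s * g2 s - rlim (\<lambda>t. g1 t * g2 t) t) / complex_of_real (s - t))
        \<longlongrightarrow> rlim (\<lambda>t. h1 t * g2 t + g1 t * h2 t) t) (ess_at_right t)"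
      unfolding rlim_mult[OF assms(1,2) t] rlim_add[OF GG_mult[OF h(1) assms(2)] GG_mult[OF assms(1) h(2)] t]
        rlim_mult[OF h(1) assms(2) t] rlim_mult[OF assms(1) h(2) t] *
      by (intro tendsto_add tendsto_mult tendsto_const GG_tendsto_right is_gderiv_right assms t)
    show "((\<lambda>s. (g1 s * g2 s - llim (\<lambda>t. g1 t * g2 t) t) / complex_of_real (s - t))
        \<longlongrightarrow> llim (\<lambda>t. h1 t * g2 t + g1 t * h2 t) t) (ess_at_left t)"
      unfolding llim_mult[OF assms(1,2) t] llim_add[OF GG_mult[OF h(1) assms(2)] GG_mult[OF assms(1) h(2)] t]
        llim_mult[OF h(1) assms(2) t] llim_mult[OF assms(1) h(2) t] *
      by (intro tendsto_add tendsto_mult tendsto_const GG_tendsto_left is_gderiv_left assms t)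
  qed
qed

lemma is_gderiv_diff:
  assumes "g1 \<in> GG I" "g2 \<in> GG I" "is_gderiv I g1 h1" "is_gderiv I g2 h2"
  shows "is_gderiv I (\<lambda>t. g1 t - g2 t) (\<lambda>t. h1 t - h2 t)"
  using is_gderiv_add[OF assms(1) GG_mult[OF GG_const[of "-1"] assms(2)] assms(3)
      is_gderiv_mult[OF GG_const[of "-1"] assms(2) is_gderiv_const assms(4)]] by simp

lemma is_gderiv_cong_AE:
  assumes "is_gderiv I g h" "AE t\<in>I in lebesgue. g t = g' t"
  shows "is_gderiv I g' h"
proof -
  have "((\<lambda>s. (g' s - rlim g' t) / complex_of_real (s - t)) \<longlongrightarrow> rlim h t) (ess_at_right t)"
    "((\<lambda>s. (g' s - llim g' t) / complex_of_real (s - t)) \<longlongrightarrow> llim h t) (ess_at_left t)" if t: "t \<in> I" for t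
  proof -
    have r: "\<forall>\<^sub>F s in ess_at_right t. g s = g' s" and l: "\<forall>\<^sub>F s in ess_at_left t. g s = g' s"
      by (rule AE_eventually_ess_at_right[OF open_I t assms(2)] AE_eventually_ess_at_left[OF open_I t assms(2)])+
    show "((\<lambda>s. (g' s - rlim g' t) / complex_of_real (s - t)) \<longlongrightarrow> rlim h t) (ess_at_right t)"
      by (rule Lim_transform_eventually[OF is_gderiv_right[OF assms(1) t]])
        (use r rlim_cong_AE[OF t assms(2)] in \<open>auto elim!: eventually_mono\<close>)
    show "((\<lambda>s. (g' s - llim g' t) / complex_of_real (s - t)) \<longlongrightarrow> llim h t) (ess_at_left t)"
      by (rule Lim_transform_eventually[OF is_gderiv_left[OF assms(1) t]])
        (use l llim_cong_AE[OF t assms(2)] in \<open>auto elim!: eventually_mono\<close>)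
  qed
  then show ?thesis
    unfolding is_gderiv_def using is_gderiv_GG[OF assms(1)] by blast
qed

lemma is_gderiv_unique:
  assumes "is_gderiv I g h" "is_gderiv I g h'"
  shows "AE t\<in>I in lebesgue. h t = h' t"
proof (intro AE_eq_if_rlim_eq is_gderiv_GG[OF assms(1)] is_gderiv_GG[OF assms(2)])
  fix t assume t: "t \<in> I"
  show "rlim h t = rlim h' t"
    by (rule tendsto_unique[OF ess_at_right_neq_bot is_gderiv_right[OF assms(1) t] is_gderiv_right[OF assms(2) t]])
qed

lemma is_gderiv_gderiv: "is_gderiv I g h \<Longrightarrow> is_gderiv I g (gderiv I g)"
  unfolding gderiv_def by (rule someI[of "is_gderiv I g"])

lemma gderiv_AE: "is_gderiv I g h \<Longrightarrow> AE t\<in>I in lebesgue. gderiv I g t = h t"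
  by (rule is_gderiv_unique[OF is_gderiv_gderiv])

text \<open>\<open>gderiv\<close> picks an unspecified representative at every step. Derivatives are
  unique almost everywhere and \<open>is_gderiv\<close> respects equality almost everywhere in the
  first function, so the iterates of \<open>gderiv\<close> follow any given chain of
  derivatives.\<close>

lemma gderiv_funpow_AE:
  assumes "\<And>k. is_gderiv I (d k) (d (Suc k))" "AE t\<in>I in lebesgue. d 0 t = g t"
  shows "AE t\<in>I in lebesgue. d k t = (gderiv I ^^ k) g t"
    and "is_gderiv I ((gderiv I ^^ k) g) ((gderiv I ^^ Suc k) g)"
proof -
  have ae: "AE t\<in>I in lebesgue. d k t = (gderiv I ^^ k) g t" for k
  proof (induction k)
    case (Suc k)
    have "is_gderiv I ((gderiv I ^^ k) g) (d (Suc k))"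
      by (rule is_gderiv_cong_AE[OF assms(1) Suc])
    from gderiv_AE[OF this] show ?case by eventually_elim simp
  qed (use assms in simp)
  show "AE t\<in>I in lebesgue. d k t = (gderiv I ^^ k) g t" by (rule ae)
  have "is_gderiv I ((gderiv I ^^ k) g) (d (Suc k))"
    by (rule is_gderiv_cong_AE[OF assms(1) ae])
  then show "is_gderiv I ((gderiv I ^^ k) g) ((gderiv I ^^ Suc k) g)"
    using is_gderiv_gderiv[of "(gderiv I ^^ k) g"] by simp
qed

section \<open>The algebra \<open>Ginf\<close> of infinitely differentiable regulated
  functions\<close>

lemma Ginf_coinduct:
  assumes "g \<in> X" "X \<subseteq> GG I" "\<And>g. g \<in> X \<Longrightarrow> \<exists>h\<in>X. is_gderiv I g h"
  shows "g \<in> Ginf I"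
proof -
  have "\<exists>d. \<forall>n::nat. (d n \<in> X \<and> (n = 0 \<longrightarrow> d n = g)) \<and> is_gderiv I (d n) (d (Suc n))"
    by (rule dependent_nat_choice) (use assms in auto)
  then show ?thesis
    unfolding Ginf_def using assms by blast
qed

lemma Ginf_GG: "g \<in> Ginf I \<Longrightarrow> g \<in> GG I"
  by (simp add: Ginf_def)

lemma Ginf_funpow:
  assumes "g \<in> Ginf I"
  shows "is_gderiv I ((gderiv I ^^ k) g) ((gderiv I ^^ Suc k) g)"
  using assms gderiv_funpow_AE(2)[of _ g k] unfolding Ginf_def by auto

lemma Ginf_gderiv:
  assumes "g \<in> Ginf I"
  shows "is_gderiv I g (gderiv I g)" "gderiv I g \<in> Ginf I"
proof -
  show "is_gderiv I g (gderiv I g)" using Ginf_funpow[OF assms, of 0] by simp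
  then have "gderiv I g \<in> GG I" by (rule is_gderiv_GG)
  moreover have "is_gderiv I ((gderiv I ^^ k) (gderiv I g)) ((gderiv I ^^ Suc k) (gderiv I g))" for k
    using Ginf_funpow[OF assms, of "Suc k"] by (simp add: funpow_swap1)
  ultimately show "gderiv I g \<in> Ginf I"
    unfolding Ginf_def by (intro CollectI conjI exI[of _ "\<lambda>k. (gderiv I ^^ k) (gderiv I g)"]) auto
qed

text \<open>The vehicle of coinduction: once the generators have derivatives in the generated
  algebra, the sum and product rules provide one for every element. Applied to \<open>Ginf I\<close>
  it yields the closure properties; later it is applied to \<open>Ginf I\<close> enlarged by
  functions whose derivatives involve these functions again.\<close>

inductive_set algebra_gen :: "cfun set \<Rightarrow> cfun set" for B where
  base: "g \<in> B \<Longrightarrow> g \<in> algebra_gen B"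
| add: "g \<in> algebra_gen B \<Longrightarrow> h \<in> algebra_gen B \<Longrightarrow> (\<lambda>t. g t + h t) \<in> algebra_gen B"
| mult: "g \<in> algebra_gen B \<Longrightarrow> h \<in> algebra_gen B \<Longrightarrow> (\<lambda>t. g t * h t) \<in> algebra_gen B"

lemma algebra_gen_subset_GG: "B \<subseteq> GG I \<Longrightarrow> algebra_gen B \<subseteq> GG I"
proof
  fix g assume "B \<subseteq> GG I" "g \<in> algebra_gen B"
  from this(2,1) show "g \<in> GG I" by induction (auto intro: GG_add GG_mult)
qed

lemma algebra_gen_subset_Ginf:
  assumes "B \<subseteq> GG I" "\<And>g. g \<in> B \<Longrightarrow> \<exists>h\<in>algebra_gen B. is_gderiv I g h"
  shows "algebra_gen B \<subseteq> Ginf I"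
proof
  have "\<exists>h\<in>algebra_gen B. is_gderiv I g h" if "g \<in> algebra_gen B" for g
    using that
  proof induction
    case (add g1 g2)
    then obtain h1 h2 where "h1 \<in> algebra_gen B" "h2 \<in> algebra_gen B" "is_gderiv I g1 h1" "is_gderiv I g2 h2" by blast
    with add show ?case
      using is_gderiv_add[of g1 g2 h1 h2] algebra_gen_subset_GG[OF assms(1)] algebra_gen.add by blast
  next
    case (mult g1 g2)
    then obtain h1 h2 where "h1 \<in> algebra_gen B" "h2 \<in> algebra_gen B" "is_gderiv I g1 h1" "is_gderiv I g2 h2" by blast
    with mult show ?case
      using is_gderiv_mult[of g1 g2 h1 h2] algebra_gen_subset_GG[OF assms(1)]
        algebra_gen.add[OF algebra_gen.mult[of h1 B g2] algebra_gen.mult[of g1 B h2]] by blast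
  qed (use assms in blast)
  then show "g \<in> Ginf I" if "g \<in> algebra_gen B" for g
    using that Ginf_coinduct algebra_gen_subset_GG[OF assms(1)] by blast
qed

lemma algebra_gen_Ginf: "algebra_gen (Ginf I) = Ginf I"
proof
  show "algebra_gen (Ginf I) \<subseteq> Ginf I"
    by (rule algebra_gen_subset_Ginf) (use Ginf_GG Ginf_gderiv algebra_gen.base in blast)+
qed (auto intro: algebra_gen.base)

lemma Ginf_add: "g \<in> Ginf I \<Longrightarrow> h \<in> Ginf I \<Longrightarrow> (\<lambda>t. g t + h t) \<in> Ginf I"
  using algebra_gen.add[of g "Ginf I" h] by (simp add: algebra_gen_Ginf)

lemma Ginf_mult: "g \<in> Ginf I \<Longrightarrow> h \<in> Ginf I \<Longrightarrow> (\<lambda>t. g t * h t) \<in> Ginf I"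
  using algebra_gen.mult[of g "Ginf I" h] by (simp add: algebra_gen_Ginf)

lemma Ginf_const: "(\<lambda>t. c) \<in> Ginf I"
  by (rule Ginf_coinduct[of _ "range (\<lambda>c t. c)"]) (auto simp: GG_const intro: is_gderiv_const)

lemma Ginf_cmult: "g \<in> Ginf I \<Longrightarrow> (\<lambda>t. c * g t) \<in> Ginf I"
  by (rule Ginf_mult[OF Ginf_const])

lemma Ginf_uminus: "g \<in> Ginf I \<Longrightarrow> (\<lambda>t. - g t) \<in> Ginf I"
  using Ginf_cmult[of g "-1"] by simp

lemma Ginf_diff: "g \<in> Ginf I \<Longrightarrow> h \<in> Ginf I \<Longrightarrow> (\<lambda>t. g t - h t) \<in> Ginf I"
  using Ginf_add[OF _ Ginf_uminus, of g h] by simp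

subsection \<open>Functions given by two smooth pieces\<close>

context
  fixes p q :: cfun and u :: real
  assumes cont_p: "continuous_on UNIV p" and cont_q: "continuous_on UNIV q"
begin

text \<open>At t = u the limit from the right belongs to q and the limit from the left to p, hence
  \<open>t < u\<close> in one formula and \<open>t \<le> u\<close> in the other. With p = q the
  lemma also gives the one-sided limits of continuous functions.\<close>

lemma piecewise_tendsto:
  "((\<lambda>t. if t < u then p t else q t) \<longlongrightarrow> (if t < u then p t else q t)) (ess_at_right t)"
  "((\<lambda>t. if t < u then p t else q t) \<longlongrightarrow> (if t \<le> u then p t else q t)) (ess_at_left t)"
proof -
  have p: "(p \<longlongrightarrow> p t) (at_right t)" "(p \<longlongrightarrow> p t) (at_left t)"
    and q: "(q \<longlongrightarrow> q t) (at_right t)" "(q \<longlongrightarrow> q t) (at_left t)"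
    using cont_p cont_q by (auto simp: continuous_on_def intro: tendsto_within_subset)
  have "\<forall>\<^sub>F s in ess_at_right t. (if t < u then p s else q s) = (if s < u then p s else q s)"
  proof (cases "t < u")
    case True
    then show ?thesis using eventually_ess_at_right_Ioo[OF True] by (auto elim!: eventually_mono)
  next
    case False
    then show ?thesis using eventually_ess_at_right_Ioo[of t "t + 1"] by (auto elim!: eventually_mono)
  qed
  then show "((\<lambda>t. if t < u then p t else q t) \<longlongrightarrow> (if t < u then p t else q t)) (ess_at_right t)"
    by (rule Lim_transform_eventually[rotated]) (use p q tendsto_ess_at_right in auto)
  have "\<forall>\<^sub>F s in ess_at_left t. (if t \<le> u then p s else q s) = (if s < u then p s else q s)"
  proof (cases "t \<le> u")
    case True
    then show ?thesis using eventually_ess_at_left_Ioo[of "t - 1" t] by (auto elim!: eventually_mono)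
  next
    case False
    then show ?thesis using eventually_ess_at_left_Ioo[of u t] by (auto elim!: eventually_mono)
  qed
  then show "((\<lambda>t. if t < u then p t else q t) \<longlongrightarrow> (if t \<le> u then p t else q t)) (ess_at_left t)"
    by (rule Lim_transform_eventually[rotated]) (use p q tendsto_ess_at_left in auto)
qed

lemmas rlim_piecewise = rlim_eqI[OF piecewise_tendsto(1)]
lemmas llim_piecewise = llim_eqI[OF piecewise_tendsto(2)]

lemma GG_piecewise:
  assumes "\<And>t. t \<in> I \<Longrightarrow> norm (if t < u then p t else q t) \<le> C"
  shows "(\<lambda>t. if t < u then p t else q t) \<in> GG I"
proof (rule GG_I[where C = C])
  have [measurable]: "p \<in> borel_measurable borel" "q \<in> borel_measurable borel"
    using cont_p cont_q by (auto intro: borel_measurable_continuous_onI)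
  have "(\<lambda>t. if t < u then p t else q t) \<in> borel_measurable borel" by measurable
  then show "(\<lambda>t. if t < u then p t else q t) \<in> borel_measurable (lebesgue_on I)"
    by (intro measurable_restrict_space1 measurable_completion) simp
qed (use assms piecewise_tendsto in \<open>auto simp del: if_split\<close>)

lemma is_gderiv_piecewise:
  assumes p': "\<And>t. (p has_vector_derivative p' t) (at t)" "continuous_on UNIV p'"
    and q': "\<And>t. (q has_vector_derivative q' t) (at t)" "continuous_on UNIV q'"
    and bdd: "\<And>t. t \<in> I \<Longrightarrow> norm (if t < u then p' t else q' t) \<le> C"
  shows "is_gderiv I (\<lambda>t. if t < u then p t else q t) (\<lambda>t. if t < u then p' t else q' t)"
proof -
  note r' = open_domain.rlim_piecewise[OF open_domain_axioms p'(2) q'(2), of u]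
    and l' = open_domain.llim_piecewise[OF open_domain_axioms p'(2) q'(2), of u]
  note quot = has_vector_derivative_iff_quotient[THEN iffD1]
  have R: "(\<lambda>s. (f s - f t) / complex_of_real (s - t)) \<midarrow>t\<rightarrow> D \<Longrightarrow>
      ((\<lambda>s. (f s - f t) / complex_of_real (s - t)) \<longlongrightarrow> D) (ess_at_right t)"
    and L: "(\<lambda>s. (f s - f t) / complex_of_real (s - t)) \<midarrow>t\<rightarrow> D \<Longrightarrow>
      ((\<lambda>s. (f s - f t) / complex_of_real (s - t)) \<longlongrightarrow> D) (ess_at_left t)" for f :: cfun and D t
    by (auto intro!: tendsto_ess_at_right tendsto_ess_at_left intro: tendsto_within_subset)
  have "((\<lambda>s. ((if s < u then p s else q s) - (if t < u then p t else q t)) / complex_of_real (s - t))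
      \<longlongrightarrow> (if t < u then p' t else q' t)) (ess_at_right t)" for t
  proof (cases "t < u")
    case True
    have "((\<lambda>s. ((if s < u then p s else q s) - p t) / complex_of_real (s - t)) \<longlongrightarrow> p' t) (ess_at_right t)"
      by (rule Lim_transform_eventually[OF R[OF quot[OF p'(1)]]])
        (use eventually_ess_at_right_Ioo[OF True] in \<open>auto elim!: eventually_mono\<close>)
    with True show ?thesis by simp
  next
    case False
    have "((\<lambda>s. ((if s < u then p s else q s) - q t) / complex_of_real (s - t)) \<longlongrightarrow> q' t) (ess_at_right t)"
      by (rule Lim_transform_eventually[OF R[OF quot[OF q'(1)]]])
        (use False eventually_ess_at_right_Ioo[of t "t + 1"] in \<open>auto elim!: eventually_mono\<close>)
    with False show ?thesis by simp
  qed
  moreover have "((\<lambda>s. ((if s < u then p s else q s) - (if t \<le> u then p t else q t)) / complex_of_real (s - t))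
      \<longlongrightarrow> (if t \<le> u then p' t else q' t)) (ess_at_left t)" for t
  proof (cases "t \<le> u")
    case True
    have "((\<lambda>s. ((if s < u then p s else q s) - p t) / complex_of_real (s - t)) \<longlongrightarrow> p' t) (ess_at_left t)"
      by (rule Lim_transform_eventually[OF L[OF quot[OF p'(1)]]])
        (use True eventually_ess_at_left_Ioo[of "t - 1" t] in \<open>auto elim!: eventually_mono\<close>)
    with True show ?thesis by simp
  next
    case False
    then have "u < t" by simp
    have "((\<lambda>s. ((if s < u then p s else q s) - q t) / complex_of_real (s - t)) \<longlongrightarrow> q' t) (ess_at_left t)"
      by (rule Lim_transform_eventually[OF L[OF quot[OF q'(1)]]])
        (use eventually_ess_at_left_Ioo[OF \<open>u < t\<close>] in \<open>auto elim!: eventually_mono\<close>)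
    with False show ?thesis by simp
  qed
  ultimately show ?thesis
    unfolding is_gderiv_def r' l' rlim_piecewise llim_piecewise
    using open_domain.GG_piecewise[OF open_domain_axioms p'(2) q'(2), of u C] bdd by blast
qed

end

text \<open>Step functions have derivative 0 in this calculus and so count as smooth. Test functions
  can therefore be cut off abruptly and remain test functions.\<close>

lemma Ginf_cut: "(\<lambda>t. if t < u then c else d) \<in> Ginf I"
proof (rule Ginf_coinduct[of _ "range (\<lambda>(c, d) t. if t < u then c else d)"])
  have "is_gderiv I (\<lambda>t. if t < u then c else d) (\<lambda>t. if t < u then 0 else 0)" for c d
    by (rule is_gderiv_piecewise[where C = 0]) (auto intro!: continuous_intros derivative_eq_intros)
  then have *: "is_gderiv I (\<lambda>t. if t < u then c else d) (\<lambda>t. 0)" for c d by simp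
  show "\<exists>h\<in>range (\<lambda>(c, d) t. if t < u then c else d). is_gderiv I g h"
    if "g \<in> range (\<lambda>(c, d) t. if t < u then c else d)" for g
    using that * by (intro bexI[of _ "\<lambda>t. 0"]) (auto intro!: image_eqI[of _ _ "(0,0)"])
  show "range (\<lambda>(c, d) t. if t < u then c else d) \<subseteq> GG I"
  proof clarify
    fix c d show "(\<lambda>t. if t < u then c else d) \<in> GG I"
      by (rule GG_piecewise[where C = "max (norm c) (norm d)"]) (auto intro: continuous_intros)
  qed
qed auto

end

subsection \<open>Test functions and distributions\<close>

locale open_interval = open_domain +
  assumes interval_I: "is_interval I" and nonempty_I: "I \<noteq> {}"
begin

lemma compact_subset_Icc:
  assumes "compact K" "K \<subseteq> I" "t0 \<in> I"
  obtains c d where "c < t0" "t0 < d" "{c..d} \<subseteq> I" "K \<subseteq> {c<..<d}"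
proof -
  define L where "L = insert t0 K"
  have L: "compact L" "L \<noteq> {}" "L \<subseteq> I" using assms by (auto simp: L_def)
  obtain u where u: "u \<in> L" "\<And>x. x \<in> L \<Longrightarrow> u \<le> x" using compact_attains_inf[OF L(1,2)] by blast
  obtain v where v: "v \<in> L" "\<And>x. x \<in> L \<Longrightarrow> x \<le> v" using compact_attains_sup[OF L(1,2)] by blast
  obtain r where r: "r > 0" "cball u r \<subseteq> I" using open_I u(1) L(3) open_contains_cball by blast
  obtain s where s: "s > 0" "cball v s \<subseteq> I" using open_I v(1) L(3) open_contains_cball by blast
  have in_I: "u - r \<in> I" "v + s \<in> I" using r s by (auto simp: dist_real_def subset_eq)
  show ?thesis
  proof (rule that[of "u - r" "v + s"])
    show "u - r < t0" "t0 < v + s" using u(2)[of t0] v(2)[of t0] r(1) s(1) by (auto simp: L_def)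
    show "{u - r..v + s} \<subseteq> I" using mem_is_interval_1_I[OF interval_I in_I] by auto
    show "K \<subseteq> {u - r<..<v + s}"
    proof
      fix x assume "x \<in> K"
      then show "x \<in> {u - r<..<v + s}" using u(2)[of x] v(2)[of x] r(1) s(1) by (auto simp: L_def)
    qed
  qed
qed

lemma gsupp_subset:
  assumes "closed C" "AE t\<in>I in lebesgue. t \<notin> C \<longrightarrow> \<phi> t = 0"
  shows "gsupp I \<phi> \<subseteq> C"
proof -
  have "{t \<in> I. llim \<phi> t \<noteq> 0 \<or> rlim \<phi> t \<noteq> 0} \<subseteq> C"
  proof (rule ccontr)
    assume "\<not> ?thesis"
    then obtain t where t: "t \<in> I - C" "llim \<phi> t \<noteq> 0 \<or> rlim \<phi> t \<noteq> 0" by blast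
    have o: "open (I - C)" using assms(1) open_I by blast
    have ae: "AE s in lebesgue. s \<in> I - C \<longrightarrow> \<phi> s = 0" using assms(2) by eventually_elim auto
    have "rlim \<phi> t = 0"
      by (rule rlim_eqI, rule tendsto_eventually, rule AE_eventually_ess_at_right[OF o t(1) ae])
    moreover have "llim \<phi> t = 0"
      by (rule llim_eqI, rule tendsto_eventually, rule AE_eventually_ess_at_left[OF o t(1) ae])
    ultimately show False using t(2) by simp
  qed
  then show ?thesis unfolding gsupp_def using assms(1) closure_minimal by blast
qed

lemma AE_zero_outside_gsupp:
  assumes "\<phi> \<in> GG I"
  shows "AE t\<in>I in lebesgue. t \<notin> gsupp I \<phi> \<longrightarrow> \<phi> t = 0"
  using AE_eq_rlim[OF assms]
proof eventually_elim
  case (elim t)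
  then show ?case
    unfolding gsupp_def using closure_subset[of "{t \<in> I. llim \<phi> t \<noteq> 0 \<or> rlim \<phi> t \<noteq> 0}"] by auto
qed

lemma is_gderiv_AE_zero_outside:
  assumes "is_gderiv I g h" "closed C" "AE t\<in>I in lebesgue. t \<notin> C \<longrightarrow> g t = 0"
  shows "AE t\<in>I in lebesgue. t \<notin> C \<longrightarrow> h t = 0"
proof -
  have o: "open (I - C)" using assms(2) open_I by blast
  have ae: "AE s in lebesgue. s \<in> I - C \<longrightarrow> g s = 0" using assms(3) by eventually_elim auto
  have "rlim h t = 0" if t: "t \<in> I - C" for t
  proof -
    have g: "\<forall>\<^sub>F s in ess_at_right t. g s = 0" by (rule AE_eventually_ess_at_right[OF o t ae])
    then have "rlim g t = 0" by (intro rlim_eqI tendsto_eventually)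
    with g have "\<forall>\<^sub>F s in ess_at_right t. (g s - rlim g t) / complex_of_real (s - t) = 0"
      by (auto elim!: eventually_mono)
    then show ?thesis
      using tendsto_unique[OF ess_at_right_neq_bot is_gderiv_right[OF assms(1), of t] tendsto_eventually] t
      by blast
  qed
  then show ?thesis
    using AE_eq_rlim[OF is_gderiv_GG[OF assms(1)]] by (auto elim!: eventually_mono)
qed

text \<open>Trades the topological support for vanishing almost everywhere outside some compact set,
  a condition that is easily checked for sums, products and derivatives.\<close>

lemma RR_iff:
  "\<phi> \<in> RR I \<longleftrightarrow> \<phi> \<in> Ginf I \<and> (\<exists>K. compact K \<and> K \<subseteq> I \<and> (AE t\<in>I in lebesgue. t \<notin> K \<longrightarrow> \<phi> t = 0))"
proof
  assume \<phi>: "\<phi> \<in> RR I"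
  have "gsupp I \<phi> \<subseteq> I" by (auto simp: gsupp_def)
  with \<phi> show "\<phi> \<in> Ginf I \<and> (\<exists>K. compact K \<and> K \<subseteq> I \<and> (AE t\<in>I in lebesgue. t \<notin> K \<longrightarrow> \<phi> t = 0))"
    unfolding RR_def using AE_zero_outside_gsupp[OF Ginf_GG] by blast
next
  assume "\<phi> \<in> Ginf I \<and> (\<exists>K. compact K \<and> K \<subseteq> I \<and> (AE t\<in>I in lebesgue. t \<notin> K \<longrightarrow> \<phi> t = 0))"
  then obtain K where K: "\<phi> \<in> Ginf I" "compact K" "K \<subseteq> I" "AE t\<in>I in lebesgue. t \<notin> K \<longrightarrow> \<phi> t = 0"
    by blast
  let ?S = "{t \<in> I. llim \<phi> t \<noteq> 0 \<or> rlim \<phi> t \<noteq> 0}"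
  have "?S \<subseteq> gsupp I \<phi>"
    unfolding gsupp_def by (intro Int_greatest closure_subset) auto
  also have sub: "gsupp I \<phi> \<subseteq> K" by (rule gsupp_subset[OF compact_imp_closed[OF K(2)] K(4)])
  \<comment> \<open>\<open>gsupp\<close> is closed only relative to I. The compact set K inside I
    catches all closure points, so none is lost at the boundary of I.\<close>
  finally have "closure ?S \<subseteq> K"
    using K(2) by (simp only: closure_minimal compact_imp_closed)
  then have "gsupp I \<phi> = K \<inter> closure ?S"
    using K(3) unfolding gsupp_def by auto
  then show "\<phi> \<in> RR I" unfolding RR_def using K(1,2) by (simp add: compact_Int_closed)
qed

lemma RR_Ginf: "\<phi> \<in> RR I \<Longrightarrow> \<phi> \<in> Ginf I"
  by (simp add: RR_def)

lemma RR_I: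
  "\<phi> \<in> Ginf I \<Longrightarrow> compact K \<Longrightarrow> K \<subseteq> I \<Longrightarrow> AE t\<in>I in lebesgue. t \<notin> K \<longrightarrow> \<phi> t = 0 \<Longrightarrow> \<phi> \<in> RR I"
  unfolding RR_iff by blast

lemma RR_E:
  assumes "\<phi> \<in> RR I"
  obtains K where "compact K" "K \<subseteq> I" "AE t\<in>I in lebesgue. t \<notin> K \<longrightarrow> \<phi> t = 0"
  using assms unfolding RR_iff by blast

lemma RR_add:
  assumes "\<phi> \<in> RR I" "\<psi> \<in> RR I"
  shows "(\<lambda>t. \<phi> t + \<psi> t) \<in> RR I"
proof -
  obtain K where K: "compact K" "K \<subseteq> I" "AE t\<in>I in lebesgue. t \<notin> K \<longrightarrow> \<phi> t = 0"
    by (rule RR_E[OF assms(1)])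
  obtain L where L: "compact L" "L \<subseteq> I" "AE t\<in>I in lebesgue. t \<notin> L \<longrightarrow> \<psi> t = 0"
    by (rule RR_E[OF assms(2)])
  show ?thesis
  proof (rule RR_I[of _ "K \<union> L"])
    show "AE t\<in>I in lebesgue. t \<notin> K \<union> L \<longrightarrow> \<phi> t + \<psi> t = 0"
      using K(3) L(3) by eventually_elim auto
  qed (use K L assms in \<open>auto intro: Ginf_add RR_Ginf\<close>)
qed

lemma RR_Ginf_mult:
  assumes "g \<in> Ginf I" "\<phi> \<in> RR I"
  shows "(\<lambda>t. g t * \<phi> t) \<in> RR I"
proof -
  obtain K where K: "compact K" "K \<subseteq> I" "AE t\<in>I in lebesgue. t \<notin> K \<longrightarrow> \<phi> t = 0"
    by (rule RR_E[OF assms(2)])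
  have "AE t\<in>I in lebesgue. t \<notin> K \<longrightarrow> g t * \<phi> t = 0"
    using K(3) by eventually_elim auto
  then show ?thesis by (rule RR_I[OF Ginf_mult[OF assms(1) RR_Ginf[OF assms(2)]] K(1,2)])
qed

lemma RR_cmult: "\<phi> \<in> RR I \<Longrightarrow> (\<lambda>t. c * \<phi> t) \<in> RR I"
  by (rule RR_Ginf_mult[OF Ginf_const])

lemma RR_zero: "(\<lambda>t. 0) \<in> RR I"
  by (rule RR_I[of _ "{}"]) (auto intro: Ginf_const)

lemma RR_sum: "(\<And>i. i \<in> S \<Longrightarrow> \<phi> i \<in> RR I) \<Longrightarrow> (\<lambda>t. \<Sum>i\<in>S. \<phi> i t) \<in> RR I"
  by (induction S rule: infinite_finite_induct) (auto intro: RR_add RR_zero)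

lemma RR_diff: "\<phi> \<in> RR I \<Longrightarrow> \<psi> \<in> RR I \<Longrightarrow> (\<lambda>t. \<phi> t - \<psi> t) \<in> RR I"
  using RR_add[OF _ RR_cmult[of \<psi> "-1"], of \<phi>] by simp

lemma RR_gderiv:
  assumes "\<phi> \<in> RR I"
  shows "gderiv I \<phi> \<in> RR I"
proof -
  obtain K where K: "compact K" "K \<subseteq> I" "AE t\<in>I in lebesgue. t \<notin> K \<longrightarrow> \<phi> t = 0"
    by (rule RR_E[OF assms(1)])
  note d = Ginf_gderiv[OF RR_Ginf[OF assms]]
  show ?thesis
    by (rule RR_I[OF d(2) K(1,2) is_gderiv_AE_zero_outside[OF d(1) compact_imp_closed[OF K(1)] K(3)]])
qed

lemma RR_on_subset_RR:
  assumes "bounded J" "closure J \<subseteq> I"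
  shows "RR_on I J \<subseteq> RR I"
proof
  fix \<phi> assume "\<phi> \<in> RR_on I J"
  then have \<phi>: "\<phi> \<in> Ginf I" "AE t\<in>I in lebesgue. t \<notin> J \<longrightarrow> \<phi> t = 0"
    unfolding RR_on_def AE_lebesgue_on_iff[OF open_I] by auto
  have "AE t\<in>I in lebesgue. t \<notin> closure J \<longrightarrow> \<phi> t = 0"
    using \<phi>(2) by eventually_elim (use closure_subset in blast)
  then show "\<phi> \<in> RR I"
    using RR_I[OF \<phi>(1) _ assms(2)] assms(1) by (simp add: compact_closure)
qed

lemma RR_dual_add: "f \<in> RR_dual I \<Longrightarrow> \<phi> \<in> RR I \<Longrightarrow> \<psi> \<in> RR I \<Longrightarrow> f (\<lambda>t. \<phi> t + \<psi> t) = f \<phi> + f \<psi>"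
  by (simp add: RR_dual_def)

lemma RR_dual_cmult: "f \<in> RR_dual I \<Longrightarrow> \<phi> \<in> RR I \<Longrightarrow> f (\<lambda>t. c * \<phi> t) = c * f \<phi>"
  by (simp add: RR_dual_def)

lemma RR_dual_diff: "f \<in> RR_dual I \<Longrightarrow> \<phi> \<in> RR I \<Longrightarrow> \<psi> \<in> RR I \<Longrightarrow> f (\<lambda>t. \<phi> t - \<psi> t) = f \<phi> - f \<psi>"
  using RR_dual_add[of f \<phi> "\<lambda>t. -1 * \<psi> t"] RR_dual_cmult[of f \<psi> "-1"] RR_cmult[of \<psi> "-1"] by simp

lemma RR_dual_zero: "f \<in> RR_dual I \<Longrightarrow> f (\<lambda>t. 0) = 0"
  using RR_dual_cmult[OF _ RR_zero, of f 0] by simp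

lemma RR_dual_sum:
  assumes "f \<in> RR_dual I" "\<And>i. i \<in> S \<Longrightarrow> \<phi> i \<in> RR I"
  shows "f (\<lambda>t. \<Sum>i\<in>S. \<phi> i t) = (\<Sum>i\<in>S. f (\<phi> i))"
  using assms(2)
  by (induction S rule: infinite_finite_induct)
    (auto simp: RR_dual_zero[OF assms(1)] RR_dual_add[OF assms(1)] RR_sum)

section \<open>Continuity of distributions in terms of the norms\<close>

lemma base_nhd_RR: "base_nhd I (RR I)"
  unfolding base_nhd_def
proof (intro conjI allI impI ballI)
  show "(\<lambda>t. c * \<phi> t + d * \<psi> t) \<in> RR I" if "\<phi> \<in> RR I" "\<psi> \<in> RR I" for \<phi> \<psi> c d
    using that by (intro RR_add RR_cmult)
  show "\<exists>k. \<exists>e>0. {\<psi> \<in> RR_on I J. gnorm I k \<psi> < e} \<subseteq> RR I"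
    if "is_interval J \<and> bounded J \<and> closure J \<subseteq> I" for J
    using that RR_on_subset_RR by (intro exI[of _ 0] exI[of _ "1::real"]) auto
qed simp

lemma topspace_RR_topology: "topspace (RR_topology I) = RR I"
proof -
  have "RR_open I (RR I)"
    unfolding RR_open_def using base_nhd_RR RR_add by blast
  then show ?thesis
    unfolding topspace_def openin_RR_topology RR_open_def by blast
qed

text \<open>The preimage of a ball around 0 is open and contains 0, hence contains a basic
  neighbourhood, whose trace on the step space of J contains a ball of one of the norms.\<close>

lemma RR_dual_continuous:
  assumes f: "f \<in> RR_dual I" and J: "is_interval J" "bounded J" "closure J \<subseteq> I" and "e > 0"
  obtains k \<delta> where "\<delta> > 0" "\<And>\<psi>. \<psi> \<in> RR_on I J \<Longrightarrow> gnorm I k \<psi> < \<delta> \<Longrightarrow> norm (f \<psi>) < e"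
proof -
  let ?U = "{\<phi> \<in> RR I. f \<phi> \<in> ball 0 e}"
  have "continuous_map (RR_topology I) euclidean f" using f by (simp add: RR_dual_def)
  then have "RR_open I ?U"
    using openin_continuous_map_preimage[of "RR_topology I" euclidean f "ball 0 e"]
    by (simp add: topspace_RR_topology openin_RR_topology)
  moreover have "(\<lambda>t. 0) \<in> ?U" using RR_zero RR_dual_zero[OF f] \<open>e > 0\<close> by simp
  ultimately obtain V where V: "base_nhd I V" "\<And>\<psi>. \<psi> \<in> V \<Longrightarrow> (\<lambda>t. 0 + \<psi> t) \<in> ?U"
    unfolding RR_open_def by blast
  then obtain k \<delta> where "\<delta> > 0" "{\<psi> \<in> RR_on I J. gnorm I k \<psi> < \<delta>} \<subseteq> V"
    using J unfolding base_nhd_def by meson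
  then show ?thesis using that[of \<delta> k] V(2) by auto
qed

lemma Ginf_funpow_in: "g \<in> Ginf I \<Longrightarrow> (gderiv I ^^ k) g \<in> Ginf I"
  by (induction k) (auto intro: Ginf_gderiv)

lemma gnorm_le:
  assumes "\<psi> \<in> Ginf I" "0 \<le> e"
    "\<And>i. i \<le> k \<Longrightarrow> AE t\<in>I in lebesgue. norm ((gderiv I ^^ i) \<psi> t) \<le> e"
  shows "gnorm I k \<psi> \<le> e"
proof -
  have "Linf_norm I ((gderiv I ^^ i) \<psi>) \<le> e" if "i \<le> k" for i
  proof -
    let ?h = "\<lambda>t. ereal (norm ((gderiv I ^^ i) \<psi> t))"
    have "(gderiv I ^^ i) \<psi> \<in> borel_measurable (lebesgue_on I)"
      by (intro GG_measurable Ginf_GG Ginf_funpow_in assms)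
    then have "?h \<in> borel_measurable (lebesgue_on I)" by measurable
    moreover have "AE t in lebesgue_on I. ?h t \<le> ereal e"
      unfolding AE_lebesgue_on_iff[OF open_I] using assms(3)[OF that] by simp
    ultimately have "esssup (lebesgue_on I) ?h \<le> ereal e" by (rule esssup_I)
    \<comment> \<open>\<open>real_of_ereal\<close> sends an essential supremum of minus infinity to
      0; that case is settled by 0 \<le> e.\<close>
    then show ?thesis
      unfolding Linf_norm_def using assms(2) by (cases "esssup (lebesgue_on I) ?h") auto
  qed
  then show ?thesis unfolding gnorm_def by auto
qed

text \<open>The support is closed in I; the gap between e and t0 is what keeps it inside
  {..<t0}.\<close>

lemma zero_beforeD:
  assumes "zero_before I t0 f" "\<phi> \<in> RR I" "e < t0" "AE t\<in>I in lebesgue. e < t \<longrightarrow> \<phi> t = 0"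
  shows "f \<phi> = 0"
proof -
  have "gsupp I \<phi> \<subseteq> {..e}"
    by (rule gsupp_subset) (use assms(4) in \<open>auto elim!: eventually_mono\<close>)
  then show ?thesis
    using assms(1-3) unfolding zero_before_def gsupp_def by force
qed

end

subsection \<open>Truncated polynomials\<close>

text \<open>If \<tau>' = \<epsilon> * \<tau> * (1 - \<tau>), then \<tau>' is a polynomial in \<tau>
  without constant term, so the span is closed under differentiation and the exponent n stays
  positive. The remaining factor \<tau> gives boundedness wherever \<tau> absorbs the powers of
  t.\<close>

inductive_set logistic_span :: "(real \<Rightarrow> real) \<Rightarrow> cfun set" for \<tau> where
  monom: "n \<ge> 1 \<Longrightarrow> (\<lambda>t. c * of_real (t ^ m * \<tau> t ^ n)) \<in> logistic_span \<tau>"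
| add: "g \<in> logistic_span \<tau> \<Longrightarrow> h \<in> logistic_span \<tau> \<Longrightarrow> (\<lambda>t. g t + h t) \<in> logistic_span \<tau>"

lemma logistic_span_sum:
  assumes "finite S" "\<And>i. i \<in> S \<Longrightarrow> g i \<in> logistic_span \<tau>"
  shows "(\<lambda>t. \<Sum>i\<in>S. g i t) \<in> logistic_span \<tau>"
  using assms
proof (induction S)
  case empty
  show ?case using logistic_span.monom[of 1 0 0 \<tau>] by simp
qed (auto intro: logistic_span.add)

lemma logistic_span_poly: "(\<lambda>t. poly p (of_real t) * of_real (\<tau> t)) \<in> logistic_span \<tau>"
proof -
  have "(\<lambda>t. \<Sum>i\<le>degree p. coeff p i * of_real (t ^ i * \<tau> t ^ 1)) \<in> logistic_span \<tau>"
    by (intro logistic_span_sum logistic_span.monom) auto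
  then show ?thesis by (simp add: poly_altdef sum_distrib_right mult.assoc)
qed

lemma logistic_span_deriv:
  assumes \<tau>: "\<And>t. (\<tau> has_real_derivative \<epsilon> * \<tau> t * (1 - \<tau> t)) (at t)" and "g \<in> logistic_span \<tau>"
  shows "\<exists>h\<in>logistic_span \<tau>. \<forall>t. (g has_vector_derivative h t) (at t)"
  using assms(2)
proof induction
  case (monom n c m)
  let ?h = "\<lambda>t. ((c * of_nat m) * of_real (t ^ (m - 1) * \<tau> t ^ n)
      + (c * of_real (of_nat n * \<epsilon>)) * of_real (t ^ m * \<tau> t ^ n)) + (- (c * of_real (of_nat n * \<epsilon>))) * of_real (t ^ m * \<tau> t ^ Suc n)"
  have "((\<lambda>t. c * of_real (t ^ m * \<tau> t ^ n)) has_vector_derivative ?h t) (at t)" for t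
  proof -
    have "((\<lambda>t. t ^ m * \<tau> t ^ n) has_real_derivative
        (of_nat m * t ^ (m - 1)) * \<tau> t ^ n + t ^ m * (of_nat n * \<tau> t ^ (n - 1) * (\<epsilon> * \<tau> t * (1 - \<tau> t)))) (at t)"
      by (auto intro!: derivative_eq_intros \<tau>)
    moreover have "\<tau> t ^ n = \<tau> t ^ (n - 1) * \<tau> t"
      using monom by (cases n) auto
    then have "t ^ m * (of_nat n * \<tau> t ^ (n - 1) * (\<epsilon> * \<tau> t * (1 - \<tau> t)))
        = of_nat n * \<epsilon> * (t ^ m * \<tau> t ^ n) - of_nat n * \<epsilon> * (t ^ m * \<tau> t ^ Suc n)"
      by (simp add: algebra_simps)
    ultimately have "((\<lambda>t. t ^ m * \<tau> t ^ n) has_real_derivative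
        of_nat m * (t ^ (m - 1) * \<tau> t ^ n) + (of_nat n * \<epsilon> * (t ^ m * \<tau> t ^ n) - of_nat n * \<epsilon> * (t ^ m * \<tau> t ^ Suc n))) (at t)"
      by (simp only: mult.assoc)
    then have "((\<lambda>t. c * of_real (t ^ m * \<tau> t ^ n)) has_vector_derivative
        c * of_real (of_nat m * (t ^ (m - 1) * \<tau> t ^ n) + (of_nat n * \<epsilon> * (t ^ m * \<tau> t ^ n) - of_nat n * \<epsilon> * (t ^ m * \<tau> t ^ Suc n)))) (at t)"
      by (intro has_vector_derivative_mult_right has_vector_derivative_of_real)
        (simp add: has_real_derivative_iff_has_vector_derivative)
    then show ?thesis by (simp add: algebra_simps)
  qed
  moreover have "?h \<in> logistic_span \<tau>"
    using monom by (intro logistic_span.add logistic_span.monom) auto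
  ultimately show ?case by (intro bexI[of _ ?h] allI)
next
  case (add g1 g2)
  then obtain h1 h2 where "h1 \<in> logistic_span \<tau>" "h2 \<in> logistic_span \<tau>"
    "\<And>t. (g1 has_vector_derivative h1 t) (at t)" "\<And>t. (g2 has_vector_derivative h2 t) (at t)" by blast
  then show ?case
    by (intro bexI[of _ "\<lambda>t. h1 t + h2 t"]) (auto intro: has_vector_derivative_add logistic_span.add)
qed

lemma logistic_span_bounded:
  assumes "\<And>t. t \<in> D \<Longrightarrow> 0 \<le> \<tau> t \<and> \<tau> t \<le> 1" "\<And>m. \<exists>C. \<forall>t\<in>D. \<bar>t\<bar> ^ m * \<tau> t \<le> C" "g \<in> logistic_span \<tau>"
  shows "\<exists>C. \<forall>t\<in>D. norm (g t) \<le> C"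
  using assms(3)
proof induction
  case (monom n c m)
  obtain C where C: "\<And>t. t \<in> D \<Longrightarrow> \<bar>t\<bar> ^ m * \<tau> t \<le> C" using assms(2)[of m] by blast
  have "norm (c * of_real (t ^ m * \<tau> t ^ n)) \<le> norm c * C" if t: "t \<in> D" for t
  proof -
    have "\<bar>t\<bar> ^ m * \<tau> t ^ n \<le> \<bar>t\<bar> ^ m * \<tau> t ^ 1"
      using assms(1)[OF t] monom by (intro mult_left_mono power_decreasing) auto
    also have "\<dots> \<le> C" using C[OF t] by simp
    finally show ?thesis
      using assms(1)[OF t] by (simp add: norm_mult norm_power mult_left_mono)
  qed
  then show ?case by blast
next
  case (add g h)
  then obtain C D' where "\<forall>t\<in>D. norm (g t) \<le> C" "\<forall>t\<in>D. norm (h t) \<le> D'" by blast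
  then have "\<forall>t\<in>D. norm (g t + h t) \<le> C + D'" by (meson norm_triangle_mono)
  then show ?case by blast
qed

lemma logistic_span_chain:
  assumes "\<And>t. (\<tau> has_real_derivative \<epsilon> * \<tau> t * (1 - \<tau> t)) (at t)" "g \<in> logistic_span \<tau>"
  obtains d where "d 0 = g" "\<And>i. d i \<in> logistic_span \<tau>"
    "\<And>i t. (d i has_vector_derivative d (Suc i) t) (at t)"
proof -
  have "\<exists>d. \<forall>n::nat. (d n \<in> logistic_span \<tau> \<and> (n = 0 \<longrightarrow> d n = g)) \<and>
      (\<forall>t. (d n has_vector_derivative d (Suc n) t) (at t))"
    by (rule dependent_nat_choice) (use assms logistic_span_deriv in \<open>blast, blast\<close>)
  then show ?thesis using that by blast
qed

definition logistic :: "real \<Rightarrow> real" where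
  "logistic t = 1 / (1 + exp (- t))"

lemma logistic_pos: "0 < logistic t" "logistic t < 1"
  by (auto simp: logistic_def add_pos_pos)

lemma logistic_minus: "logistic (- t) = 1 - logistic t"
proof -
  have "1 + exp t \<noteq> 0" "1 + exp (- t) \<noteq> 0"
    using exp_gt_zero[of t] exp_gt_zero[of "- t"] by linarith+
  then show ?thesis by (simp add: logistic_def field_simps flip: exp_add)
qed

lemma logistic_deriv: "(logistic has_real_derivative 1 * logistic t * (1 - logistic t)) (at t)"
proof -
  have pos: "1 + exp (- t) > 0" by (simp add: add_pos_pos)
  have "((\<lambda>t. 1 / (1 + exp (- t))) has_real_derivative exp (- t) / (1 + exp (- t))\<^sup>2) (at t)"
    using pos by (auto intro!: derivative_eq_intros simp: power2_eq_square)
  moreover have "exp (- t) / (1 + exp (- t))\<^sup>2 = 1 * logistic t * (1 - logistic t)"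
    using pos by (simp add: logistic_def field_simps power2_eq_square)
  ultimately show ?thesis by (simp add: logistic_def[abs_def])
qed

text \<open>The mirrored function satisfies the same type of equation with \<epsilon> = -1; it
  absorbs powers of t towards plus infinity, as \<open>logistic\<close> does towards minus
  infinity.\<close>

lemma logistic_minus_deriv:
  "((\<lambda>t. 1 - logistic t) has_real_derivative - 1 * (1 - logistic t) * (1 - (1 - logistic t))) (at t)"
  by (auto intro!: derivative_eq_intros logistic_deriv simp: algebra_simps)

text \<open>For t \<le> 0 a single term of the exponential series gives |t|^m \<le> m! * exp (- t),
  and logistic t \<le> exp t. For 0 < t \<le> u the bound |u|^m is enough. The sum of both bounds
  covers both cases.\<close>

lemma power_mult_logistic_le:
  assumes "t \<le> u"
  shows "\<bar>t\<bar> ^ m * logistic t \<le> fact m + \<bar>u\<bar> ^ m"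
proof (cases "t \<le> 0")
  case True
  have "\<bar>t\<bar> ^ m / fact m \<le> exp \<bar>t\<bar>"
  proof -
    have "(\<Sum>n\<in>{m}. \<bar>t\<bar> ^ n /\<^sub>R fact n) \<le> (\<Sum>n. \<bar>t\<bar> ^ n /\<^sub>R fact n)"
      by (rule sum_le_suminf) (use summable_exp_generic[of "\<bar>t\<bar>"] in auto)
    then show ?thesis by (simp add: exp_def divide_inverse mult.commute)
  qed
  then have 1: "\<bar>t\<bar> ^ m \<le> fact m * exp (- t)" using True by (simp add: field_simps)
  have 2: "logistic t \<le> exp t"
    unfolding logistic_def by (simp add: add_pos_pos field_simps flip: exp_add)
  have "\<bar>t\<bar> ^ m * logistic t \<le> (fact m * exp (- t)) * exp t"
    by (rule mult_mono[OF 1 2]) (use logistic_pos[of t] in auto)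
  also have "\<dots> = fact m" by (simp flip: exp_add)
  finally show ?thesis by (simp add: add_increasing2)
next
  case False
  have "\<bar>t\<bar> ^ m * logistic t \<le> \<bar>u\<bar> ^ m * 1"
    by (rule mult_mono) (use False assms logistic_pos[of t] in \<open>auto intro: power_mono\<close>)
  then show ?thesis by (simp add: add_increasing)
qed

text \<open>Left of \<open>u\<close> the first function and right of \<open>u\<close> the second one is bounded together with all its
  derivatives, while their difference is the polynomial: gluing them at \<open>u\<close> yields a function on an
  arbitrary interval whose derivatives have the jumps of the truncated polynomial.\<close>

lemma truncation_chain:
  obtains l r :: "nat \<Rightarrow> cfun" where
    "l 0 = (\<lambda>t. - poly p (of_real t) * of_real (logistic t))"
    "r 0 = (\<lambda>t. poly p (of_real t) * of_real (1 - logistic t))"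
    "\<And>i t. (l i has_vector_derivative l (Suc i) t) (at t)"
    "\<And>i t. (r i has_vector_derivative r (Suc i) t) (at t)"
    "\<And>i t. r i t - l i t = poly ((pderiv ^^ i) p) (of_real t)"
    "\<And>i u. \<exists>C. \<forall>t\<le>u. norm (l i t) \<le> C"
    "\<And>i u. \<exists>C. \<forall>t\<ge>u. norm (r i t) \<le> C"
proof -
  obtain l where l: "l 0 = (\<lambda>t. poly (- p) (of_real t) * of_real (logistic t))"
    "\<And>i. l i \<in> logistic_span logistic" "\<And>i t. (l i has_vector_derivative l (Suc i) t) (at t)"
    using logistic_span_chain[OF logistic_deriv logistic_span_poly[of "- p" logistic]] by blast
  obtain r where r: "r 0 = (\<lambda>t. poly p (of_real t) * of_real (1 - logistic t))"
    "\<And>i. r i \<in> logistic_span (\<lambda>t. 1 - logistic t)" "\<And>i t. (r i has_vector_derivative r (Suc i) t) (at t)"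
    using logistic_span_chain[OF logistic_minus_deriv logistic_span_poly[of p "\<lambda>t. 1 - logistic t"]] by blast
  show ?thesis
  proof (rule that[of l r])
    show "l 0 = (\<lambda>t. - poly p (of_real t) * of_real (logistic t))" by (simp add: l(1))
    show "r 0 = (\<lambda>t. poly p (of_real t) * of_real (1 - logistic t))" by (rule r(1))
    show "(l i has_vector_derivative l (Suc i) t) (at t)" "(r i has_vector_derivative r (Suc i) t) (at t)" for i t
      by (rule l(3) r(3))+
    show "r i t - l i t = poly ((pderiv ^^ i) p) (of_real t)" for i t
    proof (induction i arbitrary: t)
      case (Suc i)
      have "((\<lambda>t. r i t - l i t) has_vector_derivative r (Suc i) t - l (Suc i) t) (at t)"
        by (intro has_vector_derivative_diff r l)
      moreover have "((\<lambda>t. poly ((pderiv ^^ i) p) (of_real t)) has_vector_derivative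
          of_real 1 * poly (pderiv ((pderiv ^^ i) p)) (of_real t)) (at t)"
        using field_vector_diff_chain_at[OF has_vector_derivative_of_real[OF DERIV_ident] poly_DERIV[of "(pderiv ^^ i) p"]]
        by (simp add: o_def)
      ultimately show ?case
        using vector_derivative_unique_at by (fastforce simp: Suc)
    qed (simp add: l(1) r(1) algebra_simps)
    show "\<exists>C. \<forall>t\<le>u. norm (l i t) \<le> C" for i u
    proof -
      have "\<exists>C. \<forall>t\<in>{..u}. norm (l i t) \<le> C"
      proof (rule logistic_span_bounded[OF _ _ l(2)])
        show "\<exists>C. \<forall>t\<in>{..u}. \<bar>t\<bar> ^ m * logistic t \<le> C" for m
          using power_mult_logistic_le[of _ u m] by (intro exI[of _ "fact m + \<bar>u\<bar> ^ m"]) simp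
      qed (simp add: logistic_pos less_imp_le)
      then show ?thesis unfolding Ball_def atMost_iff atLeast_iff .
    qed
    show "\<exists>C. \<forall>t\<ge>u. norm (r i t) \<le> C" for i u
    proof -
      have "\<exists>C. \<forall>t\<in>{u..}. norm (r i t) \<le> C"
      proof (rule logistic_span_bounded[OF _ _ r(2)])
        have "\<bar>t\<bar> ^ m * (1 - logistic t) \<le> fact m + \<bar>u\<bar> ^ m" if "t \<ge> u" for t m
          using power_mult_logistic_le[of "- t" "- u" m] that by (simp add: logistic_minus)
        then show "\<exists>C. \<forall>t\<in>{u..}. \<bar>t\<bar> ^ m * (1 - logistic t) \<le> C" for m
          by (intro exI[of _ "fact m + \<bar>u\<bar> ^ m"]) simp
      qed (simp add: logistic_pos less_imp_le)
      then show ?thesis unfolding Ball_def atMost_iff atLeast_iff .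
    qed
  qed
qed

text \<open>Subtraction of naturals is truncated: for i > n the product contains the factor for m =
  n, which is 0, so the formula includes the vanishing of the higher derivatives.\<close>

lemma pderiv_funpow_linear_power:
  fixes a :: complex
  shows "(pderiv ^^ i) ([:- a, 1:] ^ n) = smult (\<Prod>m<i. of_nat (n - m)) ([:- a, 1:] ^ (n - i))"
  by (induction i) (auto simp: pderiv_smult pderiv_power pderiv_pCons mult.commute)

text \<open>Two uses: a power of t - u cut off at u has a jump in exactly one derivative, and adding
  a multiple of the n-th power to a polynomial changes only the n-th derivative at a.\<close>

lemma poly_pderiv_funpow_linear_power:
  fixes a :: complex
  shows "poly ((pderiv ^^ i) ([:- a, 1:] ^ n)) a = (if i = n then fact n else 0)"
proof (cases i n rule: linorder_cases)
  case equal
  have "(\<Prod>m<n. of_nat (n - m)) = (of_nat (\<Prod>m<n. n - m) :: complex)" by simp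
  also have "(\<Prod>m<n. n - m) = fact n" by (simp add: fact_prod_rev lessThan_atLeast0)
  finally show ?thesis using equal by (simp add: pderiv_funpow_linear_power)
next
  case greater
  then have "(\<Prod>m<i. of_nat (n - m)) = (0 :: complex)" by (intro prod_zero) auto
  then show ?thesis using greater by (simp add: pderiv_funpow_linear_power)
qed (simp add: pderiv_funpow_linear_power)

text \<open>The Taylor expansion at a; its coefficients are those of the composite of p with X +
  a.\<close>

lemma poly_expand_at:
  fixes p :: "complex poly"
  obtains c N where "\<And>z. poly p z = (\<Sum>j\<le>N. c j * poly ([:- a, 1:] ^ j) z)"
proof -
  let ?q = "pcompose p [:a, 1:]"
  have "poly p z = (\<Sum>j\<le>degree ?q. coeff ?q j * poly ([:- a, 1:] ^ j) z)" for z
  proof -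
    have "poly p z = poly ?q (z - a)" by (simp add: poly_pcompose)
    then show ?thesis by (subst (asm) poly_altdef) simp
  qed
  then show ?thesis using that by blast
qed

text \<open>This is p cut off to the left of u, minus p * \<open>logistic\<close>. The smooth
  correction does not affect the jumps, keeps the derivatives bounded on an unbounded I, and cancels
  in differences of two truncations.\<close>

definition trunc :: "real \<Rightarrow> complex poly \<Rightarrow> cfun" where
  "trunc u p t = (if t < u then - poly p (of_real t) * of_real (logistic t)
    else poly p (of_real t) * of_real (1 - logistic t))"

text \<open>Half-open, so that a breakpoint belongs to only one of two adjacent pieces and the
  function is right continuous.\<close>

definition poly_on :: "real \<Rightarrow> real \<Rightarrow> complex poly \<Rightarrow> cfun" where
  "poly_on x y p t = (if x \<le> t \<and> t < y then poly p (of_real t) else 0)"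

lemma poly_on_eq_trunc: "x \<le> y \<Longrightarrow> poly_on x y p = (\<lambda>t. trunc x p t - trunc y p t)"
  by (auto simp: fun_eq_iff poly_on_def trunc_def algebra_simps)

section \<open>The span \<open>FF\<close> and the truncated polynomials in it\<close>

lemma FF_base: "g \<in> FF_k I k \<Longrightarrow> g \<in> FF I"
  unfolding FF_def by (intro CollectI exI[of _ "{g}"] exI[of _ "\<lambda>_. 1"]) auto

lemma FF_cmult:
  assumes "g \<in> FF I"
  shows "(\<lambda>t. c * g t) \<in> FF I"
proof -
  obtain S d where "finite S" "S \<subseteq> (\<Union>k. FF_k I k)" "g = (\<lambda>t. \<Sum>h\<in>S. d h * h t)"
    using assms unfolding FF_def by blast
  then show ?thesis
    unfolding FF_def
    by (intro CollectI exI[of _ S] exI[of _ "\<lambda>h. c * d h"]) (auto simp: sum_distrib_left mult.assoc)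
qed

lemma FF_add:
  assumes "g1 \<in> FF I" "g2 \<in> FF I"
  shows "(\<lambda>t. g1 t + g2 t) \<in> FF I"
proof -
  obtain S1 d1 where 1: "finite S1" "S1 \<subseteq> (\<Union>k. FF_k I k)" "g1 = (\<lambda>t. \<Sum>h\<in>S1. d1 h * h t)"
    using assms unfolding FF_def by blast
  obtain S2 d2 where 2: "finite S2" "S2 \<subseteq> (\<Union>k. FF_k I k)" "g2 = (\<lambda>t. \<Sum>h\<in>S2. d2 h * h t)"
    using assms unfolding FF_def by blast
  \<comment> \<open>A function occurring in both representations receives the sum of its
    coefficients; a missing coefficient counts as 0.\<close>
  let ?d = "\<lambda>h. (if h \<in> S1 then d1 h else 0) + (if h \<in> S2 then d2 h else 0)"
  have "(\<Sum>h\<in>S1 \<union> S2. ?d h * h t) = g1 t + g2 t" for t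
  proof -
    have "(\<Sum>h\<in>S1 \<union> S2. ?d h * h t) = (\<Sum>h\<in>S1 \<union> S2. (if h \<in> S1 then d1 h * h t else 0))
        + (\<Sum>h\<in>S1 \<union> S2. (if h \<in> S2 then d2 h * h t else 0))"
      unfolding sum.distrib[symmetric] by (intro sum.cong) (auto simp: distrib_right)
    also have "(\<Sum>h\<in>S1 \<union> S2. (if h \<in> S1 then d1 h * h t else 0)) = g1 t"
      using 1 2 by (auto intro!: sum.mono_neutral_cong_right)
    also have "(\<Sum>h\<in>S1 \<union> S2. (if h \<in> S2 then d2 h * h t else 0)) = g2 t"
      using 1 2 by (auto intro!: sum.mono_neutral_cong_right)
    finally show ?thesis .
  qed
  then show ?thesis
    unfolding FF_def using 1 2 by (intro CollectI exI[of _ "S1 \<union> S2"] exI[of _ ?d]) auto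
qed

lemma FF_sum:
  assumes "finite S" "S \<noteq> {}" "\<And>i. i \<in> S \<Longrightarrow> g i \<in> FF I"
  shows "(\<lambda>t. \<Sum>i\<in>S. g i t) \<in> FF I"
  using assms by (induction S rule: finite_ne_induct) (auto intro: FF_add)

context open_domain
begin

lemma truncation_is_gderiv:
  assumes l: "\<And>i t. (l i has_vector_derivative l (Suc i) t) (at t)"
    and r: "\<And>i t. (r i has_vector_derivative r (Suc i) t) (at t)"
    and lb: "\<And>i u. \<exists>C. \<forall>t\<le>u. norm (l i t) \<le> C" and rb: "\<And>i u. \<exists>C. \<forall>t\<ge>u. norm (r i t) \<le> C"
  shows "is_gderiv I (\<lambda>t. if t < u then l i t else r i t) (\<lambda>t. if t < u then l (Suc i) t else r (Suc i) t)"
    and "(\<lambda>t. if t < u then l i t else r i t) \<in> GG I"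
proof -
  have c: "continuous_on UNIV (l i)" "continuous_on UNIV (r i)" for i
    using l r by (meson continuous_at_imp_continuous_on has_vector_derivative_continuous)+
  have b: "\<exists>C. \<forall>t\<in>I. norm (if t < u then l i t else r i t) \<le> C" for i
  proof -
    obtain C D where "\<forall>t\<le>u. norm (l i t) \<le> C" "\<forall>t\<ge>u. norm (r i t) \<le> D" using lb rb by meson
    then show ?thesis by (intro exI[of _ "max C D"]) (auto simp: max.coboundedI1 max.coboundedI2)
  qed
  show "is_gderiv I (\<lambda>t. if t < u then l i t else r i t) (\<lambda>t. if t < u then l (Suc i) t else r (Suc i) t)"
  proof -
    obtain C where "\<forall>t\<in>I. norm (if t < u then l (Suc i) t else r (Suc i) t) \<le> C" using b by blast
    then show ?thesis
      by (intro is_gderiv_piecewise[where p' = "l (Suc i)" and q' = "r (Suc i)" and C = C] c l r) (rule bspec)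
  qed
  show "(\<lambda>t. if t < u then l i t else r i t) \<in> GG I"
  proof -
    obtain C where "\<forall>t\<in>I. norm (if t < u then l i t else r i t) \<le> C" using b by blast
    then show ?thesis by (intro GG_piecewise[where C = C] c) (rule bspec)
  qed
qed

text \<open>The i-th derivative jumps at u by the i-th derivative of the j-th power of t - u,
  evaluated at u, and this is nonzero only for i = j.\<close>

lemma FF_k_trunc_power: "trunc u ([:- of_real u, 1:] ^ j) \<in> FF_k I j"
proof -
  let ?p = "[:- complex_of_real u, 1:] ^ j"
  obtain l r where lr: "l 0 = (\<lambda>t. - poly ?p (of_real t) * of_real (logistic t))"
    "r 0 = (\<lambda>t. poly ?p (of_real t) * of_real (1 - logistic t))"
    "\<And>i t. (l i has_vector_derivative l (Suc i) t) (at t)"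
    "\<And>i t. (r i has_vector_derivative r (Suc i) t) (at t)"
    "\<And>i t. r i t - l i t = poly ((pderiv ^^ i) ?p) (of_real t)"
    "\<And>i u. \<exists>C. \<forall>t\<le>u. norm (l i t) \<le> C"
    "\<And>i u. \<exists>C. \<forall>t\<ge>u. norm (r i t) \<le> C"
    using truncation_chain[of ?p] by blast
  define d where "d i t = (if t < u then l i t else r i t)" for i t
  have d0: "d 0 = trunc u ?p" by (auto simp: d_def trunc_def lr fun_eq_iff)
  have d: "is_gderiv I (d i) (d (Suc i))" "d i \<in> GG I" for i
    unfolding d_def[abs_def] by (rule truncation_is_gderiv[of l r, OF lr(3,4,6,7)])+
  have c: "continuous_on UNIV (l i)" "continuous_on UNIV (r i)" for i
    using lr(3,4) by (meson continuous_at_imp_continuous_on has_vector_derivative_continuous)+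
  have ae: "ae_eq I ((gderiv I ^^ i) (trunc u ?p)) (d i)" for i
    unfolding ae_eq_def AE_lebesgue_on_iff[OF open_I]
    using gderiv_funpow_AE(1)[of d "trunc u ?p" i] d by (auto simp: d0 elim!: eventually_mono)
  have "bdd_cont I ((gderiv I ^^ i) (trunc u ?p))" if "i \<noteq> j" for i
  proof -
    have "r i u - l i u = 0"
      unfolding lr(5) poly_pderiv_funpow_linear_power using that by simp
    \<comment> \<open>The branches agree at u, so u may be assigned to the left one as well, the
      form in which two continuous branches are glued.\<close>
    then have eq: "d i = (\<lambda>t. if t \<le> u then l i t else r i t)" by (auto simp: d_def fun_eq_iff)
    have "continuous_on I (d i)"
      unfolding eq using \<open>r i u - l i u = 0\<close>
      by (intro continuous_on_cases_le[where h = "\<lambda>t. t"]) (auto intro: continuous_on_subset[OF c(1)] continuous_on_subset[OF c(2)])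
    moreover have "bounded (d i ` I)"
    proof -
      obtain C D where "\<forall>t\<le>u. norm (l i t) \<le> C" "\<forall>t\<ge>u. norm (r i t) \<le> D" using lr(6,7) by meson
      then have "\<forall>t. norm (d i t) \<le> max C D" by (auto simp: d_def max.coboundedI1 max.coboundedI2)
      then show ?thesis unfolding bounded_iff by blast
    qed
    ultimately show ?thesis unfolding bdd_cont_def using ae by blast
  qed
  moreover have "pw_cont I ((gderiv I ^^ j) (trunc u ?p))"
  proof -
    have cont: "isCont (d j) t" if "t \<noteq> u" for t
    proof (cases "t < u")
      case True
      then have "\<forall>\<^sub>F s in nhds t. d j s = l j s"
        using eventually_nhds_in_open[of "{..<u}" t] by (auto simp: d_def elim!: eventually_mono)
      then show ?thesis using c(1) isCont_cong by (metis UNIV_I continuous_on_eq_continuous_at open_UNIV)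
    next
      case False
      then have "\<forall>\<^sub>F s in nhds t. d j s = r j s"
        using eventually_nhds_in_open[of "{u<..}" t] that by (auto simp: d_def elim!: eventually_mono)
      then show ?thesis using c(2) isCont_cong by (metis UNIV_I continuous_on_eq_continuous_at open_UNIV)
    qed
    have "finite {t \<in> K. \<not> isCont (d j) t}" for K
    proof (rule finite_subset)
      show "{t \<in> K. \<not> isCont (d j) t} \<subseteq> {u}" using cont by blast
    qed simp
    then show ?thesis unfolding pw_cont_def by (intro exI[of _ "d j"] conjI ae) blast
  qed
  moreover have "trunc u ?p \<in> Ginf I"
    unfolding Ginf_def using d by (intro CollectI conjI exI[of _ d]) (auto simp flip: d0)
  ultimately show ?thesis unfolding FF_k_def by blast
qed

text \<open>Elements of \<open>FF_k\<close> may jump in one derivative only, so p is expanded in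
  powers of t - u, each of which is admissible for its own k.\<close>

lemma trunc_FF: "trunc u p \<in> FF I"
proof -
  obtain c N where c: "\<And>z. poly p z = (\<Sum>j\<le>N. c j * poly ([:- of_real u, 1:] ^ j) z)"
    using poly_expand_at[of p "of_real u"] by blast
  have "trunc u p = (\<lambda>t. \<Sum>j\<le>N. c j * trunc u ([:- of_real u, 1:] ^ j) t)"
    unfolding trunc_def c by (auto simp: fun_eq_iff sum_distrib_right sum_distrib_left sum_negf[symmetric] algebra_simps
      simp del: poly_power intro!: sum.cong)
  also have "\<dots> \<in> FF I" by (intro FF_sum FF_cmult FF_base[OF FF_k_trunc_power]) auto
  finally show ?thesis .
qed

lemma poly_on_FF:
  assumes "x \<le> y"
  shows "poly_on x y p \<in> FF I"
  using FF_add[OF trunc_FF FF_cmult[OF trunc_FF, of "-1"], of x p y p] poly_on_eq_trunc[OF assms, of p]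
  by simp

text \<open>A difference of two gluings, at x and at y, of the same branches l and r: they cancel
  outside the interval and leave r - l, the polynomial, inside. The derivatives behave in the same
  way.\<close>

lemma poly_on_is_gderiv:
  assumes "x \<le> y"
  shows "is_gderiv I (poly_on x y p) (poly_on x y (pderiv p))" "poly_on x y p \<in> GG I"
proof -
  obtain l r where lr: "l 0 = (\<lambda>t. - poly p (of_real t) * of_real (logistic t))"
    "r 0 = (\<lambda>t. poly p (of_real t) * of_real (1 - logistic t))"
    "\<And>i t. (l i has_vector_derivative l (Suc i) t) (at t)"
    "\<And>i t. (r i has_vector_derivative r (Suc i) t) (at t)"
    "\<And>i t. r i t - l i t = poly ((pderiv ^^ i) p) (of_real t)"
    "\<And>i u. \<exists>C. \<forall>t\<le>u. norm (l i t) \<le> C"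
    "\<And>i u. \<exists>C. \<forall>t\<ge>u. norm (r i t) \<le> C"
    using truncation_chain[of p] by blast
  define d where "d u i t = (if t < u then l i t else r i t)" for u i t
  have d: "is_gderiv I (d u i) (d u (Suc i))" "d u i \<in> GG I" for u i
    unfolding d_def[abs_def] by (rule truncation_is_gderiv[of l r, OF lr(3,4,6,7)])+
  have eq: "poly_on x y ((pderiv ^^ i) p) = (\<lambda>t. d x i t + -1 * d y i t)" for i
    using assms unfolding poly_on_def lr(5)[symmetric] d_def by (auto simp: fun_eq_iff)
  have m: "is_gderiv I (\<lambda>t. -1 * d y i t) (\<lambda>t. 0 * d y i t + -1 * d y (Suc i) t)" for i
    by (intro is_gderiv_mult GG_const d is_gderiv_const)
  have "is_gderiv I (\<lambda>t. d x 0 t + -1 * d y 0 t) (\<lambda>t. d x 1 t + (0 * d y 0 t + -1 * d y 1 t))"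
    using m[of 0] d(1)[of x 0] by (intro is_gderiv_add d(2) GG_mult GG_const) auto
  then show "is_gderiv I (poly_on x y p) (poly_on x y (pderiv p))"
    using eq[of 0] eq[of 1] by simp
  show "poly_on x y p \<in> GG I"
    using GG_add[OF d(2)[of x 0] GG_mult[OF GG_const[of "-1"] d(2)[of y 0]]] eq[of 0] by simp
qed

lemma poly_on_limits:
  "rlim (poly_on x y p) t = poly_on x y p t"
  "llim (poly_on x y p) t = (if x < t \<and> t \<le> y then poly p (of_real t) else 0)"
proof -
  have cp: "((\<lambda>s. poly p (of_real s)) \<longlongrightarrow> poly p (of_real t)) (at t within S)" for S
    by (intro tendsto_intros)
  have "\<forall>\<^sub>F s in ess_at_right t. (if x \<le> t \<and> t < y then poly p (of_real s) else 0) = poly_on x y p s"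
  proof (cases "x \<le> t \<and> t < y")
    case True
    then show ?thesis using eventually_ess_at_right_Ioo[of t y]
      by (auto simp: poly_on_def elim!: eventually_mono)
  next
    case False
    then show ?thesis
      using eventually_ess_at_right_Ioo[of t x] eventually_ess_at_right_Ioo[of t "t + 1"]
      by (cases "t < x") (auto simp: poly_on_def elim!: eventually_mono)
  qed
  then have "(poly_on x y p \<longlongrightarrow> poly_on x y p t) (ess_at_right t)"
    by (rule Lim_transform_eventually[rotated])
      (use cp in \<open>auto simp: poly_on_def intro!: tendsto_ess_at_right\<close>)
  then show "rlim (poly_on x y p) t = poly_on x y p t" by (rule rlim_eqI)
  have "\<forall>\<^sub>F s in ess_at_left t. (if x < t \<and> t \<le> y then poly p (of_real s) else 0) = poly_on x y p s"
  proof (cases "x < t \<and> t \<le> y")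
    case True
    then show ?thesis using eventually_ess_at_left_Ioo[of x t]
      by (auto simp: poly_on_def elim!: eventually_mono)
  next
    case False
    then show ?thesis
      using eventually_ess_at_left_Ioo[of y t] eventually_ess_at_left_Ioo[of "t - 1" t]
      by (cases "y < t") (auto simp: poly_on_def elim!: eventually_mono)
  qed
  then have "(poly_on x y p \<longlongrightarrow> (if x < t \<and> t \<le> y then poly p (of_real t) else 0)) (ess_at_left t)"
    by (rule Lim_transform_eventually[rotated])
      (use cp in \<open>auto intro!: tendsto_ess_at_left\<close>)
  then show "llim (poly_on x y p) t = (if x < t \<and> t \<le> y then poly p (of_real t) else 0)" by (rule llim_eqI)
qed

end

subsection \<open>Approximation of continuous test functions by piecewise polynomials\<close>

lemma pderiv_funpow_add: "(pderiv ^^ i) (p + q) = (pderiv ^^ i) p + (pderiv ^^ i) q"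
  by (induction i) (auto simp: pderiv_add)

lemma pderiv_funpow_smult: "(pderiv ^^ i) (smult c p) = smult c ((pderiv ^^ i) p)"
  by (induction i) (auto simp: pderiv_smult)

text \<open>Adding a multiple of the k-th power of X - a corrects the k-th derivative at a without
  disturbing the lower ones.\<close>

lemma taylor_poly_exists:
  fixes v :: "nat \<Rightarrow> complex"
  shows "\<exists>T. \<forall>i<k. poly ((pderiv ^^ i) T) a = v i"
proof (induction k)
  case (Suc k)
  then obtain T where T: "\<And>i. i < k \<Longrightarrow> poly ((pderiv ^^ i) T) a = v i" by blast
  define c where "c = (v k - poly ((pderiv ^^ k) T) a) / fact k"
  have "poly ((pderiv ^^ i) (T + smult c ([:- a, 1:] ^ k))) a = v i" if "i < Suc k" for i
    using that T by (cases "i = k")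
      (auto simp: pderiv_funpow_add pderiv_funpow_smult poly_pderiv_funpow_linear_power c_def)
  then show ?case by blast
qed simp

text \<open>The Taylor polynomial T with data v at t has the right derivatives near t but misses the
  value at b. The correction r b * (X - t) repairs this and leaves the value at t alone. Its slope
  tends to 0 because \<phi> and T have the same derivative v 1 at t along S; for this T must match
  at least the first derivative, hence 1 \<le> k.\<close>

lemma interpolating_taylor_poly:
  fixes \<phi> :: cfun and v :: "nat \<Rightarrow> complex"
  assumes k: "1 \<le> k" and "\<eta> > 0" and v0: "v 0 = \<phi> t"
    and v1: "((\<lambda>b. (\<phi> b - \<phi> t) / complex_of_real (b - t)) \<longlongrightarrow> v 1) (at t within S)"
  obtains d where "d > 0" "\<And>b. b \<in> S \<Longrightarrow> b \<noteq> t \<Longrightarrow> \<bar>b - t\<bar> < d \<Longrightarrow>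
    \<exists>p. poly p (of_real t) = \<phi> t \<and> poly p (of_real b) = \<phi> b \<and>
      (\<forall>i\<le>k. \<forall>s. \<bar>s - t\<bar> \<le> \<bar>b - t\<bar> \<longrightarrow> norm (poly ((pderiv ^^ i) p) (of_real s) - v i) \<le> \<eta>)"
proof -
  obtain T where T: "\<And>i. i \<le> k \<Longrightarrow> poly ((pderiv ^^ i) T) (of_real t) = v i"
    using taylor_poly_exists[of "Suc k" "of_real t" v] by (auto simp: less_Suc_eq_le)
  define r where "r b = (\<phi> b - poly T (of_real b)) / complex_of_real (b - t)" for b
  have "((\<lambda>s. poly T (of_real s)) has_vector_derivative of_real 1 * poly (pderiv T) (of_real t)) (at t)"
    using field_vector_diff_chain_at[OF has_vector_derivative_of_real[OF DERIV_ident] poly_DERIV[of T]]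
    by (simp add: o_def)
  from this[unfolded has_vector_derivative_iff_quotient]
  have "((\<lambda>b. (poly T (of_real b) - poly T (of_real t)) / complex_of_real (b - t)) \<longlongrightarrow> v 1) (at t within S)"
    using T[of 1] k by (auto intro: tendsto_within_subset)
  from tendsto_diff[OF v1 this]
  have "((\<lambda>b. (\<phi> b - \<phi> t) / complex_of_real (b - t) - (poly T (of_real b) - poly T (of_real t)) / complex_of_real (b - t)) \<longlongrightarrow> 0) (at t within S)"
    by simp
  moreover have "(\<phi> b - \<phi> t) / complex_of_real (b - t) - (poly T (of_real b) - poly T (of_real t)) / complex_of_real (b - t) = r b" for b
    unfolding r_def diff_divide_distrib[symmetric] using T[of 0] v0 by simp
  ultimately have "(r \<longlongrightarrow> 0) (at t within S)" by simp
  from tendstoD[OF this, of "\<eta> / 2"] obtain d1 where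
    d1: "d1 > 0" "\<And>b. b \<in> S \<Longrightarrow> b \<noteq> t \<Longrightarrow> dist b t < d1 \<Longrightarrow> norm (r b) < \<eta> / 2"
    using \<open>\<eta> > 0\<close> unfolding eventually_at by auto
  have "\<forall>\<^sub>F s in nhds t. \<forall>i\<in>{..k}. dist (poly ((pderiv ^^ i) T) (of_real s)) (v i) < \<eta> / 2"
  proof (rule eventually_ball_finite)
    show "\<forall>i\<in>{..k}. \<forall>\<^sub>F s in nhds t. dist (poly ((pderiv ^^ i) T) (of_real s)) (v i) < \<eta> / 2"
    proof
      fix i assume i: "i \<in> {..k}"
      have c: "isCont (\<lambda>s. poly ((pderiv ^^ i) T) (complex_of_real s)) t" by (intro continuous_intros)
      have "poly ((pderiv ^^ i) T) (of_real t) = v i" using T[of i] i by simp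
      with tendsto_at_iff_tendsto_nhds[THEN iffD1, OF c[unfolded isCont_def]]
      have "((\<lambda>s. poly ((pderiv ^^ i) T) (complex_of_real s)) \<longlongrightarrow> v i) (nhds t)" by (simp only:)
      then show "\<forall>\<^sub>F s in nhds t. dist (poly ((pderiv ^^ i) T) (of_real s)) (v i) < \<eta> / 2"
        by (rule tendstoD) (use \<open>\<eta> > 0\<close> in simp)
    qed
  qed simp
  then obtain d2 where d2: "d2 > 0"
    "\<And>s i. dist s t < d2 \<Longrightarrow> i \<le> k \<Longrightarrow> dist (poly ((pderiv ^^ i) T) (of_real s)) (v i) < \<eta> / 2"
    unfolding eventually_nhds_metric by auto
  show ?thesis
  \<comment> \<open>The bound 1 on the distance bounds X - t by 1; d1 and d2 limit the contributions
    of the correction and of T to \<eta> / 2 each.\<close>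
  proof (rule that[of "min 1 (min d1 d2)"])
    fix b assume b: "b \<in> S" "b \<noteq> t" "\<bar>b - t\<bar> < min 1 (min d1 d2)"
    define p where "p = T + smult (r b) [:- of_real t, 1:]"
    have "poly p (of_real b) = poly T (of_real b) + r b * complex_of_real (b - t)"
      by (simp add: p_def algebra_simps)
    also have "r b * complex_of_real (b - t) = \<phi> b - poly T (of_real b)"
      using b(2) by (simp add: r_def)
    finally have "poly p (of_real b) = \<phi> b" by simp
    moreover have "poly p (of_real t) = \<phi> t"
      using T[of 0] v0 by (simp add: p_def)
    moreover have "norm (poly ((pderiv ^^ i) p) (of_real s) - v i) \<le> \<eta>"
      if i: "i \<le> k" and s: "\<bar>s - t\<bar> \<le> \<bar>b - t\<bar>" for i s
    proof -
      have lin: "norm (poly ((pderiv ^^ i) [:- complex_of_real t, 1:]) (of_real s)) \<le> 1"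
      proof -
        consider "i = 0" | "i = 1" | "i \<ge> 2" by linarith
        then show ?thesis
        proof cases
          case 1
          have "norm (complex_of_real s - complex_of_real t) = \<bar>s - t\<bar>"
            by (metis norm_of_real of_real_diff)
          with 1 s b show ?thesis by simp
        next
          case 3
          have prod: "(\<Prod>m<i. of_nat (1 - m)) = (0 :: complex)"
            by (rule prod_zero) (use 3 in \<open>auto intro!: bexI[of _ 1]\<close>)
          have "(pderiv ^^ i) ([:- complex_of_real t, 1:] ^ 1) = 0"
            unfolding pderiv_funpow_linear_power prod by simp
          then show ?thesis by simp
        qed (simp add: pderiv_pCons)
      qed
      have "poly ((pderiv ^^ i) p) (of_real s) - v i
          = (poly ((pderiv ^^ i) T) (of_real s) - v i) + r b * poly ((pderiv ^^ i) [:- complex_of_real t, 1:]) (of_real s)"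
        by (simp add: p_def pderiv_funpow_add pderiv_funpow_smult del: smult_pCons)
      also have "norm \<dots> \<le> \<eta> / 2 + \<eta> / 2 * 1"
        unfolding norm_mult
      proof (rule norm_triangle_mono)
        show "norm (poly ((pderiv ^^ i) T) (of_real s) - v i) \<le> \<eta> / 2"
          using d2(2)[of s i] i s b by (simp add: dist_norm)
        show "norm (r b * poly ((pderiv ^^ i) [:- complex_of_real t, 1:]) (of_real s)) \<le> \<eta> / 2 * 1"
          unfolding norm_mult using d1(2)[of b] b lin \<open>\<eta> > 0\<close>
          by (intro mult_mono) (auto simp: dist_real_def)
      qed
      finally show ?thesis by simp
    qed
    ultimately show "\<exists>p. poly p (of_real t) = \<phi> t \<and> poly p (of_real b) = \<phi> b \<and>
      (\<forall>i\<le>k. \<forall>s. \<bar>s - t\<bar> \<le> \<bar>b - t\<bar> \<longrightarrow> norm (poly ((pderiv ^^ i) p) (of_real s) - v i) \<le> \<eta>)" by blast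
  qed (use d1 d2 in auto)
qed

text \<open>Interpolation needs limits in the ordinary sense, whereas difference quotients of
  representatives converge only essentially. Passing to right limits removes the null sets: q' s is
  a limit of values of q that are already close to L.\<close>

lemma tendsto_if_ess:
  fixes q q' :: cfun
  assumes q: "\<And>e. e > 0 \<Longrightarrow> \<exists>d>0. AE s in lebesgue. s \<in> S \<and> \<bar>s - t\<bar> < d \<longrightarrow> dist (q s) L < e"
    and S: "open S" and "0 < b"
    and q': "\<And>s. s \<in> S \<Longrightarrow> \<bar>s - t\<bar> < b \<Longrightarrow> (q \<longlongrightarrow> q' s) (ess_at_right s)"
  shows "(q' \<longlongrightarrow> L) (at t within S)"
proof (rule tendstoI)
  fix e :: real assume e: "e > 0"
  then obtain d where d: "d > 0" "AE s in lebesgue. s \<in> S \<and> \<bar>s - t\<bar> < d \<longrightarrow> dist (q s) L < e / 2"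
    using q[of "e / 2"] by auto
  have "dist (q' s) L < e" if s: "s \<in> S" "dist s t < min b d" for s
  proof -
    have "\<forall>\<^sub>F r in ess_at_right s. dist (q r) L \<le> e / 2"
      by (rule AE_eventually_ess_at_right[of "S \<inter> ball t d"])
        (use d s S in \<open>auto simp: dist_real_def abs_minus_commute elim!: eventually_mono\<close>)
    then have "dist (q' s) L \<le> e / 2"
      using q'[of s] s by (intro tendsto_upperbound[OF tendsto_dist[OF _ tendsto_const]]) (auto simp: dist_real_def)
    then show ?thesis using e by simp
  qed
  then show "\<forall>\<^sub>F s in at t within S. dist (q' s) L < e"
    unfolding eventually_at using \<open>0 < b\<close> d(1) by (intro exI[of _ "min b d"]) auto
qed

context open_interval
begin

lemma rlim_zero_outside:
  assumes "closed K" "AE s\<in>I in lebesgue. s \<notin> K \<longrightarrow> g s = 0" "t \<in> I - K"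
  shows "rlim g t = 0"
proof -
  have "open (I - K)" using assms(1) open_I by blast
  moreover have "AE s in lebesgue. s \<in> I - K \<longrightarrow> g s = 0" using assms(2) by eventually_elim auto
  ultimately show ?thesis
    by (intro rlim_eqI tendsto_eventually AE_eventually_ess_at_right[of "I - K"] assms(3))
qed

lemma Ginf_funpow_AE_zero_outside:
  assumes "\<psi> \<in> Ginf I" "closed K" "AE t\<in>I in lebesgue. t \<notin> K \<longrightarrow> \<psi> t = 0"
  shows "AE t\<in>I in lebesgue. t \<notin> K \<longrightarrow> (gderiv I ^^ i) \<psi> t = 0"
proof (induction i)
  case (Suc i)
  show ?case by (rule is_gderiv_AE_zero_outside[OF Ginf_funpow[OF assms(1)] assms(2) Suc])
qed (use assms(3) in simp)

section \<open>Piecewise polynomials joined over a compact interval\<close>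

context
  fixes \<psi> :: cfun and k :: nat and \<eta> :: real
  assumes \<psi>: "\<psi> \<in> Ginf I" and cont: "\<And>t. t \<in> I \<Longrightarrow> jump t \<psi> = 0" and k: "1 \<le> k" and \<eta>: "0 < \<eta>"
begin

text \<open>\<open>Q i\<close> plays the i-th derivative of a piecewise polynomial living on [x, y[.
  The last clause gives \<open>Q 0\<close> the jumps of \<psi> restricted to this interval, so that
  the jumps at a common endpoint cancel when adjacent pieces are added.\<close>

private definition approx :: "real \<Rightarrow> real \<Rightarrow> (nat \<Rightarrow> cfun) \<Rightarrow> bool" where
  "approx x y Q \<longleftrightarrow> Q 0 \<in> FF I \<and> (\<forall>i. Q i \<in> GG I \<and> is_gderiv I (Q i) (Q (Suc i)) \<and>
      (AE s in lebesgue. s \<notin> {x..y} \<longrightarrow> Q i s = 0)) \<and>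
    (\<forall>i\<le>k. AE s in lebesgue. x < s \<and> s < y \<longrightarrow> norm ((gderiv I ^^ i) \<psi> s - Q i s) \<le> 2 * \<eta>) \<and>
    (\<forall>s\<in>I. jump s (Q 0) = (if s = x then rlim \<psi> x else 0) - (if s = y then rlim \<psi> y else 0))"

private lemma approx_refl: "approx x x (\<lambda>_ _. 0)"
  unfolding approx_def
proof (intro conjI allI ballI impI)
  show "(\<lambda>_. 0) \<in> FF I" unfolding FF_def by (intro CollectI exI[of _ "{}"]) auto
qed (auto simp: GG_const is_gderiv_const jump_def rlim_const llim_const)

private lemma approx_trans:
  assumes Q: "approx x y Q" and R: "approx y z R" and "x \<le> y" "y \<le> z"
  shows "approx x z (\<lambda>i t. Q i t + R i t)"
  unfolding approx_def
proof (intro conjI allI ballI impI)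
  note Q' = Q[unfolded approx_def] and R' = R[unfolded approx_def]
  show "(\<lambda>t. Q 0 t + R 0 t) \<in> FF I" using Q' R' by (intro FF_add) auto
  show "(\<lambda>t. Q i t + R i t) \<in> GG I" "is_gderiv I (\<lambda>t. Q i t + R i t) (\<lambda>t. Q (Suc i) t + R (Suc i) t)" for i
    using Q' R' by (intro GG_add is_gderiv_add; auto)+
  have Q0: "AE s in lebesgue. s \<notin> {x..y} \<longrightarrow> Q i s = 0" and R0: "AE s in lebesgue. s \<notin> {y..z} \<longrightarrow> R i s = 0" for i
    using Q' R' by auto
  show "AE s in lebesgue. s \<notin> {x..z} \<longrightarrow> Q i s + R i s = 0" for i
    using Q0[of i] R0[of i] by eventually_elim (use assms(3,4) in auto)
  show "AE s in lebesgue. x < s \<and> s < z \<longrightarrow> norm ((gderiv I ^^ i) \<psi> s - (Q i s + R i s)) \<le> 2 * \<eta>" if "i \<le> k" for i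
  proof -
    have "AE s in lebesgue. x < s \<and> s < y \<longrightarrow> norm ((gderiv I ^^ i) \<psi> s - Q i s) \<le> 2 * \<eta>"
      "AE s in lebesgue. y < s \<and> s < z \<longrightarrow> norm ((gderiv I ^^ i) \<psi> s - R i s) \<le> 2 * \<eta>"
      using Q' R' that by auto
    then show ?thesis
      using Q0[of i] R0[of i] AE_lebesgue_neq[of y]
    proof eventually_elim
      case (elim s)
      then show ?case by (cases s y rule: linorder_cases) auto
    qed
  qed
  show "jump s (\<lambda>t. Q 0 t + R 0 t) = (if s = x then rlim \<psi> x else 0) - (if s = z then rlim \<psi> z else 0)"
    if s: "s \<in> I" for s
  proof -
    have "jump s (\<lambda>t. Q 0 t + R 0 t) = jump s (Q 0) + jump s (R 0)"
    proof -
      have G: "Q 0 \<in> GG I" "R 0 \<in> GG I" using Q' R' by auto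
      show ?thesis unfolding jump_def rlim_add[OF G s] llim_add[OF G s] by simp
    qed
    also have "jump s (Q 0) = (if s = x then rlim \<psi> x else 0) - (if s = y then rlim \<psi> y else 0)"
      using Q' s by blast
    also have "jump s (R 0) = (if s = y then rlim \<psi> y else 0) - (if s = z then rlim \<psi> z else 0)"
      using R' s by blast
    finally show ?thesis by simp
  qed
qed

text \<open>The derivatives of \<psi> and of p are compared through the constants v i, with an error
  \<eta> on each side; this is the origin of 2 * \<eta>.\<close>

private lemma approx_poly:
  assumes "x < y" "poly p (of_real x) = rlim \<psi> x" "poly p (of_real y) = rlim \<psi> y"
    "\<And>i. i \<le> k \<Longrightarrow> AE s in lebesgue. x < s \<and> s < y \<longrightarrow> norm ((gderiv I ^^ i) \<psi> s - v i) \<le> \<eta>"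
    "\<And>i s. i \<le> k \<Longrightarrow> x < s \<Longrightarrow> s < y \<Longrightarrow> norm (poly ((pderiv ^^ i) p) (of_real s) - v i) \<le> \<eta>"
  shows "approx x y (\<lambda>i. poly_on x y ((pderiv ^^ i) p))"
  unfolding approx_def
proof (intro conjI allI ballI impI)
  have le: "x \<le> y" using assms(1) by simp
  show "poly_on x y ((pderiv ^^ 0) p) \<in> FF I" by (rule poly_on_FF[OF le])
  show "poly_on x y ((pderiv ^^ i) p) \<in> GG I"
    "is_gderiv I (poly_on x y ((pderiv ^^ i) p)) (poly_on x y ((pderiv ^^ Suc i) p))" for i
    using poly_on_is_gderiv[OF le] by auto
  show "AE s in lebesgue. s \<notin> {x..y} \<longrightarrow> poly_on x y ((pderiv ^^ i) p) s = 0" for i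
    by (auto simp: poly_on_def)
  show "AE s in lebesgue. x < s \<and> s < y \<longrightarrow> norm ((gderiv I ^^ i) \<psi> s - poly_on x y ((pderiv ^^ i) p) s) \<le> 2 * \<eta>"
    if "i \<le> k" for i
    using assms(4)[OF that]
  proof eventually_elim
    case (elim s)
    show ?case
    proof
      assume s: "x < s \<and> s < y"
      then have "dist ((gderiv I ^^ i) \<psi> s) (v i) \<le> \<eta>" "dist (poly ((pderiv ^^ i) p) (of_real s)) (v i) \<le> \<eta>"
        using elim assms(5)[OF that] by (auto simp: dist_norm)
      then show "norm ((gderiv I ^^ i) \<psi> s - poly_on x y ((pderiv ^^ i) p) s) \<le> 2 * \<eta>"
        using s dist_triangle2[of "(gderiv I ^^ i) \<psi> s" "poly ((pderiv ^^ i) p) (of_real s)" "v i"]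
        by (simp add: dist_norm poly_on_def)
    qed
  qed
  show "jump s (poly_on x y ((pderiv ^^ 0) p)) = (if s = x then rlim \<psi> x else 0) - (if s = y then rlim \<psi> y else 0)" for s
    using assms(1-3) unfolding jump_def poly_on_limits by (auto simp: poly_on_def)
qed

text \<open>Treats both sides of t at once: F is the essential filter on one side, S the open
  half-line, v i the limit of the i-th derivative along F, and \<open>min\<close>,
  \<open>max\<close> put b and t in order. Interpolation is carried out for
  \<open>rlim \<psi>\<close>, whose values do not depend on the representative.\<close>

private lemma approx_one_side:
  assumes t: "t \<in> I" and S: "S = {t<..} \<or> S = {..<t}" and v0: "v 0 = rlim \<psi> t"
    and lim: "\<And>P. eventually P F \<Longrightarrow> \<exists>d>0. AE s in lebesgue. s \<in> S \<and> \<bar>s - t\<bar> < d \<longrightarrow> P s"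
    and v: "\<And>i. ((gderiv I ^^ i) \<psi> \<longlongrightarrow> v i) F"
    and v1: "((\<lambda>b. (\<psi> b - rlim \<psi> t) / complex_of_real (b - t)) \<longlongrightarrow> v 1) F"
  shows "\<exists>d>0. \<forall>b\<in>S. \<bar>b - t\<bar> < d \<longrightarrow> (\<exists>Q. approx (min b t) (max b t) Q)"
proof -
  obtain r where r: "r > 0" "ball t r \<subseteq> I" using open_I t openE by blast
  have "((\<lambda>b. (rlim \<psi> b - rlim \<psi> t) / complex_of_real (b - t)) \<longlongrightarrow> v 1) (at t within S)"
  proof (rule tendsto_if_ess[OF lim[OF tendstoD[OF v1]] _ r(1)])
    show "open S" using S by auto
    show "((\<lambda>b. (\<psi> b - rlim \<psi> t) / complex_of_real (b - t)) \<longlongrightarrow> (rlim \<psi> s - rlim \<psi> t) / complex_of_real (s - t)) (ess_at_right s)"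
      if "s \<in> S" "\<bar>s - t\<bar> < r" for s
    proof -
      have "s \<in> I" "s \<noteq> t" using that r(2) S by (auto simp: subset_eq dist_real_def)
      moreover have "((\<lambda>b. b) \<longlongrightarrow> s) (ess_at_right s)" by (intro tendsto_ess_at_right tendsto_intros)
      ultimately show ?thesis by (intro tendsto_intros GG_tendsto_right Ginf_GG \<psi>) auto
    qed
  qed
  from interpolating_taylor_poly[OF k \<eta> v0 this] obtain d1 where d1: "d1 > 0"
    "\<And>b. b \<in> S \<Longrightarrow> b \<noteq> t \<Longrightarrow> \<bar>b - t\<bar> < d1 \<Longrightarrow>
    \<exists>p. poly p (of_real t) = rlim \<psi> t \<and> poly p (of_real b) = rlim \<psi> b \<and>
      (\<forall>i\<le>k. \<forall>s. \<bar>s - t\<bar> \<le> \<bar>b - t\<bar> \<longrightarrow> norm (poly ((pderiv ^^ i) p) (of_real s) - v i) \<le> \<eta>)"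
    by blast
  have "\<forall>\<^sub>F s in F. \<forall>i\<in>{..k}. dist ((gderiv I ^^ i) \<psi> s) (v i) < \<eta>"
    by (rule eventually_ball_finite) (use tendstoD[OF v \<eta>] in auto)
  from lim[OF this] obtain d2 where d2: "d2 > 0"
    "AE s in lebesgue. s \<in> S \<and> \<bar>s - t\<bar> < d2 \<longrightarrow> (\<forall>i\<in>{..k}. dist ((gderiv I ^^ i) \<psi> s) (v i) < \<eta>)"
    by blast
  have "\<exists>Q. approx (min b t) (max b t) Q" if b: "b \<in> S" "\<bar>b - t\<bar> < min d1 d2" for b
  proof -
    have bt: "b \<noteq> t" "\<bar>b - t\<bar> < d1" using b S by auto
    from d1(2)[OF b(1) this] obtain p where p: "poly p (of_real t) = rlim \<psi> t" "poly p (of_real b) = rlim \<psi> b"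
      "\<And>i s. i \<le> k \<Longrightarrow> \<bar>s - t\<bar> \<le> \<bar>b - t\<bar> \<Longrightarrow> norm (poly ((pderiv ^^ i) p) (of_real s) - v i) \<le> \<eta>"
      by blast
    have "approx (min b t) (max b t) (\<lambda>i. poly_on (min b t) (max b t) ((pderiv ^^ i) p))"
    proof (rule approx_poly[of _ _ _ v])
      show "poly p (of_real (min b t)) = rlim \<psi> (min b t)" "poly p (of_real (max b t)) = rlim \<psi> (max b t)"
        using p(1,2) by (simp_all add: min_def max_def)
      show "AE s in lebesgue. min b t < s \<and> s < max b t \<longrightarrow> norm ((gderiv I ^^ i) \<psi> s - v i) \<le> \<eta>" if i: "i \<le> k" for i
        using d2(2)
      proof eventually_elim
        case (elim s)
        show ?case
        proof
          assume s: "min b t < s \<and> s < max b t"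
          then have "s \<in> S \<and> \<bar>s - t\<bar> < d2" using S b by (auto simp: min_def max_def split: if_splits)
          with elim i show "norm ((gderiv I ^^ i) \<psi> s - v i) \<le> \<eta>" by (force simp: dist_norm)
        qed
      qed
      show "norm (poly ((pderiv ^^ i) p) (of_real s) - v i) \<le> \<eta>" if "i \<le> k" "min b t < s" "s < max b t" for i s
        by (rule p(3)[OF that(1)]) (use that(2,3) in \<open>auto simp: min_def max_def split: if_splits\<close>)
    qed (use bt(1) in auto)
    then show ?thesis by blast
  qed
  then show ?thesis using d1(1) d2(1) by (intro exI[of _ "min d1 d2"]) auto
qed

private lemma approx_right:
  assumes t: "t \<in> I"
  shows "\<exists>d>0. \<forall>b\<in>{t<..}. \<bar>b - t\<bar> < d \<longrightarrow> (\<exists>Q. approx (min b t) (max b t) Q)"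
proof (rule approx_one_side[OF t, of _ "\<lambda>i. rlim ((gderiv I ^^ i) \<psi>) t" "ess_at_right t"])
  show "\<exists>d>0. AE s in lebesgue. s \<in> {t<..} \<and> \<bar>s - t\<bar> < d \<longrightarrow> P s" if P: "eventually P (ess_at_right t)" for P
  proof -
    obtain d where "d > 0" "AE s in lebesgue. t < s \<and> s < t + d \<longrightarrow> P s"
      using P unfolding eventually_ess_at_right by blast
    then show ?thesis by (intro exI[of _ d]) (auto elim!: eventually_mono)
  qed
qed (use is_gderiv_right[OF Ginf_gderiv(1)[OF \<psi>] t] GG_tendsto_right[OF Ginf_GG[OF Ginf_funpow_in[OF \<psi>]] t] in auto)

private lemma approx_left:
  assumes t: "t \<in> I"
  shows "\<exists>d>0. \<forall>b\<in>{..<t}. \<bar>b - t\<bar> < d \<longrightarrow> (\<exists>Q. approx (min b t) (max b t) Q)"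
proof (rule approx_one_side[OF t, of _ "\<lambda>i. llim ((gderiv I ^^ i) \<psi>) t" "ess_at_left t"])
  \<comment> \<open>Here the absence of jumps matters: the piece on the left must end in the value
    \<open>rlim \<psi> t\<close> with which the piece on the right begins.\<close>
  have c: "llim \<psi> t = rlim \<psi> t" using cont[OF t] by (simp add: jump_def)
  then show "llim ((gderiv I ^^ 0) \<psi>) t = rlim \<psi> t" by simp
  show "\<exists>d>0. AE s in lebesgue. s \<in> {..<t} \<and> \<bar>s - t\<bar> < d \<longrightarrow> P s" if P: "eventually P (ess_at_left t)" for P
  proof -
    obtain d where "d > 0" "AE s in lebesgue. t - d < s \<and> s < t \<longrightarrow> P s"
      using P unfolding eventually_ess_at_left by blast
    then show ?thesis by (intro exI[of _ d]) (auto elim!: eventually_mono)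
  qed
  show "((\<lambda>b. (\<psi> b - rlim \<psi> t) / complex_of_real (b - t)) \<longlongrightarrow> llim ((gderiv I ^^ 1) \<psi>) t) (ess_at_left t)"
    using is_gderiv_left[OF Ginf_gderiv(1)[OF \<psi>] t] by (simp add: c)
qed (use GG_tendsto_left[OF Ginf_GG[OF Ginf_funpow_in[OF \<psi>]] t] in auto)

text \<open>Bisection: a short interval around t is split at t, where one piece on each side is
  available, and adjacent pieces can be joined.\<close>

private lemma approx_exists:
  assumes "c \<le> d" "{c..d} \<subseteq> I"
  shows "\<exists>Q. approx c d Q"
  using assms(1)
proof (rule Bolzano)
  fix t assume "c \<le> t" "t \<le> d"
  then have t: "t \<in> I" using assms(2) by auto
  obtain d1 where d1: "d1 > 0" "\<forall>b\<in>{t<..}. \<bar>b - t\<bar> < d1 \<longrightarrow> (\<exists>Q. approx (min b t) (max b t) Q)"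
    using approx_right[OF t] by blast
  obtain d2 where d2: "d2 > 0" "\<forall>b\<in>{..<t}. \<bar>b - t\<bar> < d2 \<longrightarrow> (\<exists>Q. approx (min b t) (max b t) Q)"
    using approx_left[OF t] by blast
  have right: "\<exists>Q. approx t b Q" if "t \<le> b" "b < t + d1" for b
    using d1(2)[rule_format, of b] approx_refl[of t] that by (cases "b = t") auto
  have left: "\<exists>Q. approx b t Q" if "b \<le> t" "t - d2 < b" for b
    using d2(2)[rule_format, of b] approx_refl[of t] that by (cases "b = t") auto
  have "\<exists>Q. approx x y Q" if "x \<le> t" "t \<le> y" "y - x < min d1 d2" for x y
  proof -
    have "\<exists>Q. approx x t Q" "\<exists>R. approx t y R" by (rule left, use that in auto, rule right, use that in auto)
    then obtain Q R where "approx x t Q" "approx t y R" by blast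
    then show ?thesis using approx_trans that by blast
  qed
  then show "\<exists>e>0. \<forall>x y. x \<le> t \<and> t \<le> y \<and> y - x < e \<longrightarrow> (\<exists>Q. approx x y Q)"
    using d1(1) d2(1) by (intro exI[of _ "min d1 d2"]) auto
qed (use approx_trans in blast)

text \<open>The jumps that remain in \<open>approx c d Q\<close> sit at c and d and have the sizes
  of \<open>rlim \<psi>\<close> there, which are 0. Outside {c..d} the functions and their
  derivatives vanish almost everywhere, so the estimate extends to all of I.\<close>

lemma piecewise_poly_approximation:
  assumes cd: "c \<le> d" "{c..d} \<subseteq> I" and supp: "AE t\<in>I in lebesgue. t \<notin> {c<..<d} \<longrightarrow> \<psi> t = 0"
    and ends: "rlim \<psi> c = 0" "rlim \<psi> d = 0"
  obtains q where "q \<in> RR_F I" "\<And>t. t \<in> I \<Longrightarrow> jump t q = 0" "(\<lambda>t. \<psi> t - q t) \<in> RR_on I {c..d}"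
    "gnorm I k (\<lambda>t. \<psi> t - q t) \<le> 2 * \<eta>"
proof -
  obtain Q where "approx c d Q" using approx_exists[OF cd] by blast
  note Q = this[unfolded approx_def]
  have QG: "is_gderiv I (Q i) (Q (Suc i))" "Q i \<in> GG I" for i using Q by auto
  have Q0: "AE t in lebesgue. t \<notin> {c..d} \<longrightarrow> Q i t = 0" for i using Q by auto
  have Qinf: "Q 0 \<in> Ginf I"
    unfolding Ginf_def using QG by (intro CollectI conjI exI[of _ Q]) auto
  have QRR: "Q 0 \<in> RR I"
    by (rule RR_I[of _ "{c..d}", OF Qinf]) (use Q0[of 0] cd in \<open>auto elim!: eventually_mono\<close>)
  have \<psi>0: "AE t\<in>I in lebesgue. t \<notin> {c..d} \<longrightarrow> (gderiv I ^^ i) \<psi> t = 0" for i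
    by (rule Ginf_funpow_AE_zero_outside[OF \<psi>]) (use supp in \<open>auto elim!: eventually_mono\<close>)
  have diff: "(\<lambda>t. \<psi> t - Q 0 t) \<in> Ginf I" by (rule Ginf_diff[OF \<psi> Qinf])
  have chain: "is_gderiv I (\<lambda>t. (gderiv I ^^ i) \<psi> t - Q i t) (\<lambda>t. (gderiv I ^^ Suc i) \<psi> t - Q (Suc i) t)" for i
    by (intro is_gderiv_diff QG Ginf_funpow \<psi> Ginf_GG[OF Ginf_funpow_in[OF \<psi>]])
  have "AE t\<in>I in lebesgue. norm ((gderiv I ^^ i) (\<lambda>t. \<psi> t - Q 0 t) t) \<le> 2 * \<eta>" if i: "i \<le> k" for i
  proof -
    have "AE t\<in>I in lebesgue. (gderiv I ^^ i) \<psi> t - Q i t = (gderiv I ^^ i) (\<lambda>t. \<psi> t - Q 0 t) t"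
      by (rule gderiv_funpow_AE(1)[of "\<lambda>i t. (gderiv I ^^ i) \<psi> t - Q i t"]) (use chain in auto)
    moreover have "AE s in lebesgue. c < s \<and> s < d \<longrightarrow> norm ((gderiv I ^^ i) \<psi> s - Q i s) \<le> 2 * \<eta>"
      using Q i by auto
    ultimately show ?thesis
      using \<psi>0[of i] Q0[of i] AE_lebesgue_neq[of c] AE_lebesgue_neq[of d]
    proof eventually_elim
      case (elim t)
      show ?case
      proof
        assume t: "t \<in> I"
        show "norm ((gderiv I ^^ i) (\<lambda>t. \<psi> t - Q 0 t) t) \<le> 2 * \<eta>"
        proof (cases "t \<in> {c..d}")
          case True
          then have "c < t \<and> t < d" using elim by auto
          then show ?thesis using elim t by metis
        next
          case False
          then have "(gderiv I ^^ i) \<psi> t - Q i t = 0" using elim t by simp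
          then show ?thesis using elim t \<eta> by (metis norm_zero less_imp_le mult_nonneg_nonneg zero_le_numeral)
        qed
      qed
    qed
  qed
  then have "gnorm I k (\<lambda>t. \<psi> t - Q 0 t) \<le> 2 * \<eta>"
    using \<eta> by (intro gnorm_le diff) auto
  moreover have "(\<lambda>t. \<psi> t - Q 0 t) \<in> RR_on I {c..d}"
    unfolding RR_on_def AE_lebesgue_on_iff[OF open_I] using diff \<psi>0[of 0] Q0[of 0]
    by (auto elim!: eventually_elim2)
  moreover have "Q 0 \<in> RR_F I" unfolding RR_F_def using QRR Q by blast
  moreover have "jump t (Q 0) = 0" if "t \<in> I" for t using Q that ends by auto
  ultimately show ?thesis using that[of "Q 0"] by blast
qed

end

text \<open>For a jump-free q in \<open>RR_F I\<close> the sum defining \<open>Delta\<close> is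
  empty, so g q = 0 and g \<psi> = g (\<psi> - q), which is small by continuity. The step space of
  {c..d} and its k and \<delta> are fixed before q is chosen.\<close>

lemma Delta_continuous:
  assumes g: "g \<in> Delta I" and \<psi>: "\<psi> \<in> RR I" and cont: "\<And>t. t \<in> I \<Longrightarrow> jump t \<psi> = 0"
  shows "g \<psi> = 0"
proof -
  obtain t0 where "t0 \<in> I" using nonempty_I by blast
  obtain K where K: "compact K" "K \<subseteq> I" "AE t\<in>I in lebesgue. t \<notin> K \<longrightarrow> \<psi> t = 0"
    by (rule RR_E[OF \<psi>])
  obtain c d where cd: "c < t0" "t0 < d" "{c..d} \<subseteq> I" "K \<subseteq> {c<..<d}"
    by (rule compact_subset_Icc[OF K(1,2) \<open>t0 \<in> I\<close>])
  have supp: "AE t\<in>I in lebesgue. t \<notin> {c<..<d} \<longrightarrow> \<psi> t = 0"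
    using K(3) by eventually_elim (use cd(4) in blast)
  have ends: "rlim \<psi> c = 0" "rlim \<psi> d = 0"
    using cd by (auto intro!: rlim_zero_outside[OF compact_imp_closed[OF K(1)] K(3)])
  have gd: "g \<in> RR_dual I" using g by (simp add: Delta_def)
  have "norm (g \<psi>) \<le> 0 + e" if e: "e > 0" for e
  proof -
    obtain k \<delta> where k: "\<delta> > 0" "\<And>\<psi>. \<psi> \<in> RR_on I {c..d} \<Longrightarrow> gnorm I k \<psi> < \<delta> \<Longrightarrow> norm (g \<psi>) < e"
      by (rule RR_dual_continuous[OF gd _ _ _ e, of "{c..d}"]) (use cd in \<open>auto simp: is_interval_cc\<close>)
    \<comment> \<open>The approximation works for orders at least 1, hence \<open>max 1 k\<close>;
      and 2 * (\<delta> / 4) stays strictly below \<delta>.\<close>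
    obtain q where q: "q \<in> RR_F I" "\<And>t. t \<in> I \<Longrightarrow> jump t q = 0" "(\<lambda>t. \<psi> t - q t) \<in> RR_on I {c..d}"
      "gnorm I (max 1 k) (\<lambda>t. \<psi> t - q t) \<le> 2 * (\<delta> / 4)"
      by (rule piecewise_poly_approximation[OF RR_Ginf[OF \<psi>] cont, of "max 1 k" "\<delta> / 4" c d])
        (use k(1) cd supp ends in auto)
    have "gnorm I k (\<lambda>t. \<psi> t - q t) < \<delta>"
      using gnorm_mono[of k "max 1 k" I "\<lambda>t. \<psi> t - q t"] q(4) k(1) by simp
    then have "norm (g (\<lambda>t. \<psi> t - q t)) < e" using k(2) q(3) by blast
    moreover have "g q = 0"
    proof -
      obtain c where "\<forall>\<phi>\<in>RR_F I. g \<phi> = (\<Sum>t | t \<in> I \<and> jump t \<phi> \<noteq> 0. c t * jump t \<phi>)"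
        using g unfolding Delta_def by blast
      moreover have "{t. t \<in> I \<and> jump t q \<noteq> 0} = {}" using q(2) by blast
      ultimately show ?thesis using q(1) by (metis (no_types, lifting) sum.empty)
    qed
    moreover have "g (\<lambda>t. \<psi> t - q t) = g \<psi> - g q"
      by (rule RR_dual_diff[OF gd \<psi>]) (use q(1) in \<open>simp add: RR_F_def\<close>)
    ultimately show ?thesis by simp
  qed
  then have "norm (g \<psi>) \<le> 0" by (rule field_le_epsilon)
  then show ?thesis by simp
qed

end

subsection \<open>Linear Volterra equations\<close>

lemma absolutely_integrable_bounded_mult_continuous:
  fixes f g :: cfun
  assumes "f \<in> borel_measurable (lebesgue_on {a..b})" "\<And>t. t \<in> {a..b} \<Longrightarrow> norm (f t) \<le> C"
    "continuous_on {a..b} g"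
  shows "(\<lambda>t. f t * g t) absolutely_integrable_on {a..b}"
proof (rule absolutely_integrable_bounded_measurable_product[OF bilinear_times assms(1)])
  show "bounded (f ` {a..b})" using assms(2) unfolding bounded_iff by blast
  show "g absolutely_integrable_on {a..b}" by (rule absolutely_integrable_continuous_real[OF assms(3)])
qed simp

text \<open>Banach's fixed point theorem with an exponential weight (Bielecki's norm): for w t = exp
  (- L * (d - t)) * u t the integral operator contracts on the whole interval at once, whatever its
  length.\<close>

lemma volterra_system:
  fixes M :: "'n::finite \<Rightarrow> 'n \<Rightarrow> cfun" and b :: "'n \<Rightarrow> cfun"
  assumes ed: "e \<le> d"
    and M: "\<And>j i. M j i \<in> borel_measurable (lebesgue_on {e..d})"
      "\<And>j i t. t \<in> {e..d} \<Longrightarrow> norm (M j i t) \<le> C"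
    and b: "\<And>j. b j \<in> borel_measurable (lebesgue_on {e..d})"
      "\<And>j t. t \<in> {e..d} \<Longrightarrow> norm (b j t) \<le> C'"
  obtains u :: "'n \<Rightarrow> cfun" where "\<And>j. continuous_on {e..d} (u j)"
    "\<And>j. (\<lambda>s. (\<Sum>i\<in>UNIV. M j i s * u i s) + b j s) absolutely_integrable_on {e..d}"
    "\<And>j t. t \<in> {e..d} \<Longrightarrow> u j t = integral {t..d} (\<lambda>s. (\<Sum>i\<in>UNIV. M j i s * u i s) + b j s)"
proof -
  define n where "n = real CARD('n)"
  have n: "n \<ge> 1" unfolding n_def by (simp add: Suc_leI)
  define K where "K = max C 1"
  have K: "K \<ge> 1" "\<And>j i t. t \<in> {e..d} \<Longrightarrow> norm (M j i t) \<le> K"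
    using M(2) unfolding K_def by (auto simp: le_max_iff_disj)
  \<comment> \<open>A component of the operator has Lipschitz constant n * K / L, and the norm of a
    vector is estimated by the sum of its n components; the choice of L makes the total 1 / 2. K
    \<ge> 1 ensures L > 0.\<close>
  define L where "L = 2 * (n * (n * K))"
  have L: "L > 0" unfolding L_def using n K(1) by simp
  define h where "h w j s = (\<Sum>i\<in>UNIV. M j i s * (of_real (exp (L * (d - s))) * w s $ i)) + b j s"
    for w :: "real \<Rightarrow> complex ^ 'n" and j s
  have h_int: "h w j absolutely_integrable_on {e..d}" if "continuous_on UNIV w" for w j
  proof -
    have c: "continuous_on {e..d} (\<lambda>s. of_real (exp (L * (d - s))) * w s $ i)" for i
      by (intro continuous_intros continuous_on_component continuous_on_subset[OF that]) auto
    have "(\<lambda>s. M j i s * (of_real (exp (L * (d - s))) * w s $ i)) absolutely_integrable_on {e..d}" for i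
      by (rule absolutely_integrable_bounded_mult_continuous[OF M(1) M(2) c])
    moreover have "b j absolutely_integrable_on {e..d}"
      using absolutely_integrable_bounded_mult_continuous[OF b(1)[of j] b(2) continuous_on_const[of _ 1]] by simp
    ultimately show ?thesis unfolding h_def
      by (intro set_integral_add absolutely_integrable_sum) auto
  qed
  then have h_int': "h w j integrable_on {t..d}" if "continuous_on UNIV w" "t \<in> {e..d}" for w j t
    using that integrable_on_subinterval[OF set_lebesgue_integral_eq_integral(1)[OF h_int[OF that(1)]]] by auto
  \<comment> \<open>Clamping to {e..d} extends functions to the whole line, so that the fixed point
    is found in the complete space of bounded continuous functions.\<close>
  define proj where "proj t = max e (min d t)" for t :: real
  have proj: "proj t \<in> {e..d}" "t \<in> {e..d} \<Longrightarrow> proj t = t" for t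
    using ed by (auto simp: proj_def)
  define Tf where "Tf w t = (\<chi> j. of_real (exp (- (L * (d - proj t)))) * integral {proj t..d} (h w j))"
    for w :: "real \<Rightarrow> complex ^ 'n" and t
  have Tf: "Tf w \<in> bcontfun" if w: "continuous_on UNIV w" for w
  proof -
    let ?f = "\<lambda>t. \<chi> j. of_real (exp (- (L * (d - t)))) * integral {t..d} (h w j)"
    have "continuous_on {e..d} (\<lambda>t. integral {t..d} (h w j))" for j
      by (rule indefinite_integral_continuous_1') (use h_int'[OF w, of e j] ed in auto)
    then have c: "continuous_on {e..d} ?f"
      by (intro continuous_on_vec_lambda continuous_intros)
    have "continuous_on UNIV proj" unfolding proj_def by (intro continuous_intros)
    moreover have "continuous_on (range proj) ?f"
      by (rule continuous_on_subset[OF c]) (use proj(1) in blast)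
    ultimately have "continuous_on UNIV (?f \<circ> proj)"
      by (rule continuous_on_compose)
    moreover have "Tf w = ?f \<circ> proj" by (auto simp: Tf_def)
    moreover have "range (?f \<circ> proj) \<subseteq> ?f ` {e..d}" using proj(1) by auto
    ultimately show ?thesis
      using bounded_subset[OF compact_imp_bounded[OF compact_continuous_image[OF c compact_Icc]]]
      by (simp only: bcontfun_def mem_Collect_eq)
  qed
  define T where "T w = Bcontfun (Tf (apply_bcontfun w))" for w :: "real \<Rightarrow>\<^sub>C (complex ^ 'n)"
  have T: "apply_bcontfun (T w) = Tf (apply_bcontfun w)" for w
    unfolding T_def by (rule Bcontfun_inverse) (simp add: Tf)
  have "\<exists>!w. T w = w"
  proof (rule banach_fix_type[of "1/2"])
    show "\<forall>v w. dist (T v) (T w) \<le> 1 / 2 * dist v w"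
    proof (intro allI dist_bound)
      fix v w :: "real \<Rightarrow>\<^sub>C (complex ^ 'n)" and t
      define r where "r = proj t"
      define D where "D = dist v w"
      have r: "r \<in> {e..d}" unfolding r_def by (rule proj)
      have cv: "continuous_on UNIV (apply_bcontfun v)" and cw: "continuous_on UNIV (apply_bcontfun w)" by auto
      have expint: "((\<lambda>s. n * K * D * exp (L * (d - s))) has_integral n * K * D * ((exp (L * (d - r)) - 1) / L)) {r..d}"
      proof -
        have "((\<lambda>s. exp (L * (d - s))) has_integral (- exp (L * (d - d)) / L - (- exp (L * (d - r)) / L))) {r..d}"
          by (rule fundamental_theorem_of_calculus)
            (use r L in \<open>auto intro!: derivative_eq_intros simp flip: has_real_derivative_iff_has_vector_derivative\<close>)
        then have "((\<lambda>s. exp (L * (d - s))) has_integral ((exp (L * (d - r)) - 1) / L)) {r..d}"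
          by (simp add: diff_divide_distrib)
        then show ?thesis by (rule has_integral_mult_right)
      qed
      have comp: "norm (Tf v t $ j - Tf w t $ j) \<le> n * K * D / L" for j
      proof -
        have "norm (integral {r..d} (\<lambda>s. h v j s - h w j s)) \<le> integral {r..d} (\<lambda>s. n * K * D * exp (L * (d - s)))"
        proof (rule integral_norm_bound_integral)
          show "(\<lambda>s. h v j s - h w j s) integrable_on {r..d}"
            by (intro integrable_diff h_int' cv cw r)
          show "(\<lambda>s. n * K * D * exp (L * (d - s))) integrable_on {r..d}"
            using expint by blast
          fix s assume s: "s \<in> {r..d}"
          then have s': "s \<in> {e..d}" using r by auto
          have "h v j s - h w j s = (\<Sum>i\<in>UNIV. M j i s * (of_real (exp (L * (d - s))) * (apply_bcontfun v s - apply_bcontfun w s) $ i))"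
            by (simp add: h_def sum_subtractf[symmetric] algebra_simps)
          also have "norm \<dots> \<le> of_nat CARD('n) * (K * (exp (L * (d - s)) * D))"
          proof (rule sum_norm_bound)
            fix i
            have "norm ((apply_bcontfun v s - apply_bcontfun w s) $ i) \<le> D"
              using Finite_Cartesian_Product.norm_nth_le[of "apply_bcontfun v s - apply_bcontfun w s" i] dist_bounded[of v s w]
              unfolding D_def dist_norm by linarith
            then show "norm (M j i s * (of_real (exp (L * (d - s))) * (apply_bcontfun v s - apply_bcontfun w s) $ i))
                \<le> K * (exp (L * (d - s)) * D)"
              unfolding norm_mult using K(1) K(2)[OF s', of j i]
              by (intro mult_mono) auto
          qed
          finally show "norm (h v j s - h w j s) \<le> n * K * D * exp (L * (d - s))"
            by (simp add: n_def mult_ac)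
        qed
        also have "\<dots> = n * K * D * ((exp (L * (d - r)) - 1) / L)"
          by (rule integral_unique[OF expint])
        finally have 1: "norm (integral {r..d} (h v j) - integral {r..d} (h w j)) \<le> n * K * D * ((exp (L * (d - r)) - 1) / L)"
          using h_int'[OF cv r] h_int'[OF cw r] by (simp add: integral_diff)
        have "Tf v t $ j - Tf w t $ j = of_real (exp (- (L * (d - r)))) * (integral {r..d} (h v j) - integral {r..d} (h w j))"
          by (simp add: Tf_def r_def algebra_simps)
        then have "norm (Tf v t $ j - Tf w t $ j)
            = exp (- (L * (d - r))) * norm (integral {r..d} (h v j) - integral {r..d} (h w j))"
          by (simp only: norm_mult norm_of_real abs_exp_cancel)
        also have "\<dots> \<le> exp (- (L * (d - r))) * (n * K * D * ((exp (L * (d - r)) - 1) / L))"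
          by (rule mult_left_mono[OF 1]) simp
        also have "\<dots> = n * K * D / L * (exp (- (L * (d - r))) * exp (L * (d - r)) - exp (- (L * (d - r))))"
          by (simp only: times_divide_eq_left times_divide_eq_right) (simp only: algebra_simps mult_1_left)
        also have "exp (- (L * (d - r))) * exp (L * (d - r)) = 1"
          unfolding exp_add[symmetric] by simp
        also have "n * K * D / L * (1 - exp (- (L * (d - r)))) \<le> n * K * D / L * 1"
          by (rule mult_left_mono) (use n K L in \<open>auto simp: D_def\<close>)
        finally show ?thesis by simp
      qed
      have "norm (Tf v t - Tf w t) \<le> (\<Sum>j\<in>UNIV. norm ((Tf v t - Tf w t) $ j))"
        unfolding norm_vec_def by (rule L2_set_le_sum) simp
      also have "\<dots> \<le> of_nat CARD('n) * (n * K * D / L)"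
        by (rule sum_bounded_above) (use comp in simp)
      also have "\<dots> = 1 / 2 * D"
        using n K(1) by (simp add: L_def n_def[symmetric])
      finally show "dist (apply_bcontfun (T v) t) (apply_bcontfun (T w) t) \<le> 1 / 2 * dist v w"
        by (simp add: T dist_norm D_def)
    qed
  qed auto
  then obtain w where w: "T w = w" by blast
  have cw: "continuous_on UNIV (apply_bcontfun w)" by auto
  define u where "u j t = of_real (exp (L * (d - t))) * apply_bcontfun w t $ j" for j t
  have hu: "h w j = (\<lambda>s. (\<Sum>i\<in>UNIV. M j i s * u i s) + b j s)" for j
    by (simp add: h_def u_def fun_eq_iff)
  show ?thesis
  proof (rule that[of u])
    show "continuous_on {e..d} (u j)" for j
      unfolding u_def by (intro continuous_intros continuous_on_component) auto
    show "(\<lambda>s. (\<Sum>i\<in>UNIV. M j i s * u i s) + b j s) absolutely_integrable_on {e..d}" for j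
      using h_int[OF cw, of j] unfolding hu .
    show "u j t = integral {t..d} (\<lambda>s. (\<Sum>i\<in>UNIV. M j i s * u i s) + b j s)" if t: "t \<in> {e..d}" for j t
    proof -
      have "apply_bcontfun w t = Tf w t" using T[of w] w by metis
      then have "apply_bcontfun w t $ j = of_real (exp (- (L * (d - t)))) * integral {t..d} (h w j)"
        using t by (simp add: Tf_def proj)
      moreover have "complex_of_real (exp (L * (d - t))) * of_real (exp (- (L * (d - t)))) = 1"
        unfolding of_real_mult[symmetric] exp_add[symmetric] by simp
      ultimately have "u j t = integral {t..d} (h w j)" by (simp add: u_def mult.assoc[symmetric])
      then show ?thesis unfolding hu .
    qed
  qed
qed

subsection \<open>Primitives of regulated functions\<close>

lemma negligible_if_AE: "AE x in lebesgue. P x \<Longrightarrow> negligible {x. \<not> P x}"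
  by (simp add: negligible_iff_null_sets completion.AE_iff_null_sets)

text \<open>The bound holds only almost everywhere and only inside the interval. Setting f - r to 0
  on a null set that includes the endpoints turns it into a bound at every point.\<close>

lemma has_integral_AE_bound:
  fixes f :: cfun
  assumes f: "(f has_integral i) {x..y}" and "x \<le> y" "0 \<le> B"
    and ae: "AE s in lebesgue. x < s \<and> s < y \<longrightarrow> norm (f s - r) \<le> B"
  shows "norm (i - of_real (y - x) * r) \<le> B * (y - x)"
proof -
  define N where "N = insert x (insert y {s. \<not> (x < s \<and> s < y \<longrightarrow> norm (f s - r) \<le> B)})"
  define g where "g s = (if s \<in> N then 0 else f s - r)" for s
  have "((\<lambda>s. f s - r) has_integral (i - (y - x) *\<^sub>R r)) {x..y}"
    by (intro has_integral_diff f) (use has_integral_const_real[of r x y] \<open>x \<le> y\<close> in simp)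
  moreover have "negligible N" unfolding N_def using negligible_if_AE[OF ae] by (simp only: negligible_insert)
  moreover have "g s = f s - r" if "s \<in> {x..y} - N" for s
    using that by (simp add: g_def)
  ultimately have g: "(g has_integral (i - (y - x) *\<^sub>R r)) (cbox x y)"
    unfolding box_real by (rule has_integral_spike[rotated 2])
  have "norm (i - (y - x) *\<^sub>R r) \<le> B * measure lborel (cbox x y)"
  proof (rule has_integral_bound[OF \<open>0 \<le> B\<close> g])
    fix s assume "s \<in> cbox x y"
    then have "s \<in> N \<or> norm (f s - r) \<le> B" by (auto simp: N_def)
    then show "norm (g s) \<le> B" using \<open>0 \<le> B\<close> by (auto simp: g_def)
  qed
  then show ?thesis using \<open>x \<le> y\<close> by (simp add: scaleR_conv_of_real)
qed

context open_domain
begin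

text \<open>Integrability of products is derived from bounds at every point, so the values exceeding
  an essential bound are replaced by 0.\<close>

lemma GG_bounded_representative:
  assumes "g \<in> GG I"
  obtains g' C where "g' \<in> borel_measurable (lebesgue_on I)" "\<And>t. norm (g' t) \<le> C"
    "AE t\<in>I in lebesgue. g t = g' t"
proof -
  obtain C where C: "C \<ge> 0" "AE s\<in>I in lebesgue. norm (g s) \<le> C" by (rule GG_bounded[OF assms])
  have [measurable]: "g \<in> borel_measurable (lebesgue_on I)" by (rule GG_measurable[OF assms])
  show ?thesis
  proof (rule that[of "\<lambda>t. if norm (g t) \<le> C then g t else 0" C])
    show "(\<lambda>t. if norm (g t) \<le> C then g t else 0) \<in> borel_measurable (lebesgue_on I)" by measurable
    show "AE t\<in>I in lebesgue. g t = (if norm (g t) \<le> C then g t else 0)"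
      using C(2) by eventually_elim auto
  qed (use C(1) in auto)
qed

lemma continuous_GG:
  assumes "continuous_on UNIV g" "\<And>t. norm (g t) \<le> C"
  shows "g \<in> GG I" "rlim g t = g t" "llim g t = g t"
  using GG_piecewise[OF assms(1,1), of t C] rlim_piecewise[OF assms(1,1), of t t] llim_piecewise[OF assms(1,1), of t t]
    assms(2) by auto

context
  fixes G \<eta> :: cfun
  assumes G: "G \<in> GG I" and \<eta>: "\<And>x y. x \<le> y \<Longrightarrow> {x..y} \<subseteq> I \<Longrightarrow> (G has_integral (\<eta> y - \<eta> x)) {x..y}"
begin

text \<open>The quotient is the mean of G over {t..s}, and there G is almost everywhere within e / 2
  of its right limit at t.\<close>

lemma primitive_quotient_right:
  assumes t: "t \<in> I"
  shows "((\<lambda>s. (\<eta> s - \<eta> t) / complex_of_real (s - t)) \<longlongrightarrow> rlim G t) (at_right t)"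
proof (rule tendstoI)
  fix e :: real assume e: "e > 0"
  obtain r where r: "r > 0" "ball t r \<subseteq> I" using open_I t openE by blast
  obtain d where d: "d > 0" "AE s in lebesgue. t < s \<and> s < t + d \<longrightarrow> dist (G s) (rlim G t) < e / 2"
    using tendstoD[OF GG_tendsto_right[OF G t], of "e / 2"] e unfolding eventually_ess_at_right by auto
  have "dist ((\<eta> s - \<eta> t) / complex_of_real (s - t)) (rlim G t) < e" if s: "t < s" "s < t + min d r" for s
  proof -
    have "{t..s} \<subseteq> I" using r(2) s by (auto simp: subset_eq dist_real_def)
    then have "(G has_integral (\<eta> s - \<eta> t)) {t..s}" using \<eta> s by simp
    then have "norm (\<eta> s - \<eta> t - of_real (s - t) * rlim G t) \<le> e / 2 * (s - t)"
    proof (rule has_integral_AE_bound)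
      show "AE r in lebesgue. t < r \<and> r < s \<longrightarrow> norm (G r - rlim G t) \<le> e / 2"
        using d(2) by eventually_elim (use s in \<open>auto simp: dist_norm\<close>)
    qed (use s e in auto)
    moreover have "(\<eta> s - \<eta> t) / complex_of_real (s - t) - rlim G t
        = (\<eta> s - \<eta> t - of_real (s - t) * rlim G t) / complex_of_real (s - t)"
      using s by (simp add: diff_divide_distrib del: of_real_diff)
    ultimately have "norm ((\<eta> s - \<eta> t) / complex_of_real (s - t) - rlim G t) \<le> e / 2"
      using s by (simp add: norm_divide divide_le_eq del: of_real_diff)
    then show ?thesis using e by (simp add: dist_norm)
  qed
  then show "\<forall>\<^sub>F s in at_right t. dist ((\<eta> s - \<eta> t) / complex_of_real (s - t)) (rlim G t) < e"
    unfolding eventually_at_right_field using d r by (intro exI[of _ "t + min d r"]) auto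
qed

lemma primitive_quotient_left:
  assumes t: "t \<in> I"
  shows "((\<lambda>s. (\<eta> s - \<eta> t) / complex_of_real (s - t)) \<longlongrightarrow> llim G t) (at_left t)"
proof (rule tendstoI)
  fix e :: real assume e: "e > 0"
  obtain r where r: "r > 0" "ball t r \<subseteq> I" using open_I t openE by blast
  obtain d where d: "d > 0" "AE s in lebesgue. t - d < s \<and> s < t \<longrightarrow> dist (G s) (llim G t) < e / 2"
    using tendstoD[OF GG_tendsto_left[OF G t], of "e / 2"] e unfolding eventually_ess_at_left by auto
  have "dist ((\<eta> s - \<eta> t) / complex_of_real (s - t)) (llim G t) < e" if s: "t - min d r < s" "s < t" for s
  proof -
    have "{s..t} \<subseteq> I" using r(2) s by (auto simp: subset_eq dist_real_def)
    then have "(G has_integral (\<eta> t - \<eta> s)) {s..t}" using \<eta> s by simp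
    then have "norm (\<eta> t - \<eta> s - of_real (t - s) * llim G t) \<le> e / 2 * (t - s)"
    proof (rule has_integral_AE_bound)
      show "AE r in lebesgue. s < r \<and> r < t \<longrightarrow> norm (G r - llim G t) \<le> e / 2"
        using d(2) by eventually_elim (use s in \<open>auto simp: dist_norm\<close>)
    qed (use s e in auto)
    moreover have "(\<eta> s - \<eta> t) / complex_of_real (s - t) = (\<eta> t - \<eta> s) / complex_of_real (t - s)"
      unfolding of_real_diff by (metis minus_diff_eq minus_divide_divide)
    moreover have "(\<eta> t - \<eta> s) / complex_of_real (t - s) - llim G t
        = (\<eta> t - \<eta> s - of_real (t - s) * llim G t) / complex_of_real (t - s)"
      using s by (simp add: diff_divide_distrib del: of_real_diff)
    ultimately have "norm ((\<eta> s - \<eta> t) / complex_of_real (s - t) - llim G t) \<le> e / 2"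
      using s by (simp add: norm_divide divide_le_eq del: of_real_diff)
    then show ?thesis using e by (simp add: dist_norm)
  qed
  then show "\<forall>\<^sub>F s in at_left t. dist ((\<eta> s - \<eta> t) / complex_of_real (s - t)) (llim G t) < e"
    unfolding eventually_at_left_field using d r by (intro exI[of _ "t - min d r"]) auto
qed

lemma is_gderiv_primitive:
  assumes "\<And>t. t \<in> I \<Longrightarrow> rlim \<eta> t = \<eta> t" "\<And>t. t \<in> I \<Longrightarrow> llim \<eta> t = \<eta> t"
  shows "is_gderiv I \<eta> G"
  unfolding is_gderiv_def
  using G assms primitive_quotient_left primitive_quotient_right
  by (auto intro!: tendsto_ess_at_left tendsto_ess_at_right)

text \<open>At almost every t both one-sided limits of G equal G t, so the two one-sided quotients
  have a common limit.\<close>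

lemma primitive_AE_derivative: "AE t\<in>I in lebesgue. (\<eta> has_vector_derivative G t) (at t)"
  using AE_eq_rlim[OF G] AE_eq_llim[OF G]
proof eventually_elim
  case (elim t)
  show ?case
  proof
    assume t: "t \<in> I"
    have "(\<lambda>s. (\<eta> s - \<eta> t) / complex_of_real (s - t)) \<midarrow>t\<rightarrow> G t"
      using primitive_quotient_left[OF t] primitive_quotient_right[OF t] elim t
      by (simp add: filterlim_split_at)
    then show "(\<eta> has_vector_derivative G t) (at t)"
      by (simp only: has_vector_derivative_iff_quotient)
  qed
qed

end

end

subsection \<open>Test functions solving the adjoint system\<close>

context open_interval
begin

text \<open>The adjoint equation is demanded only to the right of e; between c and e lies the
  transition to 0. Linking G and \<eta> by integrals serves two purposes: it gives the derivative of
  \<eta> as a test function, and it gives the Lipschitz bound and the pointwise derivative for the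
  comparison with absolutely continuous functions.\<close>

definition adjoint_test ::
    "(real \<Rightarrow> complex ^ 'n ^ 'n) \<Rightarrow> cfun \<Rightarrow> 'n::finite \<Rightarrow> real \<Rightarrow> real \<Rightarrow> real \<Rightarrow> ('n \<Rightarrow> cfun) \<Rightarrow> ('n \<Rightarrow> cfun) \<Rightarrow> bool" where
  "adjoint_test A \<phi> k c e d \<eta> G \<longleftrightarrow> c < e \<and> {c..d} \<subseteq> I \<and> (AE t\<in>I in lebesgue. t \<notin> {c<..<d} \<longrightarrow> \<phi> t = 0) \<and>
    (\<forall>j. \<eta> j \<in> RR I \<and> continuous_on UNIV (\<eta> j) \<and> (\<forall>t. t \<le> c \<or> d \<le> t \<longrightarrow> \<eta> j t = 0) \<and> G j \<in> GG I \<and>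
      (\<forall>x y. x \<le> y \<longrightarrow> {x..y} \<subseteq> I \<longrightarrow> (G j has_integral (\<eta> j y - \<eta> j x)) {x..y}) \<and>
      (AE t\<in>I in lebesgue. e < t \<longrightarrow>
        G j t = - (\<Sum>i\<in>UNIV. A t $ i $ j * \<eta> i t) - (if j = k then \<phi> t else 0)))"

lemma adjoint_testD:
  assumes "adjoint_test A \<phi> k c e d \<eta> G"
  shows "c < e" "{c..d} \<subseteq> I" "AE t\<in>I in lebesgue. t \<notin> {c<..<d} \<longrightarrow> \<phi> t = 0"
    "\<eta> j \<in> RR I" "continuous_on UNIV (\<eta> j)" "t \<le> c \<or> d \<le> t \<Longrightarrow> \<eta> j t = 0" "G j \<in> GG I"
    "x \<le> y \<Longrightarrow> {x..y} \<subseteq> I \<Longrightarrow> (G j has_integral (\<eta> j y - \<eta> j x)) {x..y}"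
    "AE t\<in>I in lebesgue. e < t \<longrightarrow>
      G j t = - (\<Sum>i\<in>UNIV. A t $ i $ j * \<eta> i t) - (if j = k then \<phi> t else 0)"
  using assms unfolding adjoint_test_def by blast+

text \<open>A Volterra system with bounded representatives of the coefficients yields \<eta>. Its
  smoothness is not obtained from the integral equation step by step: G j is composed of
  coefficients, \<phi>, step functions and the \<eta> i, so the algebra generated by
  \<open>Ginf I\<close> and all \<eta> i contains a derivative of each generator.\<close>

lemma adjoint_test_exists:
  assumes A: "\<And>i j. (\<lambda>t. A t $ i $ j) \<in> Ginf I" and \<phi>: "\<phi> \<in> RR I" and "t0 \<in> I"
  obtains c e d \<eta> G where "e < t0" "t0 < d" "adjoint_test A \<phi> k c e d \<eta> G"
proof -
  obtain K where K: "compact K" "K \<subseteq> I" "AE t\<in>I in lebesgue. t \<notin> K \<longrightarrow> \<phi> t = 0"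
    by (rule RR_E[OF \<phi>])
  obtain c d where cd: "c < t0" "t0 < d" "{c..d} \<subseteq> I" "K \<subseteq> {c<..<d}"
    by (rule compact_subset_Icc[OF K(1,2) \<open>t0 \<in> I\<close>])
  \<comment> \<open>Any point strictly between c and t0 would do: it leaves room for the ramp and a
    gap before t0.\<close>
  define e where "e = (c + t0) / 2"
  have e: "c < e" "e < t0" "e < d" using cd by (auto simp: e_def)
  have ed: "{e..d} \<subseteq> I" using cd(3) e by auto
  have supp: "AE t\<in>I in lebesgue. t \<notin> {c<..<d} \<longrightarrow> \<phi> t = 0"
    using K(3) by eventually_elim (use cd(4) in blast)
  define rep where "rep i j gC \<longleftrightarrow> fst gC \<in> borel_measurable (lebesgue_on I) \<and>
      (\<forall>t. norm (fst gC t) \<le> snd gC) \<and> (AE t\<in>I in lebesgue. A t $ i $ j = fst gC t)"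
    for i j and gC :: "cfun \<times> real"
  have "\<exists>gC. rep i j gC" for i j
  proof -
    obtain g C where "g \<in> borel_measurable (lebesgue_on I)" "\<And>t. norm (g t) \<le> C"
      "AE t\<in>I in lebesgue. A t $ i $ j = g t"
      using GG_bounded_representative[OF Ginf_GG[OF A[of i j]]] by blast
    then have "rep i j (g, C)" by (simp add: rep_def)
    then show ?thesis ..
  qed
  then have rep: "rep i j (SOME gC. rep i j gC)" for i j by (rule someI_ex)
  define B where "B i j = fst (SOME gC. rep i j gC)" for i j
  define C where "C i j = snd (SOME gC. rep i j gC)" for i j
  have B: "B i j \<in> borel_measurable (lebesgue_on I)" "norm (B i j t) \<le> C i j"
    "AE t\<in>I in lebesgue. A t $ i $ j = B i j t" for i j t
    using rep[of i j] unfolding rep_def B_def C_def by blast+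
  obtain p C' where p: "p \<in> borel_measurable (lebesgue_on I)" "\<And>t. norm (p t) \<le> C'"
    "AE t\<in>I in lebesgue. \<phi> t = p t"
    using GG_bounded_representative[OF Ginf_GG[OF RR_Ginf[OF \<phi>]]] by blast
  define b where "b j = (if j = k then p else (\<lambda>_. 0))" for j
  have mono: "f \<in> borel_measurable (lebesgue_on {e..d})" if "f \<in> borel_measurable (lebesgue_on I)" for f :: cfun
    using measurable_restrict_mono[OF that ed] .
  have Bb: "norm (B i j t) \<le> (\<Sum>i\<in>UNIV. \<Sum>j\<in>UNIV. \<bar>C i j\<bar>)" for i j t
  proof -
    have "norm (B i j t) \<le> \<bar>C i j\<bar>" using B(2)[of i j t] by linarith
    also have "\<dots> \<le> (\<Sum>j\<in>UNIV. \<bar>C i j\<bar>)" by (rule member_le_sum) auto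
    also have "\<dots> \<le> (\<Sum>i\<in>UNIV. \<Sum>j\<in>UNIV. \<bar>C i j\<bar>)"
      by (rule member_le_sum[of i UNIV "\<lambda>i. \<Sum>j\<in>UNIV. \<bar>C i j\<bar>"]) (auto intro: sum_nonneg)
    finally show ?thesis .
  qed
  have bm: "b j \<in> borel_measurable (lebesgue_on {e..d})" "norm (b j t) \<le> \<bar>C'\<bar>" for j t
    using mono[OF p(1)] p(2)[of t] by (auto simp: b_def)
  obtain u where u: "\<And>j. continuous_on {e..d} (u j)"
    "\<And>j. (\<lambda>s. (\<Sum>i\<in>UNIV. B i j s * u i s) + b j s) absolutely_integrable_on {e..d}"
    "\<And>j t. t \<in> {e..d} \<Longrightarrow> u j t = integral {t..d} (\<lambda>s. (\<Sum>i\<in>UNIV. B i j s * u i s) + b j s)"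
    by (rule volterra_system[of e d "\<lambda>j i. B i j" _ b, OF less_imp_le[OF e(3)] mono[OF B(1)] Bb bm(1) bm(2)]) blast
  define h where "h j s = (\<Sum>i\<in>UNIV. B i j s * u i s) + b j s" for j s
  have h: "h j integrable_on {e..d}" "t \<in> {e..d} \<Longrightarrow> u j t = integral {t..d} (h j)" for j t
    using set_lebesgue_integral_eq_integral(1)[OF u(2)[of j]] u(3)[of t j] by (simp_all add: h_def[abs_def])
  have ud: "u j d = 0" for j using h(2)[of d j] e(3) by simp
  define proj where "proj t = max e (min d t)" for t :: real
  define ramp where "ramp t = min 1 (max 0 ((t - c) / (e - c)))" for t :: real
  \<comment> \<open>Left of e, \<open>proj\<close> freezes u at its value in e while the ramp falls
    to 0 at c; right of d, \<open>proj\<close> freezes u at u j d = 0.\<close>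
  define \<eta> where "\<eta> j t = u j (proj t) * of_real (ramp t)" for j t
  have proj: "proj t \<in> {e..d}" for t using e by (auto simp: proj_def)
  have ramp: "0 \<le> ramp t" "ramp t \<le> 1" for t by (auto simp: ramp_def)
  have \<eta>_left: "\<eta> j t = 0" if "t \<le> c" for j t
    using that e by (simp add: \<eta>_def ramp_def divide_nonpos_pos)
  have \<eta>_ramp: "\<eta> j t = u j e * of_real ((t - c) / (e - c))" if "c \<le> t" "t \<le> e" for j t
  proof -
    have "ramp t = (t - c) / (e - c)" using that e by (simp add: ramp_def)
    moreover have "proj t = e" using that e by (simp add: proj_def)
    ultimately show ?thesis by (simp add: \<eta>_def)
  qed
  have \<eta>_u: "\<eta> j t = u j t" if "t \<in> {e..d}" for j t
  proof -
    have "ramp t = 1" using that e by (simp add: ramp_def)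
    moreover have "proj t = t" using that by (simp add: proj_def)
    ultimately show ?thesis by (simp add: \<eta>_def)
  qed
  have \<eta>_right: "\<eta> j t = 0" if "d \<le> t" for j t
    using that e ud by (simp add: \<eta>_def proj_def)
  have \<eta>_cont: "continuous_on UNIV (\<eta> j)" for j
  proof -
    have "continuous_on UNIV proj" unfolding proj_def by (intro continuous_intros)
    then have "continuous_on UNIV (\<lambda>t. u j (proj t))"
      by (rule continuous_on_compose2[OF u(1)]) (use proj in blast)
    moreover have "continuous_on UNIV ramp"
      unfolding ramp_def using e by (intro continuous_intros) auto
    ultimately show ?thesis unfolding \<eta>_def by (intro continuous_intros)
  qed
  obtain D where D: "\<And>j t. norm (\<eta> j t) \<le> D j"
  proof -
    have "\<exists>D. \<forall>t. norm (\<eta> j t) \<le> D" for j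
    proof -
      have "bounded (u j ` {e..d})" by (intro compact_imp_bounded compact_continuous_image u) simp
      then obtain D where D: "\<And>t. t \<in> {e..d} \<Longrightarrow> norm (u j t) \<le> D" unfolding bounded_iff by blast
      have "norm (\<eta> j t) \<le> D * 1" for t
        unfolding \<eta>_def norm_mult using D[OF proj[of t]] ramp[of t]
        by (intro mult_mono) (auto intro: order_trans[OF norm_ge_zero])
      then show ?thesis by blast
    qed
    then show ?thesis using that by metis
  qed
  note \<eta>_GG = continuous_GG[OF \<eta>_cont D]
  \<comment> \<open>Step functions enter as factors, so that membership in the generated algebra
    follows from the shape of the term.\<close>
  define G where "G j t = (if t < e then 0 else 1) * ((if t < d then 1 else 0) *
      (- 1 * ((\<Sum>i\<in>UNIV. A t $ i $ j * \<eta> i t) + (if j = k then 1 else 0) * \<phi> t)))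
    + u j e / of_real (e - c) * ((if t < c then 0 else 1) * (if t < e then 1 else 0))" for j t
  define X where "X = Ginf I \<union> range \<eta>"
  have G_X: "G j \<in> algebra_gen X" for j
  proof -
    have base: "g \<in> algebra_gen X" if "g \<in> Ginf I" for g
      using that by (auto simp: X_def intro: algebra_gen.base)
    have \<eta>X: "\<eta> i \<in> algebra_gen X" for i by (auto simp: X_def intro: algebra_gen.base)
    have sum: "(\<lambda>t. \<Sum>i\<in>S. A t $ i $ j * \<eta> i t) \<in> algebra_gen X" if "finite S" for S
      using that
    proof induction
      case empty
      show ?case using base[OF Ginf_const[of 0]] by simp
    next
      case (insert i S)
      then show ?case using algebra_gen.add[OF algebra_gen.mult[OF base[OF A] \<eta>X]] by simp
    qed
    show ?thesis unfolding G_def[abs_def]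
      by (intro algebra_gen.add algebra_gen.mult sum base Ginf_cut Ginf_const RR_Ginf \<phi>) simp
  qed
  have X_GG: "X \<subseteq> GG I" using Ginf_GG \<eta>_GG by (auto simp: X_def)
  have G_GG: "G j \<in> GG I" for j using G_X algebra_gen_subset_GG[OF X_GG] by blast
  have G_int: "(G j has_integral (\<eta> j y - \<eta> j x)) {x..y}" if "x \<le> y" for x y j
  proof -
    \<comment> \<open>Extends the integral relation across a breakpoint p; it is applied at c, e and
      d in turn.\<close>
    have comb: "(G j has_integral (\<eta> j y - \<eta> j x)) {x..y}"
      if 1: "\<And>x y. x \<le> y \<Longrightarrow> y \<le> p \<Longrightarrow> (G j has_integral (\<eta> j y - \<eta> j x)) {x..y}"
        and 2: "\<And>x y. p \<le> x \<Longrightarrow> x \<le> y \<Longrightarrow> y \<le> q \<Longrightarrow> (G j has_integral (\<eta> j y - \<eta> j x)) {x..y}"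
        and xy: "x \<le> y" "y \<le> q" for p q x y
    proof -
      consider "y \<le> p" | "p \<le> x" | "x \<le> p" "p \<le> y" by linarith
      then show ?thesis
      proof cases
        case 3
        have "(G j has_integral ((\<eta> j p - \<eta> j x) + (\<eta> j y - \<eta> j p))) {x..y}"
          by (rule has_integral_combine[OF 3 1[OF 3(1)] 2[OF _ 3(2)]]) (use xy in auto)
        then show ?thesis by simp
      qed (use 1 2 xy in auto)
    qed
    have r1: "(G j has_integral (\<eta> j y - \<eta> j x)) {x..y}" if "x \<le> y" "y \<le> c" for x y
      by (rule has_integral_spike_finite[of "{c}" _ "G j" "\<lambda>_. 0"]) (use that e \<eta>_left in \<open>auto simp: G_def\<close>)
    have r2: "(G j has_integral (\<eta> j y - \<eta> j x)) {x..y}" if xy: "c \<le> x" "x \<le> y" "y \<le> e" for x y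
    proof (rule has_integral_spike_finite[of "{e}" _ "G j" "\<lambda>_. u j e / of_real (e - c)"])
      have "\<eta> j y = u j e * of_real ((y - c) / (e - c))" "\<eta> j x = u j e * of_real ((x - c) / (e - c))"
        by (rule \<eta>_ramp; use xy in linarith)+
      then have "\<eta> j y - \<eta> j x = u j e * of_real ((y - c) / (e - c) - (x - c) / (e - c))"
        by (simp only: of_real_diff right_diff_distrib)
      also have "(y - c) / (e - c) - (x - c) / (e - c) = (y - x) * (1 / (e - c))"
        by (simp add: diff_divide_distrib)
      finally have "\<eta> j y - \<eta> j x = (y - x) *\<^sub>R (u j e / of_real (e - c))"
        by (simp add: scaleR_conv_of_real)
      then show "((\<lambda>_. u j e / of_real (e - c)) has_integral \<eta> j y - \<eta> j x) {x..y}"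
        using has_integral_const_real[of "u j e / of_real (e - c)" x y] xy by simp
    qed (use xy in \<open>auto simp: G_def\<close>)
    have r3: "(G j has_integral (\<eta> j y - \<eta> j x)) {x..y}" if xy: "e \<le> x" "x \<le> y" "y \<le> d" for x y
    proof -
      have ae: "AE t in lebesgue. e \<le> t \<and> t < d \<longrightarrow> G j t = - h j t"
      proof -
        have "AE t in lebesgue. \<forall>i\<in>UNIV. t \<in> I \<longrightarrow> A t $ i $ j = B i j t"
          by (rule AE_finite_allI) (use B(3) in auto)
        with p(3) show ?thesis
        proof eventually_elim
          case (elim t)
          show ?case
          proof
            assume t: "e \<le> t \<and> t < d"
            then have "t \<in> I" using ed by auto
            then have "(\<Sum>i\<in>UNIV. A t $ i $ j * \<eta> i t) = (\<Sum>i\<in>UNIV. B i j t * u i t)"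
              using elim t by (intro sum.cong) (auto simp: \<eta>_u)
            then show "G j t = - h j t"
              using t e elim \<open>t \<in> I\<close> by (auto simp: G_def h_def b_def)
          qed
        qed
      qed
      have hi: "h j integrable_on {x..d}" "h j integrable_on {x..y}"
        using integrable_on_subinterval[OF h(1)[of j]] xy by auto
      have "integral {x..y} (h j) + integral {y..d} (h j) = integral {x..d} (h j)"
        by (rule Henstock_Kurzweil_Integration.integral_combine) (use xy hi in auto)
      then have "integral {x..y} (h j) = \<eta> j x - \<eta> j y"
        using xy h(2)[of x j] h(2)[of y j] by (simp add: \<eta>_u algebra_simps)
      then have "(h j has_integral (\<eta> j x - \<eta> j y)) {x..y}"
        using hi(2) by (metis integrable_integral)
      then have "((\<lambda>t. - h j t) has_integral - (\<eta> j x - \<eta> j y)) {x..y}"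
        by (rule has_integral_neg)
      then have *: "((\<lambda>t. - h j t) has_integral (\<eta> j y - \<eta> j x)) {x..y}" by simp
      define N where "N = insert d {t. \<not> (e \<le> t \<and> t < d \<longrightarrow> G j t = - h j t)}"
      have "negligible N" unfolding N_def negligible_insert by (rule negligible_if_AE[OF ae])
      moreover have "G j t = - h j t" if "t \<in> {x..y} - N" for t
        using that xy by (auto simp: N_def)
      ultimately show ?thesis using * by (rule has_integral_spike)
    qed
    have r4: "(G j has_integral (\<eta> j y - \<eta> j x)) {x..y}" if "d \<le> x" "x \<le> y" for x y
      by (rule has_integral_spike_finite[of "{}" _ "G j" "\<lambda>_. 0"]) (use that e \<eta>_right in \<open>auto simp: G_def\<close>)
    have le_e: "(G j has_integral (\<eta> j y - \<eta> j x)) {x..y}" if "x \<le> y" "y \<le> e" for x y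
      by (rule comb[OF r1 r2 that])
    have le_d: "(G j has_integral (\<eta> j y - \<eta> j x)) {x..y}" if "x \<le> y" "y \<le> d" for x y
      by (rule comb[OF le_e r3 that])
    show ?thesis by (rule comb[OF le_d r4 that order_refl])
  qed
  have \<eta>_deriv: "is_gderiv I (\<eta> j) (G j)" for j
    by (rule is_gderiv_primitive[OF G_GG G_int]) (auto simp: \<eta>_GG)
  have "algebra_gen X \<subseteq> Ginf I"
  proof (rule algebra_gen_subset_Ginf[OF X_GG])
    fix g assume "g \<in> X"
    then show "\<exists>h\<in>algebra_gen X. is_gderiv I g h"
      using \<eta>_deriv G_X Ginf_gderiv algebra_gen.base[of _ X] unfolding X_def by blast
  qed
  then have \<eta>_Ginf: "\<eta> j \<in> Ginf I" for j using algebra_gen.base[of "\<eta> j" X] by (auto simp: X_def)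
  show ?thesis
  proof (rule that[OF e(2) cd(2)], unfold adjoint_test_def,
      intro conjI allI impI e(1) cd(3) supp \<eta>_cont G_GG G_int)
    show "\<eta> j \<in> RR I" for j
      by (rule RR_I[of _ "{c..d}"]) (use \<eta>_Ginf cd(3) \<eta>_left \<eta>_right in auto)
    show "\<eta> j t = 0" if "t \<le> c \<or> d \<le> t" for j t using that \<eta>_left \<eta>_right by blast
    show "AE t\<in>I in lebesgue. e < t \<longrightarrow>
        G j t = - (\<Sum>i\<in>UNIV. A t $ i $ j * \<eta> i t) - (if j = k then \<phi> t else 0)" for j
      using supp AE_lebesgue_neq[of d]
    proof eventually_elim
      case (elim t)
      then show ?case using \<eta>_right[of t] e by (cases "t < d") (auto simp: G_def)
    qed
  qed (rule e(1) cd(3) supp \<eta>_cont G_GG G_int)+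
qed

end

subsection \<open>The fundamental theorem of calculus for absolutely continuous functions\<close>

definition interval_family :: "real \<Rightarrow> real \<Rightarrow> (real \<times> real) set \<Rightarrow> bool" where
  "interval_family c d P \<longleftrightarrow> finite P \<and> (\<forall>p\<in>P. c \<le> fst p \<and> fst p \<le> snd p \<and> snd p \<le> d) \<and>
    pairwise (\<lambda>p q. {fst p<..<snd p} \<inter> {fst q<..<snd q} = {}) P"

lemma abs_cont_on_iff:
  "abs_cont_on c d x \<longleftrightarrow> (\<forall>e>0. \<exists>r>0. \<forall>P. interval_family c d P \<longrightarrow> (\<Sum>p\<in>P. snd p - fst p) < r
    \<longrightarrow> (\<Sum>p\<in>P. dist (x (fst p)) (x (snd p))) < e)"
  unfolding abs_cont_on_def interval_family_def case_prod_beta' by (simp only: conj_assoc imp_conjL)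

lemma abs_cont_onD:
  assumes "abs_cont_on c d x" "e > 0"
  obtains r where "r > 0" "\<And>P. interval_family c d P \<Longrightarrow>
    (\<Sum>p\<in>P. snd p - fst p) < r \<Longrightarrow> (\<Sum>p\<in>P. dist (x (fst p)) (x (snd p))) < e"
  using assms unfolding abs_cont_on_iff by blast

text \<open>Disjointness turns the sum of the lengths into the measure of the union, which lies in
  U.\<close>

lemma sum_lengths_le_measure:
  assumes P: "interval_family c d P" and U: "\<And>p. p \<in> P \<Longrightarrow> {fst p<..<snd p} \<subseteq> U" "U \<in> lmeasurable"
  shows "(\<Sum>p\<in>P. snd p - fst p) \<le> measure lebesgue (U :: real set)"
proof -
  have le: "fst p \<le> snd p" if "p \<in> P" for p using P that by (auto simp: interval_family_def)
  have "measure lebesgue (\<Union>p\<in>P. {fst p<..<snd p}) = (\<Sum>p\<in>P. measure lebesgue {fst p<..<snd p})"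
  proof (rule measure_finite_Union)
    show "disjoint_family_on (\<lambda>p. {fst p<..<snd p}) P"
      using P unfolding interval_family_def disjoint_family_on_def pairwise_def by blast
    show "emeasure lebesgue {fst p<..<snd p} \<noteq> \<infinity>" if "p \<in> P" for p
      using le[OF that] by simp
  qed (use P in \<open>auto simp: interval_family_def\<close>)
  also have "\<dots> = (\<Sum>p\<in>P. snd p - fst p)"
    by (rule sum.cong) (use le in auto)
  finally show ?thesis
    using measure_mono_fmeasurable[of "\<Union>p\<in>P. {fst p<..<snd p}" U lebesgue] P U
    by (force simp: interval_family_def)
qed

text \<open>A gauge argument. Intervals tagged in the exceptional null set lie in an open set of
  small measure, where absolute continuity bounds the increments of X. For all other tags
  differentiability compares the increment with the length times X' t, as in the straddle
  lemma.\<close>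

lemma abs_cont_has_integral:
  fixes X X' :: cfun
  assumes ab: "a \<le> b" and ac: "abs_cont_on a b X"
    and deriv: "AE t in lebesgue. a < t \<and> t < b \<longrightarrow> (X has_vector_derivative X' t) (at t)"
  shows "(X' has_integral (X b - X a)) {a..b}"
proof -
  define N where "N = insert a (insert b {t. \<not> (a < t \<and> t < b \<longrightarrow> (X has_vector_derivative X' t) (at t))})"
  have N: "negligible N" unfolding N_def negligible_insert by (rule negligible_if_AE[OF deriv])
  define f where "f t = (if t \<in> N then 0 else X' t)" for t
  have dX: "(X has_vector_derivative X' t) (at t)" if "t \<in> {a..b}" "t \<notin> N" for t
    using that by (auto simp: N_def)
  have "(f has_integral (X b - X a)) {a..b}"
    unfolding has_integral_real
  proof (intro allI impI)
    fix \<epsilon> :: real assume \<epsilon>: "\<epsilon> > 0"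
    \<comment> \<open>The summand 1 keeps the denominator positive when a = b.\<close>
    define \<kappa> where "\<kappa> = \<epsilon> / (2 * (b - a + 1))"
    have \<kappa>: "\<kappa> > 0" "\<kappa> * (b - a) < \<epsilon> / 2" using ab \<epsilon> by (auto simp: \<kappa>_def field_simps)
    obtain r where r: "r > 0" "\<And>P. interval_family a b P \<Longrightarrow>
      (\<Sum>p\<in>P. snd p - fst p) < r \<Longrightarrow> (\<Sum>p\<in>P. dist (X (fst p)) (X (snd p))) < \<epsilon> / 2"
      by (rule abs_cont_onD[OF ac, of "\<epsilon> / 2"]) (use \<epsilon> in auto)
    obtain U where U: "open U" "N \<subseteq> U" "U \<in> lmeasurable" "measure lebesgue U < r"
    proof -
      have Nn: "N \<in> null_sets lebesgue" using N by (simp add: negligible_iff_null_sets)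
      then obtain T where T: "open T" "N \<subseteq> T" "T - N \<in> lmeasurable" "emeasure lebesgue (T - N) < ennreal r"
        using sets_lebesgue_outer_open[of N r] r(1) by blast
      have Ts: "T \<in> sets lebesgue" using T(1) by (simp add: lborelD)
      have "emeasure lebesgue T = emeasure lebesgue (T - N)"
        using emeasure_Diff_null_set[OF Nn Ts] by simp
      then have em: "emeasure lebesgue T < ennreal r" using T(4) by simp
      then have "T \<in> lmeasurable"
        using Ts by (intro fmeasurableI) (auto intro: less_trans[OF _ ennreal_less_top])
      moreover have "measure lebesgue T < r"
        using em r(1) \<open>T \<in> lmeasurable\<close> by (simp add: emeasure_eq_measure2 ennreal_less_iff)
      ultimately show ?thesis using that T by blast
    qed
    have "\<exists>\<rho>>0. \<forall>y. \<bar>y - t\<bar> < \<rho> \<longrightarrow> norm (X y - X t - (y - t) *\<^sub>R X' t) \<le> \<kappa> * \<bar>y - t\<bar>"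
      if "t \<in> {a..b}" "t \<notin> N" for t
      using dX[OF that] \<kappa>(1) unfolding has_vector_derivative_def has_derivative_at_alt
      by (simp add: scaleR_diff_left)
    then obtain \<rho> where \<rho>: "\<And>t. t \<in> {a..b} \<Longrightarrow> t \<notin> N \<Longrightarrow> \<rho> t > 0"
      "\<And>t y. t \<in> {a..b} \<Longrightarrow> t \<notin> N \<Longrightarrow> \<bar>y - t\<bar> < \<rho> t \<Longrightarrow> norm (X y - X t - (y - t) *\<^sub>R X' t) \<le> \<kappa> * \<bar>y - t\<bar>"
      by metis
    define \<gamma> where "\<gamma> t = (if t \<in> N then U else if t \<in> {a..b} then ball t (\<rho> t) else UNIV)" for t
    have gauge: "gauge \<gamma>"
      by (rule gaugeI) (use U \<rho>(1) in \<open>auto simp: \<gamma>_def\<close>)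
    have est: "norm ((\<Sum>(t, K)\<in>D. measure lborel K *\<^sub>R f t) - (X b - X a)) < \<epsilon>"
      if D: "D tagged_division_of {a..b}" and fine: "\<gamma> fine D" for D
    proof -
      note Dd = tagged_division_ofD[OF D]
      have K: "K = {Inf K..Sup K}" "Inf K \<le> t" "t \<le> Sup K" "a \<le> Inf K" "Sup K \<le> b" "t \<in> {a..b}"
        "measure lborel K = Sup K - Inf K" "K \<subseteq> \<gamma> t" if tK: "(t, K) \<in> D" for t K
      proof -
        obtain u v where uv: "K = {u..v}" using Dd(4)[OF tK] by auto
        have "t \<in> K" "K \<subseteq> {a..b}" using Dd(2,3)[OF tK] by auto
        then show "K = {Inf K..Sup K}" "Inf K \<le> t" "t \<le> Sup K" "a \<le> Inf K" "Sup K \<le> b" "t \<in> {a..b}"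
          "measure lborel K = Sup K - Inf K"
          using uv by auto
        show "K \<subseteq> \<gamma> t" using fine tK by (auto simp: fine_def)
      qed
      define g where "g = (\<lambda>(t, K). measure lborel K *\<^sub>R f t - (X (Sup K) - X (Inf K)))"
      \<comment> \<open>Degenerate intervals contribute 0 and are discarded. The others have
        nonempty interiors, so disjointness makes the map to endpoint pairs injective, as needed to
        pass to a set of pairs.\<close>
      define D1 where "D1 = {p \<in> D. fst p \<in> N \<and> Inf (snd p) < Sup (snd p)}"
      define D2 where "D2 = {p \<in> D. fst p \<notin> N \<and> Inf (snd p) < Sup (snd p)}"
      have fin: "finite D" "finite D1" "finite D2" using Dd(1) by (auto simp: D1_def D2_def)
      have "(\<Sum>(t, K)\<in>D. measure lborel K *\<^sub>R f t) - (X b - X a) = sum g D"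
        unfolding additive_tagged_division_1[OF ab D, of X, symmetric] g_def
        by (simp add: case_prod_beta' sum_subtractf)
      also have "sum g D = sum g (D1 \<union> D2)"
      proof (rule sum.mono_neutral_right[OF fin(1)])
        show "\<forall>p\<in>D - (D1 \<union> D2). g p = 0"
        proof
          fix p assume p: "p \<in> D - (D1 \<union> D2)"
          obtain t K where tK: "p = (t, K)" by (cases p)
          then have "Sup K = Inf K" using p K[of t K] by (auto simp: D1_def D2_def)
          then show "g p = 0" using p tK K(7)[of t K] by (simp add: g_def)
        qed
      qed (auto simp: D1_def D2_def)
      also have "\<dots> = sum g D1 + sum g D2"
        by (rule sum.union_disjoint) (use fin in \<open>auto simp: D1_def D2_def\<close>)
      finally have split: "(\<Sum>(t, K)\<in>D. measure lborel K *\<^sub>R f t) - (X b - X a) = sum g D1 + sum g D2" .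
      have "norm (sum g D1) < \<epsilon> / 2"
      proof -
        define e where "e p = (Inf (snd p), Sup (snd p))" for p :: "real \<times> real set"
        have disj: "{fst (e p)<..<snd (e p)} \<inter> {fst (e q)<..<snd (e q)} = {}" if "p \<in> D1" "q \<in> D1" "p \<noteq> q" for p q
        proof -
          obtain t K s L where pq: "p = (t, K)" "q = (s, L)" by (cases p, cases q)
          then have D: "(t, K) \<in> D" "(s, L) \<in> D" using that by (auto simp: D1_def)
          have "interior K \<inter> interior L = {}" using Dd(5)[OF D] that pq by auto
          moreover have "interior K = {Inf K<..<Sup K}" "interior L = {Inf L<..<Sup L}"
            using K(1)[OF D(1)] K(1)[OF D(2)] by (metis interior_atLeastAtMost_real)+
          ultimately show ?thesis by (simp add: e_def pq)
        qed
        have inj: "inj_on e D1"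
        proof (rule inj_onI, rule ccontr)
          fix p q assume pq: "p \<in> D1" "q \<in> D1" "e p = e q" "p \<noteq> q"
          then have "{fst (e p)<..<snd (e p)} = {}" using disj[OF pq(1,2,4)] by simp
          moreover have "fst (e p) < snd (e p)" using pq(1) by (simp add: D1_def e_def)
          ultimately show False by simp
        qed
        have "norm (sum g D1) \<le> (\<Sum>p\<in>D1. dist (X (fst (e p))) (X (snd (e p))))"
        proof (rule sum_norm_le)
          fix p assume "p \<in> D1"
          then show "norm (g p) \<le> dist (X (fst (e p))) (X (snd (e p)))"
            by (cases p) (auto simp: D1_def g_def e_def f_def dist_norm norm_minus_commute)
        qed
        also have "\<dots> = (\<Sum>p\<in>e ` D1. dist (X (fst p)) (X (snd p)))"
          by (simp add: sum.reindex[OF inj])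
        also have "\<dots> < \<epsilon> / 2"
        proof (rule r(2))
          show fam: "interval_family a b (e ` D1)"
            unfolding interval_family_def
          proof (intro conjI ballI)
            show "pairwise (\<lambda>p q. {fst p<..<snd p} \<inter> {fst q<..<snd q} = {}) (e ` D1)"
              unfolding pairwise_def using disj by auto
          qed (use fin K in \<open>auto simp: D1_def e_def\<close>)
          have "(\<Sum>p\<in>e ` D1. snd p - fst p) \<le> measure lebesgue U"
          proof (rule sum_lengths_le_measure[OF fam _ U(3)])
            fix p assume "p \<in> e ` D1"
            then obtain t K where tK: "(t, K) \<in> D" "t \<in> N" "p = (Inf K, Sup K)" by (auto simp: D1_def e_def)
            have "{Inf K<..<Sup K} \<subseteq> K" using K(1)[OF tK(1)] by (metis greaterThanLessThan_subseteq_atLeastAtMost_iff order_refl)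
            also have "K \<subseteq> U" using K(8)[OF tK(1)] tK(2) by (simp add: \<gamma>_def)
            finally show "{fst p<..<snd p} \<subseteq> U" using tK by simp
          qed
          then show "(\<Sum>p\<in>e ` D1. snd p - fst p) < r" using U(4) by simp
        qed
        finally show ?thesis .
      qed
      moreover have "norm (sum g D2) \<le> \<epsilon> / 2"
      proof -
        have "norm (sum g D2) \<le> (\<Sum>p\<in>D2. \<kappa> * (Sup (snd p) - Inf (snd p)))"
        proof (rule sum_norm_le)
          fix p assume "p \<in> D2"
          then obtain t K where tK: "p = (t, K)" "(t, K) \<in> D" "t \<notin> N" by (cases p) (auto simp: D2_def)
          note k = K[OF tK(2)]
          have sub: "K \<subseteq> ball t (\<rho> t)" using k(6,8) tK(3) by (simp add: \<gamma>_def)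
          have "Inf K \<in> K" "Sup K \<in> K" using k(1,2,3) by (metis atLeastAtMost_iff order_refl order_trans)+
          then have "\<bar>Inf K - t\<bar> < \<rho> t" "\<bar>Sup K - t\<bar> < \<rho> t" using sub by (auto simp: dist_real_def subset_eq)
          then have "norm (X (Inf K) - X t - (Inf K - t) *\<^sub>R X' t) \<le> \<kappa> * \<bar>Inf K - t\<bar>"
            "norm (X (Sup K) - X t - (Sup K - t) *\<^sub>R X' t) \<le> \<kappa> * \<bar>Sup K - t\<bar>"
            using \<rho>(2)[OF k(6) tK(3)] by auto
          then have "norm ((X (Inf K) - X t - (Inf K - t) *\<^sub>R X' t) - (X (Sup K) - X t - (Sup K - t) *\<^sub>R X' t))
              \<le> \<kappa> * \<bar>Inf K - t\<bar> + \<kappa> * \<bar>Sup K - t\<bar>"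
            using norm_triangle_ineq4 order_trans add_mono by meson
          \<comment> \<open>The tag lies between the endpoints, so its distances to them add up to
            the length.\<close>
          also have "\<kappa> * \<bar>Inf K - t\<bar> + \<kappa> * \<bar>Sup K - t\<bar> = \<kappa> * (Sup K - Inf K)"
            using k(2,3) by (simp add: algebra_simps)
          also have "(X (Inf K) - X t - (Inf K - t) *\<^sub>R X' t) - (X (Sup K) - X t - (Sup K - t) *\<^sub>R X' t) = g p"
            unfolding g_def f_def tK(1) prod.case k(7) using tK(3) by (simp add: algebra_simps)
          finally show "norm (g p) \<le> \<kappa> * (Sup (snd p) - Inf (snd p))"
            by (simp add: tK(1))
        qed
        also have "\<dots> \<le> (\<Sum>p\<in>D. \<kappa> * (Sup (snd p) - Inf (snd p)))"
        proof (rule sum_mono2[OF fin(1)])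
          show "0 \<le> \<kappa> * (Sup (snd p) - Inf (snd p))" if "p \<in> D - D2" for p
            using that K(2,3)[of "fst p" "snd p"] \<kappa>(1) by auto
        qed (auto simp: D2_def)
        also have "\<dots> = \<kappa> * (b - a)"
          using additive_tagged_division_1[OF ab D, of "\<lambda>x. x"]
          by (simp add: sum_distrib_left[symmetric] case_prod_beta')
        finally show ?thesis using \<kappa>(2) by simp
      qed
      ultimately show ?thesis unfolding split using norm_triangle_lt[of "sum g D1" "sum g D2" \<epsilon>] by simp
    qed
    show "\<exists>\<gamma>. gauge \<gamma> \<and> (\<forall>D. D tagged_division_of {a..b} \<and> \<gamma> fine D \<longrightarrow>
        norm ((\<Sum>(t, K)\<in>D. measure lborel K *\<^sub>R f t) - (X b - X a)) < \<epsilon>)"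
      by (intro exI[of _ \<gamma>] conjI gauge allI impI est) auto
  qed
  then show ?thesis
    by (rule has_integral_spike[OF N, rotated]) (simp add: f_def)
qed

lemma abs_cont_on_vec_nth:
  assumes "abs_cont_on c d x"
  shows "abs_cont_on c d (\<lambda>t. x t $ i)"
  unfolding abs_cont_on_iff
proof (intro allI impI)
  fix e :: real assume "e > 0"
  obtain r where r: "r > 0" "\<And>P. interval_family c d P \<Longrightarrow>
    (\<Sum>p\<in>P. snd p - fst p) < r \<Longrightarrow> (\<Sum>p\<in>P. dist (x (fst p)) (x (snd p))) < e"
    by (rule abs_cont_onD[OF assms \<open>e > 0\<close>]) blast
  show "\<exists>r>0. \<forall>P. interval_family c d P \<longrightarrow>
    (\<Sum>p\<in>P. snd p - fst p) < r \<longrightarrow> (\<Sum>p\<in>P. dist (x (fst p) $ i) (x (snd p) $ i)) < e"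
  proof (intro exI[of _ r] conjI r(1) allI impI)
    fix P assume "interval_family c d P" "(\<Sum>p\<in>P. snd p - fst p) < r"
    then have "(\<Sum>p\<in>P. dist (x (fst p)) (x (snd p))) < e" by (rule r(2))
    moreover have "(\<Sum>p\<in>P. dist (x (fst p) $ i) (x (snd p) $ i)) \<le> (\<Sum>p\<in>P. dist (x (fst p)) (x (snd p)))"
      by (intro sum_mono dist_vec_nth_le)
    ultimately show "(\<Sum>p\<in>P. dist (x (fst p) $ i) (x (snd p) $ i)) < e" by simp
  qed
qed

lemma abs_cont_on_imp_continuous_on:
  assumes "abs_cont_on c d x"
  shows "continuous_on {c..d} x"
  unfolding continuous_on_iff
proof (intro ballI allI impI)
  fix t e assume t: "t \<in> {c..d}" and e: "(e :: real) > 0"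
  obtain r where r: "r > 0" "\<And>P. interval_family c d P \<Longrightarrow>
    (\<Sum>p\<in>P. snd p - fst p) < r \<Longrightarrow> (\<Sum>p\<in>P. dist (x (fst p)) (x (snd p))) < e"
    by (rule abs_cont_onD[OF assms e]) blast
  have "dist (x s) (x t) < e" if s: "s \<in> {c..d}" "dist s t < r" for s
  proof -
    have "(\<Sum>p\<in>{(min s t, max s t)}. dist (x (fst p)) (x (snd p))) < e"
      by (rule r(2)) (use s t in \<open>auto simp: dist_real_def interval_family_def pairwise_def\<close>)
    then show ?thesis by (auto simp: min_def max_def dist_commute split: if_splits)
  qed
  with r(1) show "\<exists>r>0. \<forall>s\<in>{c..d}. dist s t < r \<longrightarrow> dist (x s) (x t) < e" by blast
qed

text \<open>In the difference of products, the increment of f is multiplied by the bounded g and the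
  increment of g by the bounded f; the latter part is controlled by the total length alone.\<close>

lemma abs_cont_on_mult_lipschitz:
  fixes f g :: cfun
  assumes f: "abs_cont_on c d f" and L: "0 \<le> L" "\<And>u v. c \<le> u \<Longrightarrow> u \<le> v \<Longrightarrow> v \<le> d \<Longrightarrow> dist (g u) (g v) \<le> L * (v - u)"
    and B: "\<And>t. norm (g t) \<le> B"
  shows "abs_cont_on c d (\<lambda>t. f t * g t)"
  unfolding abs_cont_on_iff
proof (intro allI impI)
  fix e :: real assume e: "e > 0"
  have "bounded (f ` {c..d})"
    by (intro compact_imp_bounded compact_continuous_image abs_cont_on_imp_continuous_on[OF f]) simp
  then obtain F where F: "F > 0" "\<And>t. t \<in> {c..d} \<Longrightarrow> norm (f t) \<le> F" unfolding bounded_pos by blast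
  \<comment> \<open>The summands 1 here and in M keep both factors positive, so that e can be
    divided by them.\<close>
  define B' where "B' = \<bar>B\<bar> + 1"
  have B': "B' > 0" "norm (g t) \<le> B'" for t using B[of t] unfolding B'_def by linarith+
  define M where "M = F * (L + 1)"
  have M: "M > 0" using F(1) L(1) by (simp add: M_def)
  obtain r where r: "r > 0" "\<And>P. interval_family c d P \<Longrightarrow>
    (\<Sum>p\<in>P. snd p - fst p) < r \<Longrightarrow> (\<Sum>p\<in>P. dist (f (fst p)) (f (snd p))) < e / (2 * B')"
    by (rule abs_cont_onD[OF f, of "e / (2 * B')"]) (use e B'(1) in auto)
  show "\<exists>r>0. \<forall>P. interval_family c d P \<longrightarrow>
    (\<Sum>p\<in>P. snd p - fst p) < r \<longrightarrow>
    (\<Sum>p\<in>P. dist (f (fst p) * g (fst p)) (f (snd p) * g (snd p))) < e"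
  proof (intro exI[of _ "min r (e / (2 * M))"] conjI allI impI)
    show "0 < min r (e / (2 * M))" using r(1) e M by simp
    fix P assume P: "interval_family c d P" "(\<Sum>p\<in>P. snd p - fst p) < min r (e / (2 * M))"
    have "(\<Sum>p\<in>P. dist (f (fst p) * g (fst p)) (f (snd p) * g (snd p)))
        \<le> (\<Sum>p\<in>P. B' * dist (f (fst p)) (f (snd p)) + M * (snd p - fst p))"
    proof (rule sum_mono)
      fix p assume "p \<in> P"
      then have p: "c \<le> fst p" "fst p \<le> snd p" "snd p \<le> d" using P(1) by (auto simp: interval_family_def)
      have "f (fst p) * g (fst p) - f (snd p) * g (snd p)
          = (f (fst p) - f (snd p)) * g (fst p) + f (snd p) * (g (fst p) - g (snd p))"
        by (simp add: algebra_simps)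
      also have "norm \<dots> \<le> dist (f (fst p)) (f (snd p)) * B' + F * ((L + 1) * (snd p - fst p))"
      proof (rule norm_triangle_mono)
        show "norm ((f (fst p) - f (snd p)) * g (fst p)) \<le> dist (f (fst p)) (f (snd p)) * B'"
          unfolding norm_mult dist_norm using B'(2) by (intro mult_left_mono) auto
        have "norm (g (fst p) - g (snd p)) \<le> (L + 1) * (snd p - fst p)"
          using L(2)[OF p] p(2) by (simp add: dist_norm distrib_right)
        then show "norm (f (snd p) * (g (fst p) - g (snd p))) \<le> F * ((L + 1) * (snd p - fst p))"
          unfolding norm_mult using F p by (intro mult_mono) auto
      qed
      finally show "dist (f (fst p) * g (fst p)) (f (snd p) * g (snd p))
          \<le> B' * dist (f (fst p)) (f (snd p)) + M * (snd p - fst p)"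
        by (simp add: dist_norm M_def mult_ac)
    qed
    also have "\<dots> = B' * (\<Sum>p\<in>P. dist (f (fst p)) (f (snd p))) + M * (\<Sum>p\<in>P. snd p - fst p)"
      by (simp add: sum.distrib sum_distrib_left)
    also have "\<dots> < B' * (e / (2 * B')) + M * (e / (2 * M))"
    proof (rule add_strict_mono)
      show "B' * (\<Sum>p\<in>P. dist (f (fst p)) (f (snd p))) < B' * (e / (2 * B'))"
        using P by (intro mult_strict_left_mono B' r(2)) auto
      show "M * (\<Sum>p\<in>P. snd p - fst p) < M * (e / (2 * M))"
        using P by (intro mult_strict_left_mono M) auto
    qed
    also have "\<dots> = e" using B'(1) M by simp
    finally show "(\<Sum>p\<in>P. dist (f (fst p) * g (fst p)) (f (snd p) * g (snd p))) < e" .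
  qed
qed

subsection \<open>The Cauchy problem\<close>

context open_interval
begin

text \<open>On jump-free test functions all values of the multivalued derivative agree with
  \<open>ddt\<close>.\<close>

lemma derivatives_apply:
  assumes "y' \<in> derivatives I y" "\<psi> \<in> RR I" "\<And>t. t \<in> I \<Longrightarrow> jump t \<psi> = 0"
  shows "y' \<psi> = - y (gderiv I \<psi>)"
proof -
  obtain g where g: "g \<in> Delta I" "eq_distr I y' (\<lambda>\<phi>. ddt I y \<phi> + g \<phi>)"
    using assms(1) unfolding derivatives_def by blast
  then have "y' \<psi> = ddt I y \<psi> + g \<psi>" using assms(2) by (simp add: eq_distr_def)
  then show ?thesis using Delta_continuous[OF g(1) assms(2,3)] by (simp add: ddt_def)
qed

lemma continuous_primitive_is_gderiv:
  assumes "G \<in> GG I" "\<And>x y. x \<le> y \<Longrightarrow> {x..y} \<subseteq> I \<Longrightarrow> (G has_integral (\<eta> y - \<eta> x)) {x..y}"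
    "continuous_on UNIV \<eta>"
  shows "is_gderiv I \<eta> G"
  by (rule is_gderiv_primitive[OF assms(1,2)])
    (use rlim_piecewise[OF assms(3,3)] llim_piecewise[OF assms(3,3)] in simp_all)

lemma cauchy_solution_apply:
  fixes A :: "real \<Rightarrow> complex ^ 'n ^ 'n::finite"
  assumes A: "\<And>i j. (\<lambda>t. A t $ i $ j) \<in> Ginf I" and "t0 \<in> I" and \<phi>: "\<phi> \<in> RR I"
    and y: "cauchy_solution I A f t0 x0 \<alpha> y"
    and e: "e < t0" and T: "adjoint_test A \<phi> k c e d \<eta> G"
  shows "y k \<phi> = (\<Sum>i\<in>UNIV. f i (\<eta> i) + x0 $ i * \<eta> i t0)"
proof -
  note \<eta> = adjoint_testD(4,5)[OF T] and G = adjoint_testD(9)[OF T]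
  have D: "is_gderiv I (\<eta> j) (G j)" for j
    by (rule continuous_primitive_is_gderiv[OF adjoint_testD(7,8)[OF T] \<eta>(2)])
  have yd: "y i \<in> RR_dual I" and y0: "zero_before I t0 (y i)" for i
    using y by (auto simp: cauchy_solution_def solution_def)
  obtain y' where y': "\<And>i. y' i \<in> derivatives I (y i)"
    "\<And>i. eq_distr I (\<lambda>\<phi>. y' i \<phi> - (\<Sum>j\<in>UNIV. mult_distr (\<lambda>t. A t $ i $ j) (y j) \<phi>)) (\<lambda>\<phi>. f i \<phi> + x0 $ i * delta t0 \<alpha> \<phi>)"
    using y unfolding cauchy_solution_def solution_def by blast
  have lims: "rlim (\<eta> i) t = \<eta> i t" "llim (\<eta> i) t = \<eta> i t" for i t
    using rlim_piecewise[OF \<eta>(2)[of i] \<eta>(2)[of i], of t t] llim_piecewise[OF \<eta>(2)[of i] \<eta>(2)[of i], of t t] by simp_all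
  define H where "H i = gderiv I (\<eta> i)" for i
  have H: "H i \<in> RR I" for i unfolding H_def by (rule RR_gderiv[OF \<eta>(1)])
  have HG: "AE t\<in>I in lebesgue. H i t = G i t" for i unfolding H_def by (rule gderiv_AE[OF D])
  have A\<eta>: "(\<lambda>t. A t $ i $ j * \<eta> i t) \<in> RR I" for i j by (rule RR_Ginf_mult[OF A \<eta>(1)])
  have eq: "- y i (H i) - (\<Sum>j\<in>UNIV. y j (\<lambda>t. A t $ i $ j * \<eta> i t)) = f i (\<eta> i) + x0 $ i * \<eta> i t0" for i
  proof -
    have "y' i (\<eta> i) = - y i (H i)"
      unfolding H_def by (rule derivatives_apply[OF y'(1) \<eta>(1)]) (simp add: jump_def lims)
    moreover have "delta t0 \<alpha> (\<eta> i) = \<eta> i t0" by (simp add: delta_def lims algebra_simps)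
    ultimately show ?thesis
      using y'(2)[of i, unfolded eq_distr_def mult_distr_def, rule_format, OF \<eta>(1)[of i]] by simp
  qed
  \<comment> \<open>The defect of the adjoint equation. It vanishes almost everywhere to the right
    of e < t0, so y j, which is 0 before t0, takes the value 0 on it.\<close>
  define \<Psi> where "\<Psi> j t = (-1 * H j t - (\<Sum>i\<in>UNIV. A t $ i $ j * \<eta> i t)) - (if j = k then 1 else 0) * \<phi> t" for j t
  have \<Psi>: "\<Psi> j \<in> RR I" for j
    unfolding \<Psi>_def by (intro RR_diff RR_cmult RR_sum H A\<eta> \<phi>)
  have \<Psi>0: "y j (\<Psi> j) = 0" for j
  proof (rule zero_beforeD[OF y0 \<Psi> e])
    show "AE t\<in>I in lebesgue. e < t \<longrightarrow> \<Psi> j t = 0"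
      using HG[of j] G[of j] by eventually_elim (simp add: \<Psi>_def)
  qed
  have "y j (\<Psi> j) = (- y j (H j) - (\<Sum>i\<in>UNIV. y j (\<lambda>t. A t $ i $ j * \<eta> i t))) - (if j = k then 1 else 0) * y j \<phi>" for j
  proof -
    have 1: "(\<lambda>t. -1 * H j t) \<in> RR I" "(\<lambda>t. \<Sum>i\<in>UNIV. A t $ i $ j * \<eta> i t) \<in> RR I"
      by (intro RR_cmult RR_sum H A\<eta>)+
    have "y j (\<Psi> j) = y j (\<lambda>t. -1 * H j t - (\<Sum>i\<in>UNIV. A t $ i $ j * \<eta> i t)) - y j (\<lambda>t. (if j = k then 1 else 0) * \<phi> t)"
      unfolding \<Psi>_def by (rule RR_dual_diff[OF yd RR_diff[OF 1] RR_cmult[OF \<phi>]])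
    also have "y j (\<lambda>t. -1 * H j t - (\<Sum>i\<in>UNIV. A t $ i $ j * \<eta> i t)) = y j (\<lambda>t. -1 * H j t) - y j (\<lambda>t. \<Sum>i\<in>UNIV. A t $ i $ j * \<eta> i t)"
      by (rule RR_dual_diff[OF yd 1])
    also have "y j (\<lambda>t. -1 * H j t) = -1 * y j (H j)" by (rule RR_dual_cmult[OF yd H])
    also have "y j (\<lambda>t. \<Sum>i\<in>UNIV. A t $ i $ j * \<eta> i t) = (\<Sum>i\<in>UNIV. y j (\<lambda>t. A t $ i $ j * \<eta> i t))"
      by (rule RR_dual_sum[OF yd A\<eta>])
    also have "y j (\<lambda>t. (if j = k then 1 else 0) * \<phi> t) = (if j = k then 1 else 0) * y j \<phi>"
      by (rule RR_dual_cmult[OF yd \<phi>])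
    finally show ?thesis by simp
  qed
  then have "(if j = k then 1 else 0) * y j \<phi> = - y j (H j) - (\<Sum>i\<in>UNIV. y j (\<lambda>t. A t $ i $ j * \<eta> i t))" for j
    using \<Psi>0[of j] by simp
  then have "(\<Sum>j\<in>UNIV. (if j = k then 1 else 0) * y j \<phi>)
      = (\<Sum>j\<in>UNIV. - y j (H j) - (\<Sum>i\<in>UNIV. y j (\<lambda>t. A t $ i $ j * \<eta> i t)))" by simp
  \<comment> \<open>Exchanging the sums turns the columns of A, in which the adjoint system is
    written, back into the rows of the original equations \<open>eq\<close>.\<close>
  also have "\<dots> = (\<Sum>i\<in>UNIV. - y i (H i)) - (\<Sum>i\<in>UNIV. \<Sum>j\<in>UNIV. y j (\<lambda>t. A t $ i $ j * \<eta> i t))"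
    unfolding sum_subtractf by (subst sum.swap) simp
  also have "\<dots> = (\<Sum>i\<in>UNIV. f i (\<eta> i) + x0 $ i * \<eta> i t0)"
    unfolding sum_subtractf[symmetric] by (intro sum.cong eq) simp
  also have "(\<Sum>j\<in>UNIV. (if j = k then 1 else 0) * y j \<phi>) = y k \<phi>"
    by (simp add: if_distrib[of "\<lambda>x. x * _"] cong: if_cong)
  finally show ?thesis .
qed

text \<open>With one \<eta> for both solutions, the right-hand sides of
  \<open>cauchy_solution_apply\<close> are identical: they contain neither the solution nor its
  parameter.\<close>

lemma cauchy_solution_unique:
  fixes A :: "real \<Rightarrow> complex ^ 'n ^ 'n::finite"
  assumes A: "\<And>i j. (\<lambda>t. A t $ i $ j) \<in> Ginf I" and "t0 \<in> I"
    and y: "cauchy_solution I A f t0 x0 \<alpha> y" and z: "cauchy_solution I A f t0 x0 \<beta> z"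
  shows "eq_distr I (y k) (z k)"
  unfolding eq_distr_def
proof
  fix \<phi> assume \<phi>: "\<phi> \<in> RR I"
  obtain c e d \<eta> G where "e < t0" "adjoint_test A \<phi> k c e d \<eta> G"
    by (rule adjoint_test_exists[OF A \<phi> \<open>t0 \<in> I\<close>])
  note * = cauchy_solution_apply[OF A \<open>t0 \<in> I\<close> \<phi> _ this]
  show "y k \<phi> = z k \<phi>" unfolding *[OF y] *[OF z] ..
qed

end

section \<open>Regular right-hand sides and the ordinary Cauchy problem\<close>

context open_interval
begin

lemma locally_summable_mult_test:
  assumes F: "locally_summable I F" and \<eta>: "continuous_on UNIV \<eta>" "\<And>t. t \<le> c \<or> d \<le> t \<Longrightarrow> \<eta> t = 0"
    and cd: "{c..d} \<subseteq> I"
  shows "(\<lambda>t. F t * \<eta> t) absolutely_integrable_on {c..d}" "set_integrable lebesgue I (\<lambda>t. F t * \<eta> t)"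
proof -
  have c: "continuous_on {c..d} \<eta>" using \<eta>(1) continuous_on_subset by blast
  have "(\<lambda>t. \<eta> t * F t) absolutely_integrable_on {c..d}"
  proof (rule absolutely_integrable_bounded_measurable_product[OF bilinear_times])
    show "\<eta> \<in> borel_measurable (lebesgue_on {c..d})"
      by (rule continuous_imp_measurable_on_sets_lebesgue[OF c]) simp
    show "bounded (\<eta> ` {c..d})" by (intro compact_imp_bounded compact_continuous_image c) simp
    show "F absolutely_integrable_on {c..d}" using F cd unfolding locally_summable_def by blast
  qed simp
  then show 1: "(\<lambda>t. F t * \<eta> t) absolutely_integrable_on {c..d}" by (simp add: mult.commute)
  have "(\<lambda>t. indicat_real I t *\<^sub>R (F t * \<eta> t)) = (\<lambda>t. indicat_real {c..d} t *\<^sub>R (F t * \<eta> t))"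
    using \<eta>(2) cd by (fastforce simp: indicator_def)
  then show "set_integrable lebesgue I (\<lambda>t. F t * \<eta> t)" using 1 by (simp add: set_integrable_def)
qed

text \<open>The part of the integral before t0 must vanish. Cutting \<eta> off at t0 itself may
  leave t0 in the support, where the hypothesis on f says nothing. Cutting at s < t0 is allowed, and
  dominated convergence lets s increase to t0.\<close>

lemma regular_zero_before_apply:
  assumes f: "zero_before I t0 f" "eq_distr I f (regular I F)" and F: "locally_summable I F"
    and \<eta>: "\<eta> \<in> RR I" "continuous_on UNIV \<eta>" "\<And>t. t \<le> c \<or> d \<le> t \<Longrightarrow> \<eta> t = 0"
    and cd: "{c..d} \<subseteq> I" "c < t0"
  shows "f \<eta> = integral {t0..d} (\<lambda>t. F t * \<eta> t)"
proof -
  define \<Phi> where "\<Phi> t = indicat_real I t *\<^sub>R (F t * \<eta> t)" for t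
  define H where "H s t = (if t < s then 1 else 0 :: complex)" for s t :: real
  note int = locally_summable_mult_test[OF F \<eta>(2,3) cd(1)]
  have \<Phi>: "integrable lebesgue \<Phi>"
    using int(2) unfolding set_integrable_def \<Phi>_def .
  have Hm: "H s \<in> borel_measurable lebesgue" for s
    unfolding H_def by (intro measurable_completion) measurable
  have zero: "integral\<^sup>L lebesgue (\<lambda>t. H s t * \<Phi> t) = 0" if "s < t0" for s
  proof -
    have RR: "(\<lambda>t. H s t * \<eta> t) \<in> RR I"
      unfolding H_def by (intro RR_Ginf_mult Ginf_cut \<eta>)
    then have "f (\<lambda>t. H s t * \<eta> t) = 0"
      by (intro zero_beforeD[OF f(1) _ that]) (auto simp: H_def)
    moreover have "f (\<lambda>t. H s t * \<eta> t) = integral\<^sup>L lebesgue (\<lambda>t. H s t * \<Phi> t)"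
      using f(2) RR unfolding eq_distr_def regular_def set_lebesgue_integral_def \<Phi>_def
      by (auto simp: mult_ac intro!: Bochner_Integration.integral_cong)
    ultimately show ?thesis by simp
  qed
  have lim: "(\<lambda>n. integral\<^sup>L lebesgue (\<lambda>t. H (t0 - inverse (real (Suc n))) t * \<Phi> t)) \<longlonglongrightarrow> integral\<^sup>L lebesgue (\<lambda>t. H t0 t * \<Phi> t)"
  proof (rule integral_dominated_convergence[of _ _ _ "\<lambda>t. norm (\<Phi> t)"])
    show "(\<lambda>t. H t0 t * \<Phi> t) \<in> borel_measurable lebesgue"
      by (intro borel_measurable_times Hm borel_measurable_integrable \<Phi>)
    show "(\<lambda>t. H (t0 - inverse (real (Suc n))) t * \<Phi> t) \<in> borel_measurable lebesgue" for n
      by (intro borel_measurable_times Hm borel_measurable_integrable \<Phi>)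
    show "integrable lebesgue (\<lambda>t. norm (\<Phi> t))" using \<Phi> by (rule integrable_norm)
    show "AE t in lebesgue. norm (H (t0 - inverse (real (Suc n))) t * \<Phi> t) \<le> norm (\<Phi> t)" for n
      by (auto simp: H_def)
    show "AE t in lebesgue. (\<lambda>n. H (t0 - inverse (real (Suc n))) t * \<Phi> t) \<longlonglongrightarrow> H t0 t * \<Phi> t"
    proof (rule AE_I2, rule tendsto_eventually)
      fix t
      show "\<forall>\<^sub>F n in sequentially. H (t0 - inverse (real (Suc n))) t * \<Phi> t = H t0 t * \<Phi> t"
      proof (cases "t < t0")
        case True
        have "\<forall>\<^sub>F n in sequentially. inverse (real (Suc n)) < t0 - t"
          by (rule order_tendstoD[OF LIMSEQ_inverse_real_of_nat]) (use True in simp)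
        then show ?thesis by eventually_elim (use True in \<open>simp add: H_def\<close>)
      next
        case False
        have "\<not> t < t0 - inverse (real (Suc n))" for n
          using False positive_imp_inverse_positive[of "real (Suc n)"] by linarith
        then show ?thesis using False by (simp add: H_def)
      qed
    qed
  qed
  have "t0 - inverse (real (Suc n)) < t0" for n by simp
  with lim have "(\<lambda>n. 0) \<longlonglongrightarrow> integral\<^sup>L lebesgue (\<lambda>t. H t0 t * \<Phi> t)"
    by (simp only: zero)
  then have 0: "integral\<^sup>L lebesgue (\<lambda>t. H t0 t * \<Phi> t) = 0"
    by (simp only: LIMSEQ_const_iff)
  have i1: "integrable lebesgue (\<lambda>t. H t0 t * \<Phi> t)"
  proof (rule Bochner_Integration.integrable_bound[OF \<Phi>])
    show "(\<lambda>t. H t0 t * \<Phi> t) \<in> borel_measurable lebesgue"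
      by (intro borel_measurable_times Hm borel_measurable_integrable \<Phi>)
  qed (auto simp: H_def)
  have "(\<lambda>t. F t * \<eta> t) absolutely_integrable_on {t0..d}"
    by (rule set_integrable_subset[OF int(1)]) (use cd in auto)
  note i2 = this set_lebesgue_integral_eq_integral(2)[OF this]
  have "f \<eta> = integral\<^sup>L lebesgue \<Phi>"
    using f(2) \<eta>(1) unfolding eq_distr_def regular_def set_lebesgue_integral_def \<Phi>_def by blast
  also have "\<Phi> = (\<lambda>t. H t0 t * \<Phi> t + indicat_real {t0..d} t *\<^sub>R (F t * \<eta> t))"
  proof
    fix t
    have "t \<in> I" if "t0 \<le> t" "t \<le> d" using that cd by auto
    moreover have "\<eta> t = 0" if "d < t" using that \<eta>(3) by auto
    ultimately show "\<Phi> t = H t0 t * \<Phi> t + indicat_real {t0..d} t *\<^sub>R (F t * \<eta> t)"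
      by (cases "t < t0"; cases "d < t") (auto simp: H_def \<Phi>_def)
  qed
  also have "integral\<^sup>L lebesgue \<dots> = integral\<^sup>L lebesgue (\<lambda>t. H t0 t * \<Phi> t)
      + integral\<^sup>L lebesgue (\<lambda>t. indicat_real {t0..d} t *\<^sub>R (F t * \<eta> t))"
    by (rule Bochner_Integration.integral_add[OF i1]) (use i2(1) in \<open>simp add: set_integrable_def\<close>)
  also have "\<dots> = integral {t0..d} (\<lambda>t. F t * \<eta> t)"
    using 0 i2(2) by (simp add: set_lebesgue_integral_def)
  finally show ?thesis .
qed

text \<open>In the derivative of the sum of x i * \<eta> i the terms with A cancel, one factor
  solving the system and the other its adjoint; the sum of F i * \<eta> i, minus x k * \<phi>,
  remains. At d all \<eta> i vanish. The lower end is s > t0 because absolute continuity is given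
  only on compact intervals to the right of t0.\<close>

lemma ordinary_solution_integral:
  fixes A :: "real \<Rightarrow> complex ^ 'n ^ 'n::finite" and x F :: "real \<Rightarrow> complex ^ 'n"
  assumes x: "ordinary_solution I A F t0 x0 x" and s: "t0 < s" "s < d" and e: "e < t0"
    and T: "adjoint_test A \<phi> k c e d \<eta> G"
  shows "((\<lambda>t. (\<Sum>i\<in>UNIV. F t $ i * \<eta> i t) - x t $ k * \<phi> t) has_integral - (\<Sum>i\<in>UNIV. x s $ i * \<eta> i s)) {s..d}"
proof -
  note cd = adjoint_testD(2,1)[OF T] e and \<eta> = adjoint_testD(5,6)[OF T] and G = adjoint_testD(7-9)[OF T]
  define S where "S = I \<inter> {t0<..}"
  have S: "open S" "{s..d} \<subseteq> S" using open_I cd s by (auto simp: S_def)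
  have sd: "{s..d} \<subseteq> I" using S(2) by (auto simp: S_def)
  have ac: "abs_cont_on s d (\<lambda>t. x t $ i)" for i
    using x S(2) s unfolding ordinary_solution_def S_def[symmetric] by (intro abs_cont_on_vec_nth) auto
  have "AE t\<in>S in lebesgue. (\<exists>x'. (x has_vector_derivative x') (at t) \<and> x' - A t *v x t = F t)"
    using x unfolding ordinary_solution_def S_def[symmetric] AE_lebesgue_on_iff[OF S(1)] by blast
  then have deriv: "AE t\<in>S in lebesgue. (\<forall>i. ((\<lambda>t. x t $ i) has_vector_derivative (A t *v x t + F t) $ i) (at t))"
  proof eventually_elim
    case (elim t)
    show ?case
    proof (intro impI allI)
      fix i assume "t \<in> S"
      then obtain x' where "(x has_vector_derivative x') (at t)" "x' - A t *v x t = F t" using elim by blast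
      then show "((\<lambda>t. x t $ i) has_vector_derivative (A t *v x t + F t) $ i) (at t)"
        using bounded_linear.has_vector_derivative[OF bounded_linear_vec_nth, of x x' "at t" i]
        by (simp add: algebra_simps)
    qed
  qed
  define W where "W i t = x t $ i * G i t + (A t *v x t + F t) $ i * \<eta> i t" for i t
  have W: "(W i has_integral (x d $ i * \<eta> i d - x s $ i * \<eta> i s)) {s..d}" for i
  proof (rule abs_cont_has_integral[where X = "\<lambda>t. x t $ i * \<eta> i t"])
    show "s \<le> d" using s by simp
    show "AE t in lebesgue. s < t \<and> t < d \<longrightarrow> ((\<lambda>t. x t $ i * \<eta> i t) has_vector_derivative W i t) (at t)"
    proof -
      have "AE t\<in>I in lebesgue. (\<eta> i has_vector_derivative G i t) (at t)"
        by (rule primitive_AE_derivative[OF G(1,2)])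
      with deriv show ?thesis
      proof eventually_elim
        case (elim t)
        show ?case
        proof
          assume t: "s < t \<and> t < d"
          then have "t \<in> S" "t \<in> I" using S(2) sd by auto
          then show "((\<lambda>t. x t $ i * \<eta> i t) has_vector_derivative W i t) (at t)"
            unfolding W_def using elim by (intro has_vector_derivative_mult) auto
        qed
      qed
    qed
    obtain C where C: "C \<ge> 0" "AE t\<in>I in lebesgue. norm (G i t) \<le> C" by (rule GG_bounded[OF G(1)])
    \<comment> \<open>G i is essentially bounded, so its primitive is Lipschitz and the product with
      x i stays absolutely continuous.\<close>
    have lip: "dist (\<eta> i u) (\<eta> i v) \<le> C * (v - u)" if "s \<le> u" "u \<le> v" "v \<le> d" for u v
    proof -
      have uv: "{u..v} \<subseteq> I" using that sd by auto
      have "norm (\<eta> i v - \<eta> i u - of_real (v - u) * 0) \<le> C * (v - u)"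
      proof (rule has_integral_AE_bound[OF G(2)[OF that(2) uv] that(2) C(1)])
        show "AE t in lebesgue. u < t \<and> t < v \<longrightarrow> norm (G i t - 0) \<le> C"
          using C(2) by eventually_elim (use uv in \<open>auto simp: subset_iff\<close>)
      qed
      then show ?thesis by (simp add: dist_norm norm_minus_commute)
    qed
    have "bounded (\<eta> i ` {c..d})"
      by (intro compact_imp_bounded compact_continuous_image continuous_on_subset[OF \<eta>(1)]) auto
    then obtain B where B: "B > 0" "\<And>t. t \<in> {c..d} \<Longrightarrow> norm (\<eta> i t) \<le> B" unfolding bounded_pos by blast
    have bd: "norm (\<eta> i t) \<le> B" for t
    proof (cases "t \<in> {c..d}")
      case False
      then have "\<eta> i t = 0" using \<eta>(2)[of t i] by auto
      then show ?thesis using B(1) by simp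
    qed (rule B(2))
    show "abs_cont_on s d (\<lambda>t. x t $ i * \<eta> i t)"
      by (rule abs_cont_on_mult_lipschitz[OF ac C(1) lip bd])
  qed
  have "((\<lambda>t. \<Sum>i\<in>UNIV. W i t) has_integral (\<Sum>i\<in>UNIV. x d $ i * \<eta> i d - x s $ i * \<eta> i s)) {s..d}"
    by (intro has_integral_sum W) simp
  then have "((\<lambda>t. \<Sum>i\<in>UNIV. W i t) has_integral - (\<Sum>i\<in>UNIV. x s $ i * \<eta> i s)) {s..d}"
    using \<eta>(2)[of d] by (simp add: sum_negf)
  moreover have "AE t in lebesgue. s \<le> t \<and> t \<le> d \<longrightarrow> (\<Sum>i\<in>UNIV. F t $ i * \<eta> i t) - x t $ k * \<phi> t = (\<Sum>i\<in>UNIV. W i t)"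
  proof -
    have "AE t in lebesgue. \<forall>j\<in>UNIV. t \<in> I \<longrightarrow> e < t \<longrightarrow>
        G j t = - (\<Sum>i\<in>UNIV. A t $ i $ j * \<eta> i t) - (if j = k then \<phi> t else 0)"
      by (rule AE_finite_allI) (use G(3) in auto)
    then show ?thesis
    proof eventually_elim
      case (elim t)
      show ?case
      proof
        assume t: "s \<le> t \<and> t \<le> d"
        then have "t \<in> I" "e < t" using sd s cd by auto
        then have Gt: "G j t = - (\<Sum>i\<in>UNIV. A t $ i $ j * \<eta> i t) - (if j = k then \<phi> t else 0)" for j
          using elim by blast
        have "(\<Sum>i\<in>UNIV. x t $ i * G i t)
            = - (\<Sum>j\<in>UNIV. \<Sum>i\<in>UNIV. x t $ j * (A t $ i $ j * \<eta> i t)) - (\<Sum>j\<in>UNIV. if j = k then x t $ j * \<phi> t else 0)"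
          unfolding Gt sum_negf[symmetric] sum_subtractf[symmetric]
          by (intro sum.cong) (auto simp: sum_distrib_left algebra_simps)
        also have "(\<Sum>j\<in>UNIV. if j = k then x t $ j * \<phi> t else 0) = x t $ k * \<phi> t" by simp
        also have "(\<Sum>j\<in>UNIV. \<Sum>i\<in>UNIV. x t $ j * (A t $ i $ j * \<eta> i t)) = (\<Sum>i\<in>UNIV. (A t *v x t) $ i * \<eta> i t)"
          by (subst sum.swap) (auto simp: matrix_vector_mult_def sum_distrib_left sum_distrib_right mult_ac intro!: sum.cong)
        finally show "(\<Sum>i\<in>UNIV. F t $ i * \<eta> i t) - x t $ k * \<phi> t = (\<Sum>i\<in>UNIV. W i t)"
          unfolding W_def by (simp add: sum.distrib distrib_right)
      qed
    qed
  qed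
  from negligible_if_AE[OF this] have "((\<lambda>t. (\<Sum>i\<in>UNIV. F t $ i * \<eta> i t) - x t $ k * \<phi> t) has_integral y) {s..d}"
    if "((\<lambda>t. \<Sum>i\<in>UNIV. W i t) has_integral y) {s..d}" for y
    by (rule has_integral_spike[OF _ _ that]) auto
  ultimately show ?thesis by blast
qed

text \<open>Mediates between the Lebesgue integral over the open set S in \<open>regular\<close> and
  the gauge integral over a compact interval.\<close>

lemma regular_integral_eq:
  assumes x: "continuous_on {t1..d} x" and \<phi>: "\<phi> \<in> GG I" and S: "{t1..d} \<subseteq> S" "S \<subseteq> I" "open S"
    and supp: "AE t\<in>S in lebesgue. t \<notin> {t1..d} \<longrightarrow> \<phi> t = 0"
  shows "((\<lambda>t. x t * \<phi> t) has_integral regular S x \<phi>) {t1..d}"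
proof -
  obtain p C where p: "p \<in> borel_measurable (lebesgue_on I)" "\<And>t. norm (p t) \<le> C"
    "AE t\<in>I in lebesgue. \<phi> t = p t"
    using GG_bounded_representative[OF \<phi>] by blast
  have "p \<in> borel_measurable (lebesgue_on {t1..d})"
    by (rule measurable_restrict_mono[OF p(1)]) (use S in auto)
  then have "(\<lambda>t. p t * x t) absolutely_integrable_on {t1..d}"
    by (rule absolutely_integrable_bounded_mult_continuous[OF _ p(2) x])
  then have 1: "(\<lambda>t. x t * \<phi> t) absolutely_integrable_on {t1..d}"
    by (rule absolutely_integrable_spike[OF _ negligible_if_AE[OF p(3)]]) (use S in auto)
  define \<theta> where "\<theta> t = (if t \<in> {t1..d} then x t * \<phi> t else 0)" for t
  have "\<theta> absolutely_integrable_on UNIV"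
    unfolding \<theta>_def absolutely_integrable_restrict_UNIV by (rule 1)
  then have \<theta>: "\<theta> absolutely_integrable_on S"
    by (rule set_integrable_subset) (use S(3) in auto)
  have N: "negligible {t. \<not> (t \<in> S \<longrightarrow> t \<notin> {t1..d} \<longrightarrow> \<phi> t = 0)}" by (rule negligible_if_AE[OF supp])
  have "(\<lambda>t. x t * \<phi> t) absolutely_integrable_on S"
    by (rule absolutely_integrable_spike[OF \<theta> N]) (auto simp: \<theta>_def)
  from set_lebesgue_integral_eq_integral(2)[OF this]
  have "regular S x \<phi> = integral S (\<lambda>t. x t * \<phi> t)" by (simp add: regular_def)
  also have "\<dots> = integral S \<theta>"
    by (rule integral_spike[OF N]) (auto simp: \<theta>_def)
  also have "\<dots> = integral {t1..d} (\<lambda>t. x t * \<phi> t)"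
    unfolding \<theta>_def integral_restrict_Int using S(1) by (simp add: Int_absorb2)
  finally show ?thesis
    using set_lebesgue_integral_eq_integral(1)[OF 1] by (simp add: integrable_integral)
qed

lemma cauchy_solution_eq_ordinary_solution:
  fixes A :: "real \<Rightarrow> complex ^ 'n ^ 'n::finite" and F :: "real \<Rightarrow> complex ^ 'n"
  assumes A: "\<And>i j. (\<lambda>t. A t $ i $ j) \<in> Ginf I" and "t0 \<in> I"
    and f: "\<And>i. zero_before I t0 (f i)" "\<And>i. eq_distr I (f i) (regular I (\<lambda>t. F t $ i))"
      "\<And>i. locally_summable I (\<lambda>t. F t $ i)"
    and y: "cauchy_solution I A f t0 x0 \<alpha> y" and x: "ordinary_solution I A F t0 x0 x"
    and \<phi>: "\<phi> \<in> RR I" "gsupp I \<phi> \<subseteq> I \<inter> {t0<..}"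
  shows "y k \<phi> = regular (I \<inter> {t0<..}) (\<lambda>t. x t $ k) \<phi>"
proof -
  obtain c e d \<eta> G where T: "e < t0" "t0 < d" "adjoint_test A \<phi> k c e d \<eta> G"
    by (rule adjoint_test_exists[OF A \<phi>(1) \<open>t0 \<in> I\<close>])
  note cd = adjoint_testD(1)[OF T(3)] T(1,2) adjoint_testD(2)[OF T(3)]
    and supp = adjoint_testD(3)[OF T(3)] and \<eta> = adjoint_testD(4-6)[OF T(3)]
  have ct0: "c < t0" using cd by simp
  define \<Phi> where "\<Phi> t = (\<Sum>i\<in>UNIV. F t $ i * \<eta> i t)" for t
  have F\<eta>: "(\<lambda>t. F t $ i * \<eta> i t) integrable_on {t0..d}" for i
    using integrable_on_subinterval[OF set_lebesgue_integral_eq_integral(1)[OF locally_summable_mult_test(1)[OF f(3) \<eta>(2,3) cd(4)]], of t0 d]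
      ct0 by auto
  have \<Phi>: "\<Phi> integrable_on {t0..d}" unfolding \<Phi>_def by (intro integrable_sum F\<eta>) simp
  have "y k \<phi> = (\<Sum>i\<in>UNIV. f i (\<eta> i) + x0 $ i * \<eta> i t0)"
    by (rule cauchy_solution_apply[OF A \<open>t0 \<in> I\<close> \<phi>(1) y T(1,3)])
  also have "\<dots> = (\<Sum>i\<in>UNIV. integral {t0..d} (\<lambda>t. F t $ i * \<eta> i t)) + (\<Sum>i\<in>UNIV. x0 $ i * \<eta> i t0)"
    using regular_zero_before_apply[OF f(1) f(2) f(3) \<eta>(1,2,3) cd(4) ct0] by (simp add: sum.distrib)
  also have "(\<Sum>i\<in>UNIV. integral {t0..d} (\<lambda>t. F t $ i * \<eta> i t)) = integral {t0..d} \<Phi>"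
    unfolding \<Phi>_def by (rule integral_sum[symmetric]) (use F\<eta> in auto)
  finally have yk: "y k \<phi> = integral {t0..d} \<Phi> + (\<Sum>i\<in>UNIV. x0 $ i * \<eta> i t0)" .
  \<comment> \<open>The compact support of \<phi> keeps a distance from t0, so x * \<phi> need only
    be integrated over {t1..d}, where x is continuous.\<close>
  obtain t1 where t1: "t0 < t1" "t1 < d" "AE t\<in>I in lebesgue. t < t1 \<longrightarrow> \<phi> t = 0"
  proof -
    obtain m where m: "m > t0" "\<And>t. t \<in> gsupp I \<phi> \<Longrightarrow> m \<le> t"
    proof (cases "gsupp I \<phi> = {}")
      case False
      have "compact (gsupp I \<phi>)" using \<phi>(1) by (simp add: RR_def)
      then obtain m where "m \<in> gsupp I \<phi>" "\<And>t. t \<in> gsupp I \<phi> \<Longrightarrow> m \<le> t"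
        using compact_attains_inf[OF _ False] by blast
      then show ?thesis using that[of m] \<phi>(2) by auto
    qed (use that[of "t0 + 1"] in auto)
    show ?thesis
    \<comment> \<open>The midpoint ensures t1 < d, also when the support is empty and m = t0 +
      1.\<close>
    proof (rule that[of "min m ((t0 + d) / 2)"])
      show "AE t\<in>I in lebesgue. t < min m ((t0 + d) / 2) \<longrightarrow> \<phi> t = 0"
        using AE_zero_outside_gsupp[OF Ginf_GG[OF RR_Ginf[OF \<phi>(1)]]]
      proof eventually_elim
        case (elim t)
        then show ?case using m(2)[of t] by auto
      qed
    qed (use m(1) cd(3) in \<open>auto simp: min_less_iff_disj\<close>)
  qed
  define S where "S = I \<inter> {t0<..}"
  have S: "{t1..d} \<subseteq> S" "S \<subseteq> I" "open S" using open_I cd t1 by (auto simp: S_def)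
  have xc: "continuous_on {t1..d} (\<lambda>t. x t $ k)"
    using x S(1) t1(2) unfolding ordinary_solution_def S_def[symmetric]
    by (intro abs_cont_on_imp_continuous_on abs_cont_on_vec_nth) auto
  have Q: "((\<lambda>t. x t $ k * \<phi> t) has_integral regular S (\<lambda>t. x t $ k) \<phi>) {t1..d}"
  proof (rule regular_integral_eq[OF xc Ginf_GG[OF RR_Ginf[OF \<phi>(1)]] S])
    show "AE t\<in>S in lebesgue. t \<notin> {t1..d} \<longrightarrow> \<phi> t = 0"
      using supp t1(3) by eventually_elim (use S(2) in auto)
  qed
  \<comment> \<open>The left-hand side does not depend on s, since \<phi> vanishes almost everywhere
    on {s..t1}; only the right-hand side changes as s decreases to t0.\<close>
  have eq: "regular S (\<lambda>t. x t $ k) \<phi> = integral {s..d} \<Phi> + (\<Sum>i\<in>UNIV. x s $ i * \<eta> i s)"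
    if s: "t0 < s" "s < t1" for s
  proof -
    have sd: "s < d" using s t1 by simp
    have "\<Phi> integrable_on {s..d}" using integrable_on_subinterval[OF \<Phi>, of s d] s by auto
    from has_integral_diff[OF integrable_integral[OF this] ordinary_solution_integral[OF x s(1) sd T(1,3)]]
    have whole: "((\<lambda>t. x t $ k * \<phi> t) has_integral (integral {s..d} \<Phi> + (\<Sum>i\<in>UNIV. x s $ i * \<eta> i s))) {s..d}"
      by (simp add: \<Phi>_def)
    have zero: "((\<lambda>t. x t $ k * \<phi> t) has_integral 0) {s..t1}"
    proof (rule has_integral_spike[of "insert t1 {t. \<not> (t \<in> I \<longrightarrow> t < t1 \<longrightarrow> \<phi> t = 0)}" _ _ "\<lambda>_. 0"])
      show "negligible (insert t1 {t. \<not> (t \<in> I \<longrightarrow> t < t1 \<longrightarrow> \<phi> t = 0)})"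
        unfolding negligible_insert by (rule negligible_if_AE[OF t1(3)])
      fix t assume t: "t \<in> {s..t1} - insert t1 {t. \<not> (t \<in> I \<longrightarrow> t < t1 \<longrightarrow> \<phi> t = 0)}"
      moreover have "{s..t1} \<subseteq> I" using cd t1 s by auto
      ultimately show "x t $ k * \<phi> t = 0" by auto
    qed simp
    have split: "((\<lambda>t. x t $ k * \<phi> t) has_integral (0 + regular S (\<lambda>t. x t $ k) \<phi>)) {s..d}"
      by (rule has_integral_combine[OF _ _ zero Q]) (use s t1 in auto)
    show ?thesis using has_integral_unique[OF split whole] by simp
  qed
  have "((\<lambda>s. integral {s..d} \<Phi> + (\<Sum>i\<in>UNIV. x s $ i * \<eta> i s)) \<longlongrightarrow> integral {t0..d} \<Phi> + (\<Sum>i\<in>UNIV. x0 $ i * \<eta> i t0)) (at_right t0)"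
  proof (intro tendsto_add tendsto_sum tendsto_mult tendsto_vec_nth)
    have "continuous_on {t0..d} (\<lambda>s. integral {s..d} \<Phi>)" by (rule indefinite_integral_continuous_1'[OF \<Phi>])
    then have "((\<lambda>s. integral {s..d} \<Phi>) \<longlongrightarrow> integral {t0..d} \<Phi>) (at t0 within {t0..d})"
      using cd(3) unfolding continuous_on_def by auto
    then show "((\<lambda>s. integral {s..d} \<Phi>) \<longlongrightarrow> integral {t0..d} \<Phi>) (at_right t0)"
      using cd(3) by (simp add: at_within_Icc_at_right)
    show "(x \<longlongrightarrow> x0) (at_right t0)" using x unfolding ordinary_solution_def by blast
    show "(\<eta> i \<longlongrightarrow> \<eta> i t0) (at_right t0)" for i
      using \<eta>(2)[of i] unfolding continuous_on_def by (auto intro: tendsto_within_subset)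
  qed
  then have "((\<lambda>s. regular S (\<lambda>t. x t $ k) \<phi>) \<longlongrightarrow> y k \<phi>) (at_right t0)"
    unfolding yk
  proof (rule Lim_transform_eventually)
    show "\<forall>\<^sub>F s in at_right t0. integral {s..d} \<Phi> + (\<Sum>i\<in>UNIV. x s $ i * \<eta> i s) = regular S (\<lambda>t. x t $ k) \<phi>"
      unfolding eventually_at_right_field using eq t1(1) by (intro exI[of _ t1]) auto
  qed
  then have "regular S (\<lambda>t. x t $ k) \<phi> = y k \<phi>"
    by (simp add: tendsto_const_iff)
  then show ?thesis by (simp add: S_def)
qed

end

theorem theorem3p4:
  fixes a b :: ereal and I :: "real set"
    and A :: "real \<Rightarrow> complex^'n^'n" and t0 :: real and x0 :: "complex^'n"
    and f :: "'n::finite \<Rightarrow> distr"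
  assumes "a < b" and "I = einterval a b"
    and "\<And>i j. (\<lambda>t. A t $ i $ j) \<in> Ginf I"
    and "t0 \<in> I"
    and "\<And>i. f i \<in> RR_dual I"
    and "\<And>i. zero_before I t0 (f i)"
  shows "(\<forall>\<alpha> \<beta> y z. cauchy_solution I A f t0 x0 \<alpha> y \<and> cauchy_solution I A f t0 x0 \<beta> z
            \<longrightarrow> (\<forall>i. eq_distr I (y i) (z i))) \<and>
         (\<forall>F :: real \<Rightarrow> complex^'n.
            (\<forall>i. locally_summable I (\<lambda>t. F t $ i) \<and> eq_distr I (f i) (regular I (\<lambda>t. F t $ i)))
            \<longrightarrow> (\<forall>\<alpha> y x. cauchy_solution I A f t0 x0 \<alpha> y \<and> ordinary_solution I A F t0 x0 x
                  \<longrightarrow> (\<forall>i. \<forall>\<phi>\<in>RR I. gsupp I \<phi> \<subseteq> I \<inter> {t0<..} \<longrightarrow>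
                         y i \<phi> = regular (I \<inter> {t0<..}) (\<lambda>t. x t $ i) \<phi>)))"
proof -
  interpret open_interval I
  proof
    show "open I" "I \<noteq> {}" using assms(2,4) by auto
    have "u \<in> I" if "s \<in> I" "t \<in> I" "s \<le> u" "u \<le> t" for s t u
    proof -
      have "ereal s \<le> ereal u" "ereal u \<le> ereal t" using that by auto
      then show ?thesis
        using that(1,2) unfolding assms(2) einterval_iff by (meson le_less_trans less_le_trans)
    qed
    then show "is_interval I" unfolding is_interval_1 by blast
  qed
  show ?thesis
  proof (intro conjI allI impI ballI)
    show "eq_distr I (y i) (z i)"
      if "cauchy_solution I A f t0 x0 \<alpha> y \<and> cauchy_solution I A f t0 x0 \<beta> z" for \<alpha> \<beta> y z i
      using cauchy_solution_unique[OF assms(3,4)] that by blast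
    show "y i \<phi> = regular (I \<inter> {t0<..}) (\<lambda>t. x t $ i) \<phi>"
      if "\<forall>i. locally_summable I (\<lambda>t. F t $ i) \<and> eq_distr I (f i) (regular I (\<lambda>t. F t $ i))"
        "cauchy_solution I A f t0 x0 \<alpha> y \<and> ordinary_solution I A F t0 x0 x"
        "\<phi> \<in> RR I" "gsupp I \<phi> \<subseteq> I \<inter> {t0<..}" for F :: "real \<Rightarrow> complex^'n" and \<alpha> y x i \<phi>
      by (rule cauchy_solution_eq_ordinary_solution[OF assms(3,4) assms(6)]) (use that in auto)
  qed
qed

end
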